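(* The theories $\mathbf{emTT}^c_{\mathsf{imp}}$ and $\mathbf{emTT}_{\mathsf{imp}}$ are equiconsistent: one is consistent if and only if the other is.
   Context: A theory is consistent if it does not derive $\mathsf{true}\in\bot\ [\,]$ (empty context). $\mathbf{emTT}_{\mathsf{imp}}$ is $\mathbf{emTT}$ extended with the resizing rules: from $A\ col\ [\Gamma]$ infer $A\ set\ [\Gamma]$; from $\varphi\ prop\ [\Gamma]$ infer $\varphi\ prop_s\ [\Gamma]$. $\mathbf{emTT}^c_{\mathsf{imp}}$ is $\mathbf{emTT}_{\mathsf{imp}}$ extended with the rule $\mathsf{LEM}$: from $\varphi\ prop\ [\Gamma]$ infer $\varphi\vee\neg\varphi$ true $[\Gamma]$ (where "$\varphi$ true $[\Gamma]$" means $\mathsf{true}\in\varphi\ [\Gamma]$). THE THEORY $\mathbf{emTT}$. Judgements: $\Gamma\ ctx$, $A\ type\ [\Gamma]$, $A=B\ type\ [\Gamma]$, $a\in A\ [\Gamma]$, $a=b\in A\ [\Gamma]$, where $type$ is one of the kinds $prop_s$ (small propositions), $prop$, $set$, $col$ (collections). Contexts are lists $x_1\in A_1,\dots,x_n\in A_n$, each $A_i$ a collection in the preceding context. The common context is left implicit below. Structural rules: variables, weakening, substitution; $=$ is an equivalence relation on types and on terms; conversion; every type and term constructor (including binders) is a congruence for $=$; inclusions $prop_s\subseteq prop$, $prop_s\subseteq set$, $prop\subseteq col$, $set\subseteq col$. Formation. Propositions: $\bot$ is small; $\varphi\wedge\psi,\varphi\vee\psi,\varphi\Rightarrow\psi$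 are propositions, small if $\varphi,\psi$ are; $(\exists x\in A)\varphi$, $(\forall x\in A)\varphi$ for $A\ col$, $\varphi\ prop\ [x\in A]$, small if $A\ set$ and $\varphi\ prop_s$; $\mathsf{Eq}(A,a,b)$ (written $a=_A b$) for $A\ col$, $a,b\in A$, small if $A\ set$. Sets: $\mathsf N_0$, $\mathsf N_1$; $\mathsf{List}(A)$, $A+B$ for sets $A,B$; $(\Sigma x\in A)B$, $(\Pi x\in A)B$ for $A\ set$, $B\ set\ [x\in A]$; $A/R$ for $A\ set$ and $R(x,y)\ prop_s\ [x,y\in A]$ derivably an equivalence relation. Collections: $\mathcal P(1)$; $A\to\mathcal P(1)$ for $A\ set$; $(\Sigma x\in A)B$ for $A\ col$, $B\ col\ [x\in A]$. Terms. Propositions are proof-irrelevant: if $\varphi\ prop$ and $p\in\varphi$ then $\mathsf{true}\in\varphi$; if $p,q\in\varphi$ then $p=q\in\varphi$. The usual intuitionistic natural deduction rules hold for the connectives and quantifiers, with all proof-terms $\mathsf{true}$ and hypotheses given by context variables; eliminations are only towards propositions (not depending on the eliminated proof). $a\in A$ gives $\mathsf{true}\in\mathsf{Eq}(A,a,a)$; reflection: $\mathsf{true}\in\mathsf{Eq}(A,a,b)$ gives $a=b\in A$. $\mathsf N_0$ (no constructor), $\mathsf N_1$ (constructor $\star$), $\mathsf{List}(A)$ ($\epsilon$, $\mathsf{cons}(l,a)$), $A+B$ ($\mathsf{inl},\mathsf{inr}$), $(\Sigma x\in A)B$ ($\langle a,b\rangle$) have the usual dependent eliminators $\mathsf{El}$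 towards arbitrary dependent collections, with $\beta$-equalities. Products $(\Pi x\in A)B$ and $A\to\mathcal P(1)$ have $\lambda$, $\mathsf{Ap}$ (also written $f(a)$), $\beta$ and $\eta$. Quotients: $a\in A$ gives $[a]\in A/R$; $R(a,b)$ true gives $[a]=[b]\in A/R$; conversely $[a]=[b]\in A/R$ gives $R(a,b)$ true; eliminator $\mathsf{El_Q}(p,(x).l)\in L(p)$ for $L(z)\ col\ [z\in A/R]$, $p\in A/R$, $l(x)\in L([x])\ [x\in A]$ with $l(x)=l(y)\in L([x])\ [x,y\in A, w\in R(x,y)]$, with $\beta$. $\mathcal P(1)$: $\varphi\ prop_s$ gives $[\varphi]\in\mathcal P(1)$; for small $\varphi,\psi$, $[\varphi]=[\psi]\in\mathcal P(1)$ is derivable from $\varphi\Leftrightarrow\psi$ true, and conversely; for $U\in\mathcal P(1)$, $U=[\mathsf{Eq}(\mathcal P(1),U,[\top])]\in\mathcal P(1)$. Here $\neg\varphi:\equiv\varphi\Rightarrow\bot$, $\top:\equiv\neg\bot$, $\varphi\Leftrightarrow\psi:\equiv(\varphi\Rightarrow\psi)\wedge(\psi\Rightarrow\varphi)$. *)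

theory Defs
  imports Main
begin

text \<open>
  Raw syntax in de Bruijn style. Types and terms are mutually defined, because \<open>EqP\<close> contains
  terms and \<open>Code\<close> contains a type. Propositions are types. Arguments that live under
  binders: the second argument of \<open>Exi\<close>, \<open>Forall\<close>, \<open>Sigma\<close> and \<open>Pi\<close> binds one variable, and
  the second argument of \<open>Quot\<close> binds two (in \<open>R(x,y)\<close>, \<open>x\<close> is index 1 and \<open>y\<close> is index 0).
  In the eliminators, \<open>ElPlus p l r\<close> binds one variable in \<open>l\<close> and one in \<open>r\<close>, \<open>ElSigma p m\<close>
  binds two in \<open>m\<close>, \<open>ElList s a l\<close> binds three in \<open>l\<close>, and \<open>ElQ p l\<close> and \<open>Lam l\<close> bind one in
  \<open>l\<close>; the variable bound last always has index 0.
\<close>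

datatype ty =
    Bot
  | Conj ty ty
  | Disj ty ty
  | Impl ty ty
  | Exi ty ty
  | Forall ty ty
  | EqP ty tm tm
  | N0
  | N1
  | LIST ty
  | Plus ty ty
  | Sigma ty ty
  | Pi ty ty
  | Quot ty ty
  | P1                    \<comment> \<open>the collection \<open>P(1)\<close>\<close>
  | ToP1 ty               \<comment> \<open>the collection \<open>A \<rightarrow> P(1)\<close>\<close>
and tm =
    Var nat
  | TT                    \<comment> \<open>the canonical proof-term \<open>true\<close>\<close>
  | ElN0 tm
  | Star
  | ElN1 tm tm
  | LNil
  | LCons tm tm           \<comment> \<open>\<open>LCons l a\<close> is \<open>cons(l,a)\<close>: the list comes first\<close>
  | ElList tm tm tm
  | InL tm
  | InR tm
  | ElPlus tm tm tm
  | Pr tm tm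
  | ElSigma tm tm
  | Lam tm                \<comment> \<open>shared by \<open>Pi A B\<close> and \<open>ToP1 A\<close>, as is \<open>Ap\<close>\<close>
  | Ap tm tm
  | Cls tm                \<comment> \<open>the class \<open>[a]\<close> in a quotient\<close>
  | ElQ tm tm
  | Code ty               \<comment> \<open>the element \<open>[\<phi>]\<close> of \<open>P(1)\<close>\<close>

abbreviation Neg :: "ty \<Rightarrow> ty" where "Neg \<phi> \<equiv> Impl \<phi> Bot"
abbreviation Top :: ty where "Top \<equiv> Neg Bot"
abbreviation Iff :: "ty \<Rightarrow> ty \<Rightarrow> ty" where "Iff \<phi> \<psi> \<equiv> Conj (Impl \<phi> \<psi>) (Impl \<psi> \<phi>)"


section \<open>Parallel substitution\<close>

fun lift_ren :: "(nat \<Rightarrow> nat) \<Rightarrow> nat \<Rightarrow> nat" where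
  "lift_ren \<rho> 0 = 0"
| "lift_ren \<rho> (Suc n) = Suc (\<rho> n)"

primrec ren_ty :: "(nat \<Rightarrow> nat) \<Rightarrow> ty \<Rightarrow> ty" and ren_tm :: "(nat \<Rightarrow> nat) \<Rightarrow> tm \<Rightarrow> tm" where
  "ren_ty \<rho> Bot = Bot"
| "ren_ty \<rho> (Conj A B) = Conj (ren_ty \<rho> A) (ren_ty \<rho> B)"
| "ren_ty \<rho> (Disj A B) = Disj (ren_ty \<rho> A) (ren_ty \<rho> B)"
| "ren_ty \<rho> (Impl A B) = Impl (ren_ty \<rho> A) (ren_ty \<rho> B)"
| "ren_ty \<rho> (Exi A B) = Exi (ren_ty \<rho> A) (ren_ty (lift_ren \<rho>) B)"
| "ren_ty \<rho> (Forall A B) = Forall (ren_ty \<rho> A) (ren_ty (lift_ren \<rho>) B)"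
| "ren_ty \<rho> (EqP A a b) = EqP (ren_ty \<rho> A) (ren_tm \<rho> a) (ren_tm \<rho> b)"
| "ren_ty \<rho> N0 = N0"
| "ren_ty \<rho> N1 = N1"
| "ren_ty \<rho> (LIST A) = LIST (ren_ty \<rho> A)"
| "ren_ty \<rho> (Plus A B) = Plus (ren_ty \<rho> A) (ren_ty \<rho> B)"
| "ren_ty \<rho> (Sigma A B) = Sigma (ren_ty \<rho> A) (ren_ty (lift_ren \<rho>) B)"
| "ren_ty \<rho> (Pi A B) = Pi (ren_ty \<rho> A) (ren_ty (lift_ren \<rho>) B)"
| "ren_ty \<rho> (Quot A R) = Quot (ren_ty \<rho> A) (ren_ty (lift_ren (lift_ren \<rho>)) R)"
| "ren_ty \<rho> P1 = P1"
| "ren_ty \<rho> (ToP1 A) = ToP1 (ren_ty \<rho> A)"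
| "ren_tm \<rho> (Var n) = Var (\<rho> n)"
| "ren_tm \<rho> TT = TT"
| "ren_tm \<rho> (ElN0 p) = ElN0 (ren_tm \<rho> p)"
| "ren_tm \<rho> Star = Star"
| "ren_tm \<rho> (ElN1 p c) = ElN1 (ren_tm \<rho> p) (ren_tm \<rho> c)"
| "ren_tm \<rho> LNil = LNil"
| "ren_tm \<rho> (LCons s a) = LCons (ren_tm \<rho> s) (ren_tm \<rho> a)"
| "ren_tm \<rho> (ElList s a l) =
     ElList (ren_tm \<rho> s) (ren_tm \<rho> a) (ren_tm (lift_ren (lift_ren (lift_ren \<rho>))) l)"
| "ren_tm \<rho> (InL a) = InL (ren_tm \<rho> a)"
| "ren_tm \<rho> (InR a) = InR (ren_tm \<rho> a)"
| "ren_tm \<rho> (ElPlus p l r) =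
     ElPlus (ren_tm \<rho> p) (ren_tm (lift_ren \<rho>) l) (ren_tm (lift_ren \<rho>) r)"
| "ren_tm \<rho> (Pr a b) = Pr (ren_tm \<rho> a) (ren_tm \<rho> b)"
| "ren_tm \<rho> (ElSigma p m) = ElSigma (ren_tm \<rho> p) (ren_tm (lift_ren (lift_ren \<rho>)) m)"
| "ren_tm \<rho> (Lam b) = Lam (ren_tm (lift_ren \<rho>) b)"
| "ren_tm \<rho> (Ap f a) = Ap (ren_tm \<rho> f) (ren_tm \<rho> a)"
| "ren_tm \<rho> (Cls a) = Cls (ren_tm \<rho> a)"
| "ren_tm \<rho> (ElQ p l) = ElQ (ren_tm \<rho> p) (ren_tm (lift_ren \<rho>) l)"
| "ren_tm \<rho> (Code \<phi>) = Code (ren_ty \<rho> \<phi>)"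

primrec scons :: "tm \<Rightarrow> (nat \<Rightarrow> tm) \<Rightarrow> nat \<Rightarrow> tm"  (infixr "\<cdot>" 70) where
  "(a \<cdot> \<sigma>) 0 = a"
| "(a \<cdot> \<sigma>) (Suc n) = \<sigma> n"

definition shift :: "nat \<Rightarrow> nat \<Rightarrow> tm" where
  "shift k = (\<lambda>n. Var (n + k))"

definition lift_sub :: "(nat \<Rightarrow> tm) \<Rightarrow> nat \<Rightarrow> tm" where
  "lift_sub \<sigma> = Var 0 \<cdot> (\<lambda>n. ren_tm Suc (\<sigma> n))"

primrec sub_ty :: "(nat \<Rightarrow> tm) \<Rightarrow> ty \<Rightarrow> ty" and sub_tm :: "(nat \<Rightarrow> tm) \<Rightarrow> tm \<Rightarrow> tm" where
  "sub_ty \<sigma> Bot = Bot"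
| "sub_ty \<sigma> (Conj A B) = Conj (sub_ty \<sigma> A) (sub_ty \<sigma> B)"
| "sub_ty \<sigma> (Disj A B) = Disj (sub_ty \<sigma> A) (sub_ty \<sigma> B)"
| "sub_ty \<sigma> (Impl A B) = Impl (sub_ty \<sigma> A) (sub_ty \<sigma> B)"
| "sub_ty \<sigma> (Exi A B) = Exi (sub_ty \<sigma> A) (sub_ty (lift_sub \<sigma>) B)"
| "sub_ty \<sigma> (Forall A B) = Forall (sub_ty \<sigma> A) (sub_ty (lift_sub \<sigma>) B)"
| "sub_ty \<sigma> (EqP A a b) = EqP (sub_ty \<sigma> A) (sub_tm \<sigma> a) (sub_tm \<sigma> b)"
| "sub_ty \<sigma> N0 = N0"
| "sub_ty \<sigma> N1 = N1"
| "sub_ty \<sigma> (LIST A) = LIST (sub_ty \<sigma> A)"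
| "sub_ty \<sigma> (Plus A B) = Plus (sub_ty \<sigma> A) (sub_ty \<sigma> B)"
| "sub_ty \<sigma> (Sigma A B) = Sigma (sub_ty \<sigma> A) (sub_ty (lift_sub \<sigma>) B)"
| "sub_ty \<sigma> (Pi A B) = Pi (sub_ty \<sigma> A) (sub_ty (lift_sub \<sigma>) B)"
| "sub_ty \<sigma> (Quot A R) = Quot (sub_ty \<sigma> A) (sub_ty (lift_sub (lift_sub \<sigma>)) R)"
| "sub_ty \<sigma> P1 = P1"
| "sub_ty \<sigma> (ToP1 A) = ToP1 (sub_ty \<sigma> A)"
| "sub_tm \<sigma> (Var n) = \<sigma> n"
| "sub_tm \<sigma> TT = TT"
| "sub_tm \<sigma> (ElN0 p) = ElN0 (sub_tm \<sigma> p)"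
| "sub_tm \<sigma> Star = Star"
| "sub_tm \<sigma> (ElN1 p c) = ElN1 (sub_tm \<sigma> p) (sub_tm \<sigma> c)"
| "sub_tm \<sigma> LNil = LNil"
| "sub_tm \<sigma> (LCons s a) = LCons (sub_tm \<sigma> s) (sub_tm \<sigma> a)"
| "sub_tm \<sigma> (ElList s a l) =
     ElList (sub_tm \<sigma> s) (sub_tm \<sigma> a) (sub_tm (lift_sub (lift_sub (lift_sub \<sigma>))) l)"
| "sub_tm \<sigma> (InL a) = InL (sub_tm \<sigma> a)"
| "sub_tm \<sigma> (InR a) = InR (sub_tm \<sigma> a)"
| "sub_tm \<sigma> (ElPlus p l r) =
     ElPlus (sub_tm \<sigma> p) (sub_tm (lift_sub \<sigma>) l) (sub_tm (lift_sub \<sigma>) r)"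
| "sub_tm \<sigma> (Pr a b) = Pr (sub_tm \<sigma> a) (sub_tm \<sigma> b)"
| "sub_tm \<sigma> (ElSigma p m) = ElSigma (sub_tm \<sigma> p) (sub_tm (lift_sub (lift_sub \<sigma>)) m)"
| "sub_tm \<sigma> (Lam b) = Lam (sub_tm (lift_sub \<sigma>) b)"
| "sub_tm \<sigma> (Ap f a) = Ap (sub_tm \<sigma> f) (sub_tm \<sigma> a)"
| "sub_tm \<sigma> (Cls a) = Cls (sub_tm \<sigma> a)"
| "sub_tm \<sigma> (ElQ p l) = ElQ (sub_tm \<sigma> p) (sub_tm (lift_sub \<sigma>) l)"
| "sub_tm \<sigma> (Code \<phi>) = Code (sub_ty \<sigma> \<phi>)"

text \<open>
  The parameter \<open>k\<close> below is the number of variables by which the context has been extended: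
  if \<open>B(x)\<close> lives in \<open>\<Gamma>, x\<close> then \<open>inst_ty k a B\<close> is \<open>B(a)\<close> in an extension of \<open>\<Gamma>\<close>
  by \<open>k\<close> variables. In the instantiations of several variables the arguments are listed in the
  order of binding, so \<open>inst2_ty k a b R\<close> is \<open>R(a,b)\<close>.
\<close>

abbreviation wk_ty :: "nat \<Rightarrow> ty \<Rightarrow> ty" where
  "wk_ty k A \<equiv> sub_ty (shift k) A"
abbreviation wk_tm :: "nat \<Rightarrow> tm \<Rightarrow> tm" where
  "wk_tm k a \<equiv> sub_tm (shift k) a"
abbreviation inst_ty :: "nat \<Rightarrow> tm \<Rightarrow> ty \<Rightarrow> ty" where
  "inst_ty k a B \<equiv> sub_ty (a \<cdot> shift k) B"
abbreviation inst_tm :: "nat \<Rightarrow> tm \<Rightarrow> tm \<Rightarrow> tm" where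
  "inst_tm k a b \<equiv> sub_tm (a \<cdot> shift k) b"
abbreviation inst2_ty :: "nat \<Rightarrow> tm \<Rightarrow> tm \<Rightarrow> ty \<Rightarrow> ty" where
  "inst2_ty k a b R \<equiv> sub_ty (b \<cdot> a \<cdot> shift k) R"
abbreviation inst2_tm :: "nat \<Rightarrow> tm \<Rightarrow> tm \<Rightarrow> tm \<Rightarrow> tm" where
  "inst2_tm k a b m \<equiv> sub_tm (b \<cdot> a \<cdot> shift k) m"
abbreviation inst3_tm :: "nat \<Rightarrow> tm \<Rightarrow> tm \<Rightarrow> tm \<Rightarrow> tm \<Rightarrow> tm" where
  "inst3_tm k a b c l \<equiv> sub_tm (c \<cdot> b \<cdot> a \<cdot> shift k) l"


section \<open>Judgements\<close>

datatype kind = PropS | Prop | Set | Col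

text \<open>The kind over which quantification and equality yield a proposition of the given kind.\<close>
fun dom_kind :: "kind \<Rightarrow> kind" where
  "dom_kind PropS = Set"
| "dom_kind Prop = Col"
| "dom_kind k = k"

inductive kind_incl :: "kind \<Rightarrow> kind \<Rightarrow> bool" where
  "kind_incl PropS Prop"
| "kind_incl PropS Set"
| "kind_incl Prop Col"
| "kind_incl Set Col"

text \<open>Contexts are listed with the most recent variable first.\<close>
type_synonym ctx = "ty list"

datatype judgement =
    Ctx
  | Ty kind ty            \<comment> \<open>\<open>A k [\<Gamma>]\<close>\<close>
  | TyEq kind ty ty       \<comment> \<open>\<open>A = B k [\<Gamma>]\<close>\<close>
  | Tm tm ty              \<comment> \<open>\<open>a \<in> A [\<Gamma>]\<close>\<close>
  | TmEq tm tm ty         \<comment> \<open>\<open>a = b \<in> A [\<Gamma>]\<close>\<close>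

primrec sub_judgement :: "(nat \<Rightarrow> tm) \<Rightarrow> judgement \<Rightarrow> judgement" where
  "sub_judgement \<sigma> Ctx = Ctx"
| "sub_judgement \<sigma> (Ty k A) = Ty k (sub_ty \<sigma> A)"
| "sub_judgement \<sigma> (TyEq k A B) = TyEq k (sub_ty \<sigma> A) (sub_ty \<sigma> B)"
| "sub_judgement \<sigma> (Tm a A) = Tm (sub_tm \<sigma> a) (sub_ty \<sigma> A)"
| "sub_judgement \<sigma> (TmEq a b A) = TmEq (sub_tm \<sigma> a) (sub_tm \<sigma> b) (sub_ty \<sigma> A)"

definition var_ty :: "ctx \<Rightarrow> nat \<Rightarrow> ty" where
  "var_ty \<Gamma> i = wk_ty (Suc i) (\<Gamma> ! i)"


section \<open>Derivability\<close>

datatype system = emTT | emTT_imp | emTT_imp_c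

text \<open>
  All rules are common to the three systems, except for the resizing rules and \<open>lem\<close>, which carry
  a side condition on \<open>T\<close>. Presuppositions of rules are spelled out as premises. Substitution is
  simultaneous for all variables of a context. Inclusions and resizing act on type equalities
  too: these are the congruence rules of the corresponding changes of kind. Eliminators have no
  motive argument and \<open>Lam\<close> no domain annotation, so the motive \<open>L\<close> occurs in the premises only.
\<close>

inductive derives :: "system \<Rightarrow> ctx \<Rightarrow> judgement \<Rightarrow> bool"  ("(_ \<rhd> _ \<turnstile> _)" [51, 51, 51] 50)
  for T :: system
where
  \<comment> \<open>contexts and structural rules\<close>
  ctx_empty: "T \<rhd> [] \<turnstile> Ctx"
| ctx_ext: "\<lbrakk>T \<rhd> \<Gamma> \<turnstile> Ctx; T \<rhd> \<Gamma> \<turnstile> Ty Col A\<rbrakk> \<Longrightarrow> T \<rhd> A # \<Gamma> \<turnstile> Ctx"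
| var: "\<lbrakk>T \<rhd> \<Gamma> \<turnstile> Ctx; i < length \<Gamma>\<rbrakk> \<Longrightarrow> T \<rhd> \<Gamma> \<turnstile> Tm (Var i) (var_ty \<Gamma> i)"
| weakening: "\<lbrakk>T \<rhd> \<Gamma> \<turnstile> J; T \<rhd> \<Gamma> \<turnstile> Ty Col A\<rbrakk> \<Longrightarrow> T \<rhd> A # \<Gamma> \<turnstile> sub_judgement (shift 1) J"
| substitution:
    "\<lbrakk>T \<rhd> \<Gamma> \<turnstile> J; T \<rhd> \<Delta> \<turnstile> Ctx;
      \<forall>i < length \<Gamma>. T \<rhd> \<Delta> \<turnstile> Tm (\<sigma> i) (sub_ty \<sigma> (var_ty \<Gamma> i))\<rbrakk>
     \<Longrightarrow> T \<rhd> \<Delta> \<turnstile> sub_judgement \<sigma> J"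
| substitution_ty_eq:
    "\<lbrakk>T \<rhd> \<Gamma> \<turnstile> Ty k A; T \<rhd> \<Delta> \<turnstile> Ctx;
      \<forall>i < length \<Gamma>. T \<rhd> \<Delta> \<turnstile> Tm (\<sigma> i) (sub_ty \<sigma> (var_ty \<Gamma> i));
      \<forall>i < length \<Gamma>. T \<rhd> \<Delta> \<turnstile> Tm (\<tau> i) (sub_ty \<tau> (var_ty \<Gamma> i));
      \<forall>i < length \<Gamma>. T \<rhd> \<Delta> \<turnstile> TmEq (\<sigma> i) (\<tau> i) (sub_ty \<sigma> (var_ty \<Gamma> i))\<rbrakk>
     \<Longrightarrow> T \<rhd> \<Delta> \<turnstile> TyEq k (sub_ty \<sigma> A) (sub_ty \<tau> A)"
| substitution_tm_eq:
    "\<lbrakk>T \<rhd> \<Gamma> \<turnstile> Tm a A; T \<rhd> \<Delta> \<turnstile> Ctx;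
      \<forall>i < length \<Gamma>. T \<rhd> \<Delta> \<turnstile> Tm (\<sigma> i) (sub_ty \<sigma> (var_ty \<Gamma> i));
      \<forall>i < length \<Gamma>. T \<rhd> \<Delta> \<turnstile> Tm (\<tau> i) (sub_ty \<tau> (var_ty \<Gamma> i));
      \<forall>i < length \<Gamma>. T \<rhd> \<Delta> \<turnstile> TmEq (\<sigma> i) (\<tau> i) (sub_ty \<sigma> (var_ty \<Gamma> i))\<rbrakk>
     \<Longrightarrow> T \<rhd> \<Delta> \<turnstile> TmEq (sub_tm \<sigma> a) (sub_tm \<tau> a) (sub_ty \<sigma> A)"
| ty_refl: "T \<rhd> \<Gamma> \<turnstile> Ty k A \<Longrightarrow> T \<rhd> \<Gamma> \<turnstile> TyEq k A A"
| ty_sym: "T \<rhd> \<Gamma> \<turnstile> TyEq k A B \<Longrightarrow> T \<rhd> \<Gamma> \<turnstile> TyEq k B A"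
| ty_trans: "\<lbrakk>T \<rhd> \<Gamma> \<turnstile> TyEq k A B; T \<rhd> \<Gamma> \<turnstile> TyEq k B C\<rbrakk> \<Longrightarrow> T \<rhd> \<Gamma> \<turnstile> TyEq k A C"
| tm_refl: "T \<rhd> \<Gamma> \<turnstile> Tm a A \<Longrightarrow> T \<rhd> \<Gamma> \<turnstile> TmEq a a A"
| tm_sym: "T \<rhd> \<Gamma> \<turnstile> TmEq a b A \<Longrightarrow> T \<rhd> \<Gamma> \<turnstile> TmEq b a A"
| tm_trans: "\<lbrakk>T \<rhd> \<Gamma> \<turnstile> TmEq a b A; T \<rhd> \<Gamma> \<turnstile> TmEq b c A\<rbrakk> \<Longrightarrow> T \<rhd> \<Gamma> \<turnstile> TmEq a c A"
| tm_conv: "\<lbrakk>T \<rhd> \<Gamma> \<turnstile> Tm a A; T \<rhd> \<Gamma> \<turnstile> TyEq Col A B\<rbrakk> \<Longrightarrow> T \<rhd> \<Gamma> \<turnstile> Tm a B"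
| tm_eq_conv: "\<lbrakk>T \<rhd> \<Gamma> \<turnstile> TmEq a b A; T \<rhd> \<Gamma> \<turnstile> TyEq Col A B\<rbrakk> \<Longrightarrow> T \<rhd> \<Gamma> \<turnstile> TmEq a b B"

  \<comment> \<open>inclusions between kinds, resizing, excluded middle\<close>
| ty_incl: "\<lbrakk>T \<rhd> \<Gamma> \<turnstile> Ty k A; kind_incl k k'\<rbrakk> \<Longrightarrow> T \<rhd> \<Gamma> \<turnstile> Ty k' A"
| ty_eq_incl: "\<lbrakk>T \<rhd> \<Gamma> \<turnstile> TyEq k A B; kind_incl k k'\<rbrakk> \<Longrightarrow> T \<rhd> \<Gamma> \<turnstile> TyEq k' A B"
| resize_col: "\<lbrakk>T \<in> {emTT_imp, emTT_imp_c}; T \<rhd> \<Gamma> \<turnstile> Ty Col A\<rbrakk> \<Longrightarrow> T \<rhd> \<Gamma> \<turnstile> Ty Set A"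
| resize_col_eq:
    "\<lbrakk>T \<in> {emTT_imp, emTT_imp_c}; T \<rhd> \<Gamma> \<turnstile> TyEq Col A B\<rbrakk> \<Longrightarrow> T \<rhd> \<Gamma> \<turnstile> TyEq Set A B"
| resize_prop: "\<lbrakk>T \<in> {emTT_imp, emTT_imp_c}; T \<rhd> \<Gamma> \<turnstile> Ty Prop \<phi>\<rbrakk> \<Longrightarrow> T \<rhd> \<Gamma> \<turnstile> Ty PropS \<phi>"
| resize_prop_eq:
    "\<lbrakk>T \<in> {emTT_imp, emTT_imp_c}; T \<rhd> \<Gamma> \<turnstile> TyEq Prop \<phi> \<psi>\<rbrakk> \<Longrightarrow> T \<rhd> \<Gamma> \<turnstile> TyEq PropS \<phi> \<psi>"
| lem: "\<lbrakk>T = emTT_imp_c; T \<rhd> \<Gamma> \<turnstile> Ty Prop \<phi>\<rbrakk> \<Longrightarrow> T \<rhd> \<Gamma> \<turnstile> Tm TT (Disj \<phi> (Neg \<phi>))"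

  \<comment> \<open>formation and congruence of propositions\<close>
| bot_form: "T \<rhd> \<Gamma> \<turnstile> Ctx \<Longrightarrow> T \<rhd> \<Gamma> \<turnstile> Ty PropS Bot"
| conj_form:
    "\<lbrakk>k \<in> {PropS, Prop}; T \<rhd> \<Gamma> \<turnstile> Ty k \<phi>; T \<rhd> \<Gamma> \<turnstile> Ty k \<psi>\<rbrakk> \<Longrightarrow> T \<rhd> \<Gamma> \<turnstile> Ty k (Conj \<phi> \<psi>)"
| conj_form_cong:
    "\<lbrakk>k \<in> {PropS, Prop}; T \<rhd> \<Gamma> \<turnstile> TyEq k \<phi> \<phi>'; T \<rhd> \<Gamma> \<turnstile> TyEq k \<psi> \<psi>'\<rbrakk>
     \<Longrightarrow> T \<rhd> \<Gamma> \<turnstile> TyEq k (Conj \<phi> \<psi>) (Conj \<phi>' \<psi>')"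
| disj_form:
    "\<lbrakk>k \<in> {PropS, Prop}; T \<rhd> \<Gamma> \<turnstile> Ty k \<phi>; T \<rhd> \<Gamma> \<turnstile> Ty k \<psi>\<rbrakk> \<Longrightarrow> T \<rhd> \<Gamma> \<turnstile> Ty k (Disj \<phi> \<psi>)"
| disj_form_cong:
    "\<lbrakk>k \<in> {PropS, Prop}; T \<rhd> \<Gamma> \<turnstile> TyEq k \<phi> \<phi>'; T \<rhd> \<Gamma> \<turnstile> TyEq k \<psi> \<psi>'\<rbrakk>
     \<Longrightarrow> T \<rhd> \<Gamma> \<turnstile> TyEq k (Disj \<phi> \<psi>) (Disj \<phi>' \<psi>')"
| impl_form:
    "\<lbrakk>k \<in> {PropS, Prop}; T \<rhd> \<Gamma> \<turnstile> Ty k \<phi>; T \<rhd> \<Gamma> \<turnstile> Ty k \<psi>\<rbrakk> \<Longrightarrow> T \<rhd> \<Gamma> \<turnstile> Ty k (Impl \<phi> \<psi>)"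
| impl_form_cong:
    "\<lbrakk>k \<in> {PropS, Prop}; T \<rhd> \<Gamma> \<turnstile> TyEq k \<phi> \<phi>'; T \<rhd> \<Gamma> \<turnstile> TyEq k \<psi> \<psi>'\<rbrakk>
     \<Longrightarrow> T \<rhd> \<Gamma> \<turnstile> TyEq k (Impl \<phi> \<psi>) (Impl \<phi>' \<psi>')"
| exi_form:
    "\<lbrakk>k \<in> {PropS, Prop}; T \<rhd> \<Gamma> \<turnstile> Ty (dom_kind k) A; T \<rhd> A # \<Gamma> \<turnstile> Ty k \<phi>\<rbrakk>
     \<Longrightarrow> T \<rhd> \<Gamma> \<turnstile> Ty k (Exi A \<phi>)"
| exi_form_cong:
    "\<lbrakk>k \<in> {PropS, Prop}; T \<rhd> \<Gamma> \<turnstile> TyEq (dom_kind k) A A'; T \<rhd> A # \<Gamma> \<turnstile> TyEq k \<phi> \<phi>'\<rbrakk>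
     \<Longrightarrow> T \<rhd> \<Gamma> \<turnstile> TyEq k (Exi A \<phi>) (Exi A' \<phi>')"
| forall_form:
    "\<lbrakk>k \<in> {PropS, Prop}; T \<rhd> \<Gamma> \<turnstile> Ty (dom_kind k) A; T \<rhd> A # \<Gamma> \<turnstile> Ty k \<phi>\<rbrakk>
     \<Longrightarrow> T \<rhd> \<Gamma> \<turnstile> Ty k (Forall A \<phi>)"
| forall_form_cong:
    "\<lbrakk>k \<in> {PropS, Prop}; T \<rhd> \<Gamma> \<turnstile> TyEq (dom_kind k) A A'; T \<rhd> A # \<Gamma> \<turnstile> TyEq k \<phi> \<phi>'\<rbrakk>
     \<Longrightarrow> T \<rhd> \<Gamma> \<turnstile> TyEq k (Forall A \<phi>) (Forall A' \<phi>')"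
| eq_form:
    "\<lbrakk>k \<in> {PropS, Prop}; T \<rhd> \<Gamma> \<turnstile> Ty (dom_kind k) A; T \<rhd> \<Gamma> \<turnstile> Tm a A; T \<rhd> \<Gamma> \<turnstile> Tm b A\<rbrakk>
     \<Longrightarrow> T \<rhd> \<Gamma> \<turnstile> Ty k (EqP A a b)"
| eq_form_cong:
    "\<lbrakk>k \<in> {PropS, Prop}; T \<rhd> \<Gamma> \<turnstile> TyEq (dom_kind k) A A';
      T \<rhd> \<Gamma> \<turnstile> TmEq a a' A; T \<rhd> \<Gamma> \<turnstile> TmEq b b' A\<rbrakk>
     \<Longrightarrow> T \<rhd> \<Gamma> \<turnstile> TyEq k (EqP A a b) (EqP A' a' b')"

  \<comment> \<open>formation and congruence of sets and collections\<close>
| n0_form: "T \<rhd> \<Gamma> \<turnstile> Ctx \<Longrightarrow> T \<rhd> \<Gamma> \<turnstile> Ty Set N0"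
| n1_form: "T \<rhd> \<Gamma> \<turnstile> Ctx \<Longrightarrow> T \<rhd> \<Gamma> \<turnstile> Ty Set N1"
| list_form: "T \<rhd> \<Gamma> \<turnstile> Ty Set A \<Longrightarrow> T \<rhd> \<Gamma> \<turnstile> Ty Set (LIST A)"
| list_form_cong: "T \<rhd> \<Gamma> \<turnstile> TyEq Set A A' \<Longrightarrow> T \<rhd> \<Gamma> \<turnstile> TyEq Set (LIST A) (LIST A')"
| plus_form: "\<lbrakk>T \<rhd> \<Gamma> \<turnstile> Ty Set A; T \<rhd> \<Gamma> \<turnstile> Ty Set B\<rbrakk> \<Longrightarrow> T \<rhd> \<Gamma> \<turnstile> Ty Set (Plus A B)"
| plus_form_cong:
    "\<lbrakk>T \<rhd> \<Gamma> \<turnstile> TyEq Set A A'; T \<rhd> \<Gamma> \<turnstile> TyEq Set B B'\<rbrakk>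
     \<Longrightarrow> T \<rhd> \<Gamma> \<turnstile> TyEq Set (Plus A B) (Plus A' B')"
| sigma_form:
    "\<lbrakk>k \<in> {Set, Col}; T \<rhd> \<Gamma> \<turnstile> Ty k A; T \<rhd> A # \<Gamma> \<turnstile> Ty k B\<rbrakk> \<Longrightarrow> T \<rhd> \<Gamma> \<turnstile> Ty k (Sigma A B)"
| sigma_form_cong:
    "\<lbrakk>k \<in> {Set, Col}; T \<rhd> \<Gamma> \<turnstile> TyEq k A A'; T \<rhd> A # \<Gamma> \<turnstile> TyEq k B B'\<rbrakk>
     \<Longrightarrow> T \<rhd> \<Gamma> \<turnstile> TyEq k (Sigma A B) (Sigma A' B')"
| pi_form: "\<lbrakk>T \<rhd> \<Gamma> \<turnstile> Ty Set A; T \<rhd> A # \<Gamma> \<turnstile> Ty Set B\<rbrakk> \<Longrightarrow> T \<rhd> \<Gamma> \<turnstile> Ty Set (Pi A B)"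
| pi_form_cong:
    "\<lbrakk>T \<rhd> \<Gamma> \<turnstile> TyEq Set A A'; T \<rhd> A # \<Gamma> \<turnstile> TyEq Set B B'\<rbrakk>
     \<Longrightarrow> T \<rhd> \<Gamma> \<turnstile> TyEq Set (Pi A B) (Pi A' B')"
  \<comment> \<open>the last three premises say that \<open>R\<close> is derivably reflexive, symmetric and transitive\<close>
| quot_form:
    "\<lbrakk>T \<rhd> \<Gamma> \<turnstile> Ty Set A; T \<rhd> wk_ty 1 A # A # \<Gamma> \<turnstile> Ty PropS R;
      T \<rhd> A # \<Gamma> \<turnstile> Tm TT (inst2_ty 1 (Var 0) (Var 0) R);
      T \<rhd> R # wk_ty 1 A # A # \<Gamma> \<turnstile> Tm TT (inst2_ty 3 (Var 1) (Var 2) R);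
      T \<rhd> inst2_ty 4 (Var 2) (Var 1) R # inst2_ty 3 (Var 2) (Var 1) R
          # wk_ty 2 A # wk_ty 1 A # A # \<Gamma> \<turnstile> Tm TT (inst2_ty 5 (Var 4) (Var 2) R)\<rbrakk>
     \<Longrightarrow> T \<rhd> \<Gamma> \<turnstile> Ty Set (Quot A R)"
| quot_form_cong:
    "\<lbrakk>T \<rhd> \<Gamma> \<turnstile> Ty Set (Quot A R); T \<rhd> \<Gamma> \<turnstile> Ty Set (Quot A' R');
      T \<rhd> \<Gamma> \<turnstile> TyEq Set A A'; T \<rhd> wk_ty 1 A # A # \<Gamma> \<turnstile> TyEq PropS R R'\<rbrakk>
     \<Longrightarrow> T \<rhd> \<Gamma> \<turnstile> TyEq Set (Quot A R) (Quot A' R')"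
| p1_form: "T \<rhd> \<Gamma> \<turnstile> Ctx \<Longrightarrow> T \<rhd> \<Gamma> \<turnstile> Ty Col P1"
| top1_form: "T \<rhd> \<Gamma> \<turnstile> Ty Set A \<Longrightarrow> T \<rhd> \<Gamma> \<turnstile> Ty Col (ToP1 A)"
| top1_form_cong: "T \<rhd> \<Gamma> \<turnstile> TyEq Set A A' \<Longrightarrow> T \<rhd> \<Gamma> \<turnstile> TyEq Col (ToP1 A) (ToP1 A')"

  \<comment> \<open>proof irrelevance and intuitionistic natural deduction\<close>
| proof_true: "\<lbrakk>T \<rhd> \<Gamma> \<turnstile> Ty Prop \<phi>; T \<rhd> \<Gamma> \<turnstile> Tm p \<phi>\<rbrakk> \<Longrightarrow> T \<rhd> \<Gamma> \<turnstile> Tm TT \<phi>"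
| proof_irrelevance:
    "\<lbrakk>T \<rhd> \<Gamma> \<turnstile> Ty Prop \<phi>; T \<rhd> \<Gamma> \<turnstile> Tm p \<phi>; T \<rhd> \<Gamma> \<turnstile> Tm q \<phi>\<rbrakk> \<Longrightarrow> T \<rhd> \<Gamma> \<turnstile> TmEq p q \<phi>"
| bot_elim: "\<lbrakk>T \<rhd> \<Gamma> \<turnstile> Tm TT Bot; T \<rhd> \<Gamma> \<turnstile> Ty Prop \<chi>\<rbrakk> \<Longrightarrow> T \<rhd> \<Gamma> \<turnstile> Tm TT \<chi>"
| conj_intro:
    "\<lbrakk>T \<rhd> \<Gamma> \<turnstile> Ty Prop \<phi>; T \<rhd> \<Gamma> \<turnstile> Ty Prop \<psi>; T \<rhd> \<Gamma> \<turnstile> Tm TT \<phi>; T \<rhd> \<Gamma> \<turnstile> Tm TT \<psi>\<rbrakk>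
     \<Longrightarrow> T \<rhd> \<Gamma> \<turnstile> Tm TT (Conj \<phi> \<psi>)"
| conj_elim1:
    "\<lbrakk>T \<rhd> \<Gamma> \<turnstile> Ty Prop \<phi>; T \<rhd> \<Gamma> \<turnstile> Ty Prop \<psi>; T \<rhd> \<Gamma> \<turnstile> Tm TT (Conj \<phi> \<psi>)\<rbrakk> \<Longrightarrow> T \<rhd> \<Gamma> \<turnstile> Tm TT \<phi>"
| conj_elim2:
    "\<lbrakk>T \<rhd> \<Gamma> \<turnstile> Ty Prop \<phi>; T \<rhd> \<Gamma> \<turnstile> Ty Prop \<psi>; T \<rhd> \<Gamma> \<turnstile> Tm TT (Conj \<phi> \<psi>)\<rbrakk> \<Longrightarrow> T \<rhd> \<Gamma> \<turnstile> Tm TT \<psi>"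
| disj_intro1:
    "\<lbrakk>T \<rhd> \<Gamma> \<turnstile> Ty Prop \<phi>; T \<rhd> \<Gamma> \<turnstile> Ty Prop \<psi>; T \<rhd> \<Gamma> \<turnstile> Tm TT \<phi>\<rbrakk> \<Longrightarrow> T \<rhd> \<Gamma> \<turnstile> Tm TT (Disj \<phi> \<psi>)"
| disj_intro2:
    "\<lbrakk>T \<rhd> \<Gamma> \<turnstile> Ty Prop \<phi>; T \<rhd> \<Gamma> \<turnstile> Ty Prop \<psi>; T \<rhd> \<Gamma> \<turnstile> Tm TT \<psi>\<rbrakk> \<Longrightarrow> T \<rhd> \<Gamma> \<turnstile> Tm TT (Disj \<phi> \<psi>)"
| disj_elim:
    "\<lbrakk>T \<rhd> \<Gamma> \<turnstile> Ty Prop \<phi>; T \<rhd> \<Gamma> \<turnstile> Ty Prop \<psi>; T \<rhd> \<Gamma> \<turnstile> Ty Prop \<chi>;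
      T \<rhd> \<Gamma> \<turnstile> Tm TT (Disj \<phi> \<psi>);
      T \<rhd> \<phi> # \<Gamma> \<turnstile> Tm TT (wk_ty 1 \<chi>); T \<rhd> \<psi> # \<Gamma> \<turnstile> Tm TT (wk_ty 1 \<chi>)\<rbrakk>
     \<Longrightarrow> T \<rhd> \<Gamma> \<turnstile> Tm TT \<chi>"
| impl_intro:
    "\<lbrakk>T \<rhd> \<Gamma> \<turnstile> Ty Prop \<phi>; T \<rhd> \<Gamma> \<turnstile> Ty Prop \<psi>; T \<rhd> \<phi> # \<Gamma> \<turnstile> Tm TT (wk_ty 1 \<psi>)\<rbrakk>
     \<Longrightarrow> T \<rhd> \<Gamma> \<turnstile> Tm TT (Impl \<phi> \<psi>)"
| impl_elim:
    "\<lbrakk>T \<rhd> \<Gamma> \<turnstile> Ty Prop \<phi>; T \<rhd> \<Gamma> \<turnstile> Ty Prop \<psi>; T \<rhd> \<Gamma> \<turnstile> Tm TT (Impl \<phi> \<psi>); T \<rhd> \<Gamma> \<turnstile> Tm TT \<phi>\<rbrakk>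
     \<Longrightarrow> T \<rhd> \<Gamma> \<turnstile> Tm TT \<psi>"
| exi_intro:
    "\<lbrakk>T \<rhd> \<Gamma> \<turnstile> Ty Col A; T \<rhd> A # \<Gamma> \<turnstile> Ty Prop \<phi>; T \<rhd> \<Gamma> \<turnstile> Tm a A; T \<rhd> \<Gamma> \<turnstile> Tm TT (inst_ty 0 a \<phi>)\<rbrakk>
     \<Longrightarrow> T \<rhd> \<Gamma> \<turnstile> Tm TT (Exi A \<phi>)"
| exi_elim:
    "\<lbrakk>T \<rhd> \<Gamma> \<turnstile> Ty Col A; T \<rhd> A # \<Gamma> \<turnstile> Ty Prop \<phi>; T \<rhd> \<Gamma> \<turnstile> Ty Prop \<chi>;
      T \<rhd> \<Gamma> \<turnstile> Tm TT (Exi A \<phi>); T \<rhd> \<phi> # A # \<Gamma> \<turnstile> Tm TT (wk_ty 2 \<chi>)\<rbrakk>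
     \<Longrightarrow> T \<rhd> \<Gamma> \<turnstile> Tm TT \<chi>"
| forall_intro:
    "\<lbrakk>T \<rhd> \<Gamma> \<turnstile> Ty Col A; T \<rhd> A # \<Gamma> \<turnstile> Ty Prop \<phi>; T \<rhd> A # \<Gamma> \<turnstile> Tm TT \<phi>\<rbrakk>
     \<Longrightarrow> T \<rhd> \<Gamma> \<turnstile> Tm TT (Forall A \<phi>)"
| forall_elim:
    "\<lbrakk>T \<rhd> \<Gamma> \<turnstile> Ty Col A; T \<rhd> A # \<Gamma> \<turnstile> Ty Prop \<phi>; T \<rhd> \<Gamma> \<turnstile> Tm TT (Forall A \<phi>); T \<rhd> \<Gamma> \<turnstile> Tm a A\<rbrakk>
     \<Longrightarrow> T \<rhd> \<Gamma> \<turnstile> Tm TT (inst_ty 0 a \<phi>)"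
| eq_intro: "\<lbrakk>T \<rhd> \<Gamma> \<turnstile> Ty Col A; T \<rhd> \<Gamma> \<turnstile> Tm a A\<rbrakk> \<Longrightarrow> T \<rhd> \<Gamma> \<turnstile> Tm TT (EqP A a a)"
| eq_reflection:
    "\<lbrakk>T \<rhd> \<Gamma> \<turnstile> Ty Col A; T \<rhd> \<Gamma> \<turnstile> Tm a A; T \<rhd> \<Gamma> \<turnstile> Tm b A; T \<rhd> \<Gamma> \<turnstile> Tm TT (EqP A a b)\<rbrakk>
     \<Longrightarrow> T \<rhd> \<Gamma> \<turnstile> TmEq a b A"

  \<comment> \<open>\<open>N0\<close>\<close>
| n0_elim:
    "\<lbrakk>T \<rhd> N0 # \<Gamma> \<turnstile> Ty Col L; T \<rhd> \<Gamma> \<turnstile> Tm p N0\<rbrakk> \<Longrightarrow> T \<rhd> \<Gamma> \<turnstile> Tm (ElN0 p) (inst_ty 0 p L)"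
| n0_elim_cong:
    "\<lbrakk>T \<rhd> N0 # \<Gamma> \<turnstile> Ty Col L; T \<rhd> \<Gamma> \<turnstile> TmEq p p' N0\<rbrakk>
     \<Longrightarrow> T \<rhd> \<Gamma> \<turnstile> TmEq (ElN0 p) (ElN0 p') (inst_ty 0 p L)"

  \<comment> \<open>\<open>N1\<close>\<close>
| n1_intro: "T \<rhd> \<Gamma> \<turnstile> Ctx \<Longrightarrow> T \<rhd> \<Gamma> \<turnstile> Tm Star N1"
| n1_elim:
    "\<lbrakk>T \<rhd> N1 # \<Gamma> \<turnstile> Ty Col L; T \<rhd> \<Gamma> \<turnstile> Tm p N1; T \<rhd> \<Gamma> \<turnstile> Tm c (inst_ty 0 Star L)\<rbrakk>
     \<Longrightarrow> T \<rhd> \<Gamma> \<turnstile> Tm (ElN1 p c) (inst_ty 0 p L)"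
| n1_elim_cong:
    "\<lbrakk>T \<rhd> N1 # \<Gamma> \<turnstile> Ty Col L; T \<rhd> \<Gamma> \<turnstile> TmEq p p' N1; T \<rhd> \<Gamma> \<turnstile> TmEq c c' (inst_ty 0 Star L)\<rbrakk>
     \<Longrightarrow> T \<rhd> \<Gamma> \<turnstile> TmEq (ElN1 p c) (ElN1 p' c') (inst_ty 0 p L)"
| n1_beta:
    "\<lbrakk>T \<rhd> N1 # \<Gamma> \<turnstile> Ty Col L; T \<rhd> \<Gamma> \<turnstile> Tm c (inst_ty 0 Star L)\<rbrakk>
     \<Longrightarrow> T \<rhd> \<Gamma> \<turnstile> TmEq (ElN1 Star c) c (inst_ty 0 Star L)"

  \<comment> \<open>lists; in \<open>ElList s a l\<close> the bound variables of \<open>l\<close> are \<open>x \<in> List(A)\<close>, \<open>y \<in> A\<close>, \<open>z \<in> L(x)\<close>\<close>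
| nil_intro: "T \<rhd> \<Gamma> \<turnstile> Ty Set A \<Longrightarrow> T \<rhd> \<Gamma> \<turnstile> Tm LNil (LIST A)"
| cons_intro:
    "\<lbrakk>T \<rhd> \<Gamma> \<turnstile> Ty Set A; T \<rhd> \<Gamma> \<turnstile> Tm s (LIST A); T \<rhd> \<Gamma> \<turnstile> Tm a A\<rbrakk>
     \<Longrightarrow> T \<rhd> \<Gamma> \<turnstile> Tm (LCons s a) (LIST A)"
| cons_cong:
    "\<lbrakk>T \<rhd> \<Gamma> \<turnstile> Ty Set A; T \<rhd> \<Gamma> \<turnstile> TmEq s s' (LIST A); T \<rhd> \<Gamma> \<turnstile> TmEq a a' A\<rbrakk>
     \<Longrightarrow> T \<rhd> \<Gamma> \<turnstile> TmEq (LCons s a) (LCons s' a') (LIST A)"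
| list_elim:
    "\<lbrakk>T \<rhd> \<Gamma> \<turnstile> Ty Set A; T \<rhd> LIST A # \<Gamma> \<turnstile> Ty Col L; T \<rhd> \<Gamma> \<turnstile> Tm s (LIST A);
      T \<rhd> \<Gamma> \<turnstile> Tm a (inst_ty 0 LNil L);
      T \<rhd> inst_ty 2 (Var 1) L # wk_ty 1 A # LIST A # \<Gamma>
        \<turnstile> Tm l (inst_ty 3 (LCons (Var 2) (Var 1)) L)\<rbrakk>
     \<Longrightarrow> T \<rhd> \<Gamma> \<turnstile> Tm (ElList s a l) (inst_ty 0 s L)"
| list_elim_cong:
    "\<lbrakk>T \<rhd> \<Gamma> \<turnstile> Ty Set A; T \<rhd> LIST A # \<Gamma> \<turnstile> Ty Col L; T \<rhd> \<Gamma> \<turnstile> TmEq s s' (LIST A);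
      T \<rhd> \<Gamma> \<turnstile> TmEq a a' (inst_ty 0 LNil L);
      T \<rhd> inst_ty 2 (Var 1) L # wk_ty 1 A # LIST A # \<Gamma>
        \<turnstile> TmEq l l' (inst_ty 3 (LCons (Var 2) (Var 1)) L)\<rbrakk>
     \<Longrightarrow> T \<rhd> \<Gamma> \<turnstile> TmEq (ElList s a l) (ElList s' a' l') (inst_ty 0 s L)"
| nil_beta:
    "\<lbrakk>T \<rhd> \<Gamma> \<turnstile> Ty Set A; T \<rhd> LIST A # \<Gamma> \<turnstile> Ty Col L; T \<rhd> \<Gamma> \<turnstile> Tm a (inst_ty 0 LNil L);
      T \<rhd> inst_ty 2 (Var 1) L # wk_ty 1 A # LIST A # \<Gamma>
        \<turnstile> Tm l (inst_ty 3 (LCons (Var 2) (Var 1)) L)\<rbrakk>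
     \<Longrightarrow> T \<rhd> \<Gamma> \<turnstile> TmEq (ElList LNil a l) a (inst_ty 0 LNil L)"
| cons_beta:
    "\<lbrakk>T \<rhd> \<Gamma> \<turnstile> Ty Set A; T \<rhd> LIST A # \<Gamma> \<turnstile> Ty Col L; T \<rhd> \<Gamma> \<turnstile> Tm s (LIST A); T \<rhd> \<Gamma> \<turnstile> Tm b A;
      T \<rhd> \<Gamma> \<turnstile> Tm a (inst_ty 0 LNil L);
      T \<rhd> inst_ty 2 (Var 1) L # wk_ty 1 A # LIST A # \<Gamma>
        \<turnstile> Tm l (inst_ty 3 (LCons (Var 2) (Var 1)) L)\<rbrakk>
     \<Longrightarrow> T \<rhd> \<Gamma> \<turnstile> TmEq (ElList (LCons s b) a l) (inst3_tm 0 s b (ElList s a l) l)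
                   (inst_ty 0 (LCons s b) L)"

  \<comment> \<open>disjoint sums\<close>
| inl_intro:
    "\<lbrakk>T \<rhd> \<Gamma> \<turnstile> Ty Set A; T \<rhd> \<Gamma> \<turnstile> Ty Set B; T \<rhd> \<Gamma> \<turnstile> Tm a A\<rbrakk> \<Longrightarrow> T \<rhd> \<Gamma> \<turnstile> Tm (InL a) (Plus A B)"
| inl_cong:
    "\<lbrakk>T \<rhd> \<Gamma> \<turnstile> Ty Set A; T \<rhd> \<Gamma> \<turnstile> Ty Set B; T \<rhd> \<Gamma> \<turnstile> TmEq a a' A\<rbrakk>
     \<Longrightarrow> T \<rhd> \<Gamma> \<turnstile> TmEq (InL a) (InL a') (Plus A B)"
| inr_intro:
    "\<lbrakk>T \<rhd> \<Gamma> \<turnstile> Ty Set A; T \<rhd> \<Gamma> \<turnstile> Ty Set B; T \<rhd> \<Gamma> \<turnstile> Tm b B\<rbrakk> \<Longrightarrow> T \<rhd> \<Gamma> \<turnstile> Tm (InR b) (Plus A B)"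
| inr_cong:
    "\<lbrakk>T \<rhd> \<Gamma> \<turnstile> Ty Set A; T \<rhd> \<Gamma> \<turnstile> Ty Set B; T \<rhd> \<Gamma> \<turnstile> TmEq b b' B\<rbrakk>
     \<Longrightarrow> T \<rhd> \<Gamma> \<turnstile> TmEq (InR b) (InR b') (Plus A B)"
| plus_elim:
    "\<lbrakk>T \<rhd> \<Gamma> \<turnstile> Ty Set A; T \<rhd> \<Gamma> \<turnstile> Ty Set B; T \<rhd> Plus A B # \<Gamma> \<turnstile> Ty Col L;
      T \<rhd> \<Gamma> \<turnstile> Tm p (Plus A B);
      T \<rhd> A # \<Gamma> \<turnstile> Tm l (inst_ty 1 (InL (Var 0)) L);
      T \<rhd> B # \<Gamma> \<turnstile> Tm r (inst_ty 1 (InR (Var 0)) L)\<rbrakk>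
     \<Longrightarrow> T \<rhd> \<Gamma> \<turnstile> Tm (ElPlus p l r) (inst_ty 0 p L)"
| plus_elim_cong:
    "\<lbrakk>T \<rhd> \<Gamma> \<turnstile> Ty Set A; T \<rhd> \<Gamma> \<turnstile> Ty Set B; T \<rhd> Plus A B # \<Gamma> \<turnstile> Ty Col L;
      T \<rhd> \<Gamma> \<turnstile> TmEq p p' (Plus A B);
      T \<rhd> A # \<Gamma> \<turnstile> TmEq l l' (inst_ty 1 (InL (Var 0)) L);
      T \<rhd> B # \<Gamma> \<turnstile> TmEq r r' (inst_ty 1 (InR (Var 0)) L)\<rbrakk>
     \<Longrightarrow> T \<rhd> \<Gamma> \<turnstile> TmEq (ElPlus p l r) (ElPlus p' l' r') (inst_ty 0 p L)"
| inl_beta: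
    "\<lbrakk>T \<rhd> \<Gamma> \<turnstile> Ty Set A; T \<rhd> \<Gamma> \<turnstile> Ty Set B; T \<rhd> Plus A B # \<Gamma> \<turnstile> Ty Col L;
      T \<rhd> \<Gamma> \<turnstile> Tm a A;
      T \<rhd> A # \<Gamma> \<turnstile> Tm l (inst_ty 1 (InL (Var 0)) L);
      T \<rhd> B # \<Gamma> \<turnstile> Tm r (inst_ty 1 (InR (Var 0)) L)\<rbrakk>
     \<Longrightarrow> T \<rhd> \<Gamma> \<turnstile> TmEq (ElPlus (InL a) l r) (inst_tm 0 a l) (inst_ty 0 (InL a) L)"
| inr_beta:
    "\<lbrakk>T \<rhd> \<Gamma> \<turnstile> Ty Set A; T \<rhd> \<Gamma> \<turnstile> Ty Set B; T \<rhd> Plus A B # \<Gamma> \<turnstile> Ty Col L;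
      T \<rhd> \<Gamma> \<turnstile> Tm b B;
      T \<rhd> A # \<Gamma> \<turnstile> Tm l (inst_ty 1 (InL (Var 0)) L);
      T \<rhd> B # \<Gamma> \<turnstile> Tm r (inst_ty 1 (InR (Var 0)) L)\<rbrakk>
     \<Longrightarrow> T \<rhd> \<Gamma> \<turnstile> TmEq (ElPlus (InR b) l r) (inst_tm 0 b r) (inst_ty 0 (InR b) L)"

  \<comment> \<open>indexed sums\<close>
| pair_intro:
    "\<lbrakk>T \<rhd> \<Gamma> \<turnstile> Ty Col A; T \<rhd> A # \<Gamma> \<turnstile> Ty Col B; T \<rhd> \<Gamma> \<turnstile> Tm a A; T \<rhd> \<Gamma> \<turnstile> Tm b (inst_ty 0 a B)\<rbrakk>
     \<Longrightarrow> T \<rhd> \<Gamma> \<turnstile> Tm (Pr a b) (Sigma A B)"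
| pair_cong:
    "\<lbrakk>T \<rhd> \<Gamma> \<turnstile> Ty Col A; T \<rhd> A # \<Gamma> \<turnstile> Ty Col B;
      T \<rhd> \<Gamma> \<turnstile> TmEq a a' A; T \<rhd> \<Gamma> \<turnstile> TmEq b b' (inst_ty 0 a B)\<rbrakk>
     \<Longrightarrow> T \<rhd> \<Gamma> \<turnstile> TmEq (Pr a b) (Pr a' b') (Sigma A B)"
| sigma_elim:
    "\<lbrakk>T \<rhd> \<Gamma> \<turnstile> Ty Col A; T \<rhd> A # \<Gamma> \<turnstile> Ty Col B; T \<rhd> Sigma A B # \<Gamma> \<turnstile> Ty Col L;
      T \<rhd> \<Gamma> \<turnstile> Tm p (Sigma A B);
      T \<rhd> B # A # \<Gamma> \<turnstile> Tm m (inst_ty 2 (Pr (Var 1) (Var 0)) L)\<rbrakk>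
     \<Longrightarrow> T \<rhd> \<Gamma> \<turnstile> Tm (ElSigma p m) (inst_ty 0 p L)"
| sigma_elim_cong:
    "\<lbrakk>T \<rhd> \<Gamma> \<turnstile> Ty Col A; T \<rhd> A # \<Gamma> \<turnstile> Ty Col B; T \<rhd> Sigma A B # \<Gamma> \<turnstile> Ty Col L;
      T \<rhd> \<Gamma> \<turnstile> TmEq p p' (Sigma A B);
      T \<rhd> B # A # \<Gamma> \<turnstile> TmEq m m' (inst_ty 2 (Pr (Var 1) (Var 0)) L)\<rbrakk>
     \<Longrightarrow> T \<rhd> \<Gamma> \<turnstile> TmEq (ElSigma p m) (ElSigma p' m') (inst_ty 0 p L)"
| sigma_beta:
    "\<lbrakk>T \<rhd> \<Gamma> \<turnstile> Ty Col A; T \<rhd> A # \<Gamma> \<turnstile> Ty Col B; T \<rhd> Sigma A B # \<Gamma> \<turnstile> Ty Col L;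
      T \<rhd> \<Gamma> \<turnstile> Tm a A; T \<rhd> \<Gamma> \<turnstile> Tm b (inst_ty 0 a B);
      T \<rhd> B # A # \<Gamma> \<turnstile> Tm m (inst_ty 2 (Pr (Var 1) (Var 0)) L)\<rbrakk>
     \<Longrightarrow> T \<rhd> \<Gamma> \<turnstile> TmEq (ElSigma (Pr a b) m) (inst2_tm 0 a b m) (inst_ty 0 (Pr a b) L)"

  \<comment> \<open>dependent products\<close>
| pi_intro:
    "\<lbrakk>T \<rhd> \<Gamma> \<turnstile> Ty Set A; T \<rhd> A # \<Gamma> \<turnstile> Ty Set B; T \<rhd> A # \<Gamma> \<turnstile> Tm b B\<rbrakk>
     \<Longrightarrow> T \<rhd> \<Gamma> \<turnstile> Tm (Lam b) (Pi A B)"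
| pi_intro_cong:
    "\<lbrakk>T \<rhd> \<Gamma> \<turnstile> Ty Set A; T \<rhd> A # \<Gamma> \<turnstile> Ty Set B; T \<rhd> A # \<Gamma> \<turnstile> TmEq b b' B\<rbrakk>
     \<Longrightarrow> T \<rhd> \<Gamma> \<turnstile> TmEq (Lam b) (Lam b') (Pi A B)"
| pi_elim:
    "\<lbrakk>T \<rhd> \<Gamma> \<turnstile> Ty Set A; T \<rhd> A # \<Gamma> \<turnstile> Ty Set B; T \<rhd> \<Gamma> \<turnstile> Tm f (Pi A B); T \<rhd> \<Gamma> \<turnstile> Tm a A\<rbrakk>
     \<Longrightarrow> T \<rhd> \<Gamma> \<turnstile> Tm (Ap f a) (inst_ty 0 a B)"
| pi_elim_cong:
    "\<lbrakk>T \<rhd> \<Gamma> \<turnstile> Ty Set A; T \<rhd> A # \<Gamma> \<turnstile> Ty Set B;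
      T \<rhd> \<Gamma> \<turnstile> TmEq f f' (Pi A B); T \<rhd> \<Gamma> \<turnstile> TmEq a a' A\<rbrakk>
     \<Longrightarrow> T \<rhd> \<Gamma> \<turnstile> TmEq (Ap f a) (Ap f' a') (inst_ty 0 a B)"
| pi_beta:
    "\<lbrakk>T \<rhd> \<Gamma> \<turnstile> Ty Set A; T \<rhd> A # \<Gamma> \<turnstile> Ty Set B; T \<rhd> A # \<Gamma> \<turnstile> Tm b B; T \<rhd> \<Gamma> \<turnstile> Tm a A\<rbrakk>
     \<Longrightarrow> T \<rhd> \<Gamma> \<turnstile> TmEq (Ap (Lam b) a) (inst_tm 0 a b) (inst_ty 0 a B)"
| pi_eta:
    "\<lbrakk>T \<rhd> \<Gamma> \<turnstile> Ty Set A; T \<rhd> A # \<Gamma> \<turnstile> Ty Set B; T \<rhd> \<Gamma> \<turnstile> Tm f (Pi A B)\<rbrakk>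
     \<Longrightarrow> T \<rhd> \<Gamma> \<turnstile> TmEq (Lam (Ap (wk_tm 1 f) (Var 0))) f (Pi A B)"

  \<comment> \<open>the function collections \<open>A \<rightarrow> P(1)\<close>\<close>
| top1_intro:
    "\<lbrakk>T \<rhd> \<Gamma> \<turnstile> Ty Set A; T \<rhd> A # \<Gamma> \<turnstile> Tm b P1\<rbrakk> \<Longrightarrow> T \<rhd> \<Gamma> \<turnstile> Tm (Lam b) (ToP1 A)"
| top1_intro_cong:
    "\<lbrakk>T \<rhd> \<Gamma> \<turnstile> Ty Set A; T \<rhd> A # \<Gamma> \<turnstile> TmEq b b' P1\<rbrakk> \<Longrightarrow> T \<rhd> \<Gamma> \<turnstile> TmEq (Lam b) (Lam b') (ToP1 A)"
| top1_elim:
    "\<lbrakk>T \<rhd> \<Gamma> \<turnstile> Ty Set A; T \<rhd> \<Gamma> \<turnstile> Tm f (ToP1 A); T \<rhd> \<Gamma> \<turnstile> Tm a A\<rbrakk> \<Longrightarrow> T \<rhd> \<Gamma> \<turnstile> Tm (Ap f a) P1"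
| top1_elim_cong:
    "\<lbrakk>T \<rhd> \<Gamma> \<turnstile> Ty Set A; T \<rhd> \<Gamma> \<turnstile> TmEq f f' (ToP1 A); T \<rhd> \<Gamma> \<turnstile> TmEq a a' A\<rbrakk>
     \<Longrightarrow> T \<rhd> \<Gamma> \<turnstile> TmEq (Ap f a) (Ap f' a') P1"
| top1_beta:
    "\<lbrakk>T \<rhd> \<Gamma> \<turnstile> Ty Set A; T \<rhd> A # \<Gamma> \<turnstile> Tm b P1; T \<rhd> \<Gamma> \<turnstile> Tm a A\<rbrakk>
     \<Longrightarrow> T \<rhd> \<Gamma> \<turnstile> TmEq (Ap (Lam b) a) (inst_tm 0 a b) P1"
| top1_eta:
    "\<lbrakk>T \<rhd> \<Gamma> \<turnstile> Ty Set A; T \<rhd> \<Gamma> \<turnstile> Tm f (ToP1 A)\<rbrakk>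
     \<Longrightarrow> T \<rhd> \<Gamma> \<turnstile> TmEq (Lam (Ap (wk_tm 1 f) (Var 0))) f (ToP1 A)"

  \<comment> \<open>quotients; in the eliminator the branch \<open>l\<close> must respect \<open>R\<close> in the context
      \<open>x \<in> A, y \<in> A, w \<in> R(x,y)\<close>\<close>
| cls_intro:
    "\<lbrakk>T \<rhd> \<Gamma> \<turnstile> Ty Set A; T \<rhd> wk_ty 1 A # A # \<Gamma> \<turnstile> Ty PropS R; T \<rhd> \<Gamma> \<turnstile> Ty Set (Quot A R);
      T \<rhd> \<Gamma> \<turnstile> Tm a A\<rbrakk>
     \<Longrightarrow> T \<rhd> \<Gamma> \<turnstile> Tm (Cls a) (Quot A R)"
| cls_cong:
    "\<lbrakk>T \<rhd> \<Gamma> \<turnstile> Ty Set A; T \<rhd> wk_ty 1 A # A # \<Gamma> \<turnstile> Ty PropS R; T \<rhd> \<Gamma> \<turnstile> Ty Set (Quot A R);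
      T \<rhd> \<Gamma> \<turnstile> TmEq a a' A\<rbrakk>
     \<Longrightarrow> T \<rhd> \<Gamma> \<turnstile> TmEq (Cls a) (Cls a') (Quot A R)"
| quot_eq:
    "\<lbrakk>T \<rhd> \<Gamma> \<turnstile> Ty Set A; T \<rhd> wk_ty 1 A # A # \<Gamma> \<turnstile> Ty PropS R; T \<rhd> \<Gamma> \<turnstile> Ty Set (Quot A R);
      T \<rhd> \<Gamma> \<turnstile> Tm a A; T \<rhd> \<Gamma> \<turnstile> Tm b A; T \<rhd> \<Gamma> \<turnstile> Tm TT (inst2_ty 0 a b R)\<rbrakk>
     \<Longrightarrow> T \<rhd> \<Gamma> \<turnstile> TmEq (Cls a) (Cls b) (Quot A R)"
| quot_eff:
    "\<lbrakk>T \<rhd> \<Gamma> \<turnstile> Ty Set A; T \<rhd> wk_ty 1 A # A # \<Gamma> \<turnstile> Ty PropS R; T \<rhd> \<Gamma> \<turnstile> Ty Set (Quot A R);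
      T \<rhd> \<Gamma> \<turnstile> Tm a A; T \<rhd> \<Gamma> \<turnstile> Tm b A; T \<rhd> \<Gamma> \<turnstile> TmEq (Cls a) (Cls b) (Quot A R)\<rbrakk>
     \<Longrightarrow> T \<rhd> \<Gamma> \<turnstile> Tm TT (inst2_ty 0 a b R)"
| quot_elim:
    "\<lbrakk>T \<rhd> \<Gamma> \<turnstile> Ty Set A; T \<rhd> wk_ty 1 A # A # \<Gamma> \<turnstile> Ty PropS R; T \<rhd> \<Gamma> \<turnstile> Ty Set (Quot A R);
      T \<rhd> Quot A R # \<Gamma> \<turnstile> Ty Col L; T \<rhd> \<Gamma> \<turnstile> Tm p (Quot A R);
      T \<rhd> A # \<Gamma> \<turnstile> Tm l (inst_ty 1 (Cls (Var 0)) L);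
      T \<rhd> R # wk_ty 1 A # A # \<Gamma>
        \<turnstile> TmEq (inst_tm 3 (Var 2) l) (inst_tm 3 (Var 1) l) (inst_ty 3 (Cls (Var 2)) L)\<rbrakk>
     \<Longrightarrow> T \<rhd> \<Gamma> \<turnstile> Tm (ElQ p l) (inst_ty 0 p L)"
| quot_elim_cong:
    "\<lbrakk>T \<rhd> \<Gamma> \<turnstile> Ty Set A; T \<rhd> wk_ty 1 A # A # \<Gamma> \<turnstile> Ty PropS R; T \<rhd> \<Gamma> \<turnstile> Ty Set (Quot A R);
      T \<rhd> Quot A R # \<Gamma> \<turnstile> Ty Col L; T \<rhd> \<Gamma> \<turnstile> TmEq p p' (Quot A R);
      T \<rhd> A # \<Gamma> \<turnstile> TmEq l l' (inst_ty 1 (Cls (Var 0)) L);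
      T \<rhd> R # wk_ty 1 A # A # \<Gamma>
        \<turnstile> TmEq (inst_tm 3 (Var 2) l) (inst_tm 3 (Var 1) l) (inst_ty 3 (Cls (Var 2)) L)\<rbrakk>
     \<Longrightarrow> T \<rhd> \<Gamma> \<turnstile> TmEq (ElQ p l) (ElQ p' l') (inst_ty 0 p L)"
| quot_beta:
    "\<lbrakk>T \<rhd> \<Gamma> \<turnstile> Ty Set A; T \<rhd> wk_ty 1 A # A # \<Gamma> \<turnstile> Ty PropS R; T \<rhd> \<Gamma> \<turnstile> Ty Set (Quot A R);
      T \<rhd> Quot A R # \<Gamma> \<turnstile> Ty Col L; T \<rhd> \<Gamma> \<turnstile> Tm a A;
      T \<rhd> A # \<Gamma> \<turnstile> Tm l (inst_ty 1 (Cls (Var 0)) L);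
      T \<rhd> R # wk_ty 1 A # A # \<Gamma>
        \<turnstile> TmEq (inst_tm 3 (Var 2) l) (inst_tm 3 (Var 1) l) (inst_ty 3 (Cls (Var 2)) L)\<rbrakk>
     \<Longrightarrow> T \<rhd> \<Gamma> \<turnstile> TmEq (ElQ (Cls a) l) (inst_tm 0 a l) (inst_ty 0 (Cls a) L)"

  \<comment> \<open>\<open>P(1)\<close>\<close>
| code_intro: "T \<rhd> \<Gamma> \<turnstile> Ty PropS \<phi> \<Longrightarrow> T \<rhd> \<Gamma> \<turnstile> Tm (Code \<phi>) P1"
| code_cong: "T \<rhd> \<Gamma> \<turnstile> TyEq PropS \<phi> \<psi> \<Longrightarrow> T \<rhd> \<Gamma> \<turnstile> TmEq (Code \<phi>) (Code \<psi>) P1"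
| code_eq:
    "\<lbrakk>T \<rhd> \<Gamma> \<turnstile> Ty PropS \<phi>; T \<rhd> \<Gamma> \<turnstile> Ty PropS \<psi>; T \<rhd> \<Gamma> \<turnstile> Tm TT (Iff \<phi> \<psi>)\<rbrakk>
     \<Longrightarrow> T \<rhd> \<Gamma> \<turnstile> TmEq (Code \<phi>) (Code \<psi>) P1"
| code_eff:
    "\<lbrakk>T \<rhd> \<Gamma> \<turnstile> Ty PropS \<phi>; T \<rhd> \<Gamma> \<turnstile> Ty PropS \<psi>; T \<rhd> \<Gamma> \<turnstile> TmEq (Code \<phi>) (Code \<psi>) P1\<rbrakk>
     \<Longrightarrow> T \<rhd> \<Gamma> \<turnstile> Tm TT (Iff \<phi> \<psi>)"
| code_eta: "T \<rhd> \<Gamma> \<turnstile> Tm U P1 \<Longrightarrow> T \<rhd> \<Gamma> \<turnstile> TmEq U (Code (EqP P1 U (Code Top))) P1"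

definition consistent :: "system \<Rightarrow> bool" where
  "consistent T \<longleftrightarrow> \<not> T \<rhd> [] \<turnstile> Tm TT Bot"

end

theory Submission
  imports Defs
begin

text \<open>Forgetting excluded middle cannot destroy consistency, since every derivation of
  \<open>emTT_imp\<close> is one of \<open>emTT_imp_c\<close>. The content lies in the converse: a Goedel--Gentzen
  double-negation translation (\<open>tr_ty\<close>, \<open>tr_tm\<close>) carries each derivation of \<open>emTT_imp_c\<close> to one of
  \<open>emTT_imp\<close> and fixes \<open>Bot\<close>, so a classical proof of falsity becomes an intuitionistic one
  (\<open>tr_sound\<close>).

  Disjunction and existential quantification receive a double negation; every other
  connective, and equality in particular, is translated homomorphically. Equality must stay as it
  is because of the reflection rule: a propositional equality has to yield a judgemental one. On
  the other hand, eliminating a translated disjunction or existential requires the conclusion to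
  follow from its own double negation, equations included. So the translation works only if every
  translated collection has \<open>\<not>\<not>\<close>-stable equality, and this is what most of the development proves,
  by recursion on type formation: equality in sums, lists and indexed sums reduces to equality of
  components or is absurd; functions are equal when they are equal pointwise; a quotient is
  effective, so its equality is as stable as the relation.

  The type former that fails is \<open>P(1)\<close>, and with it \<open>A \<rightarrow> P(1)\<close>: equality of codes is
  equivalence of the coded propositions, and these are arbitrary. It is replaced by its quotient
  \<open>P1nn\<close> under the relation \<open>\<not>\<not>(U = V)\<close>, which is stable by construction. Two codes of stable
  propositions are still equal in this quotient only if the propositions are equivalent
  (\<open>P1nn_code_eff\<close>), and every element \<open>U\<close> is still the code of the proposition that \<open>U\<close> is true
  (\<open>P1nn_code_eta\<close>). The power collection \<open>A \<rightarrow> P(1)\<close> then has to become the product of copies of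
  \<open>P1nn\<close>. Both steps rest on resizing: a quotient can be formed only of a set by a small relation,
  and a product only of sets.

  A subtlety arises in the congruence rule for \<open>A \<rightarrow> P(1)\<close>. Its translation is a congruence
  between products, one premise of which is stated over the context extended by \<open>A\<close>. So \<open>A\<close> must
  be known to be a collection, whereas all that is given is an equality \<open>A = A'\<close>. Therefore the
  presuppositions of derivable equalities are established as well (\<open>presuppositions\<close>).\<close>

section \<open>Substitution calculus\<close>

text \<open>Substitutions are simplified with the rewrite rules of the \<open>\<sigma>\<close>-calculus: composites are
  pushed through \<open>scons\<close> until only shifts remain. Instances of types and terms that arise along
  different routes then become syntactically equal.\<close>

definition sub_comp :: "(nat \<Rightarrow> tm) \<Rightarrow> (nat \<Rightarrow> tm) \<Rightarrow> nat \<Rightarrow> tm"  (infixr "\<odot>" 75) where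
  "\<sigma> \<odot> \<tau> = (\<lambda>n. sub_tm \<tau> (\<sigma> n))"

lemma sub_comp_apply [simp]: "(\<sigma> \<odot> \<tau>) n = sub_tm \<tau> (\<sigma> n)"
  by (simp add: sub_comp_def)

lemma ren_as_sub:
  "ren_ty \<rho> A = sub_ty (\<lambda>n. Var (\<rho> n)) A" "ren_tm \<rho> a = sub_tm (\<lambda>n. Var (\<rho> n)) a"
proof -
  have [simp]: "lift_sub (\<lambda>n. Var (\<rho> n)) = (\<lambda>n. Var (lift_ren \<rho> n))" for \<rho>
  proof
    fix n show "lift_sub (\<lambda>n. Var (\<rho> n)) n = Var (lift_ren \<rho> n)"
      by (cases n) (simp_all add: lift_sub_def)
  qed
  show "ren_ty \<rho> A = sub_ty (\<lambda>n. Var (\<rho> n)) A" "ren_tm \<rho> a = sub_tm (\<lambda>n. Var (\<rho> n)) a"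
    by (induction A and a arbitrary: \<rho> and \<rho>) simp_all
qed

lemma sub_ren:
  "sub_ty \<sigma> (ren_ty \<rho> A) = sub_ty (\<lambda>n. \<sigma> (\<rho> n)) A"
  "sub_tm \<sigma> (ren_tm \<rho> a) = sub_tm (\<lambda>n. \<sigma> (\<rho> n)) a"
proof -
  have [simp]: "(\<lambda>n. lift_sub \<sigma> (lift_ren \<rho> n)) = lift_sub (\<lambda>n. \<sigma> (\<rho> n))" for \<sigma> \<rho>
  proof
    fix n show "lift_sub \<sigma> (lift_ren \<rho> n) = lift_sub (\<lambda>n. \<sigma> (\<rho> n)) n"
      by (cases n) (simp_all add: lift_sub_def)
  qed
  show "sub_ty \<sigma> (ren_ty \<rho> A) = sub_ty (\<lambda>n. \<sigma> (\<rho> n)) A"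
    "sub_tm \<sigma> (ren_tm \<rho> a) = sub_tm (\<lambda>n. \<sigma> (\<rho> n)) a"
    by (induction A and a arbitrary: \<sigma> \<rho> and \<sigma> \<rho>) simp_all
qed

text \<open>The commutation of renaming and substitution has to come in two halves before the
  composition law for substitutions, since lifting a substitution under a binder renames its
  values.\<close>

lemma ren_sub:
  "ren_ty \<rho> (sub_ty \<sigma> A) = sub_ty (\<lambda>n. ren_tm \<rho> (\<sigma> n)) A"
  "ren_tm \<rho> (sub_tm \<sigma> a) = sub_tm (\<lambda>n. ren_tm \<rho> (\<sigma> n)) a"
proof -
  have ren_ren: "ren_tm \<rho> (ren_tm \<rho>' a) = ren_tm (\<lambda>n. \<rho> (\<rho>' n)) a" for \<rho> \<rho>' a
    by (simp add: ren_as_sub(2)[of \<rho>] sub_ren) (simp add: ren_as_sub)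
  have [simp]: "(\<lambda>n. ren_tm (lift_ren \<rho>) (lift_sub \<sigma> n)) = lift_sub (\<lambda>n. ren_tm \<rho> (\<sigma> n))" for \<sigma> \<rho>
  proof
    fix n show "ren_tm (lift_ren \<rho>) (lift_sub \<sigma> n) = lift_sub (\<lambda>n. ren_tm \<rho> (\<sigma> n)) n"
      by (cases n) (simp_all add: lift_sub_def ren_ren)
  qed
  show "ren_ty \<rho> (sub_ty \<sigma> A) = sub_ty (\<lambda>n. ren_tm \<rho> (\<sigma> n)) A"
    "ren_tm \<rho> (sub_tm \<sigma> a) = sub_tm (\<lambda>n. ren_tm \<rho> (\<sigma> n)) a"
    by (induction A and a arbitrary: \<sigma> \<rho> and \<sigma> \<rho>) simp_all
qed

lemma sub_sub [simp]:
  "sub_ty \<tau> (sub_ty \<sigma> A) = sub_ty (\<sigma> \<odot> \<tau>) A"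
  "sub_tm \<tau> (sub_tm \<sigma> a) = sub_tm (\<sigma> \<odot> \<tau>) a"
proof -
  have [simp]: "lift_sub \<sigma> \<odot> lift_sub \<tau> = lift_sub (\<sigma> \<odot> \<tau>)" for \<sigma> \<tau>
  proof
    fix n show "(lift_sub \<sigma> \<odot> lift_sub \<tau>) n = lift_sub (\<sigma> \<odot> \<tau>) n"
      by (cases n) (simp_all add: lift_sub_def sub_ren ren_sub)
  qed
  show "sub_ty \<tau> (sub_ty \<sigma> A) = sub_ty (\<sigma> \<odot> \<tau>) A" "sub_tm \<tau> (sub_tm \<sigma> a) = sub_tm (\<sigma> \<odot> \<tau>) a"
    by (induction A and a arbitrary: \<sigma> \<tau> and \<sigma> \<tau>) simp_all
qed

lemma sub_Var [simp]: "sub_ty Var A = A" "sub_tm Var a = a"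
proof -
  have [simp]: "lift_sub Var = Var"
  proof
    fix n show "lift_sub Var n = Var n"
      by (cases n) (simp_all add: lift_sub_def)
  qed
  show "sub_ty Var A = A" "sub_tm Var a = a"
    by (induction A and a) simp_all
qed

lemma shift_0 [simp]: "shift 0 = Var"
  by (simp add: shift_def)

lemma shift_apply [simp]: "shift k n = Var (n + k)"
  by (simp add: shift_def)

text \<open>Expressing the lifting by \<open>scons\<close> and composition removes the last operation for which the
  rewrite system would need rules of its own.\<close>

lemma lift_sub_eq [simp]: "lift_sub \<sigma> = Var 0 \<cdot> (\<sigma> \<odot> shift (Suc 0))"
  by (simp add: lift_sub_def sub_comp_def ren_as_sub shift_def)

lemma scons_comp [simp]: "(a \<cdot> \<sigma>) \<odot> \<tau> = sub_tm \<tau> a \<cdot> (\<sigma> \<odot> \<tau>)"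
proof
  fix n show "((a \<cdot> \<sigma>) \<odot> \<tau>) n = (sub_tm \<tau> a \<cdot> (\<sigma> \<odot> \<tau>)) n" by (cases n) simp_all
qed

lemma shift_comp_scons [simp]: "shift (Suc k) \<odot> (a \<cdot> \<sigma>) = shift k \<odot> \<sigma>"
  by (rule ext) simp

lemma shift_comp_shift [simp]: "shift k \<odot> shift l = shift (k + l)"
  by (rule ext) (simp add: ac_simps)

lemma comp_assoc [simp]: "(\<sigma> \<odot> \<tau>) \<odot> \<rho> = \<sigma> \<odot> (\<tau> \<odot> \<rho>)"
  by (rule ext) simp

lemma comp_Var [simp]: "\<sigma> \<odot> Var = \<sigma>" "Var \<odot> \<sigma> = \<sigma>"
  by (simp_all add: sub_comp_def)

lemma var_scons_shift [simp]: "Var k \<cdot> shift (Suc k) = shift k"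
proof
  fix n show "(Var k \<cdot> shift (Suc k)) n = shift k n" by (cases n) simp_all
qed

declare numeral_eq_Suc [simp]

section \<open>Collapse of the kinds under resizing\<close>

abbreviation imp_derives :: "ctx \<Rightarrow> judgement \<Rightarrow> bool"  (infix "\<tturnstile>" 50) where
  "\<Gamma> \<tturnstile> J \<equiv> emTT_imp \<rhd> \<Gamma> \<turnstile> J"

lemma derives_ctx: "T \<rhd> \<Gamma> \<turnstile> J \<Longrightarrow> T \<rhd> \<Gamma> \<turnstile> Ctx"
  by (induction rule: derives.induct) (auto intro: ctx_empty ctx_ext)

text \<open>Resizing leaves only two kinds that matter. Rewriting with the next four equivalences
  brings every judgement to the kinds \<open>Col\<close> and \<open>Prop\<close>.\<close>

lemma set_iff_col [simp]: "\<Gamma> \<tturnstile> Ty Set A \<longleftrightarrow> \<Gamma> \<tturnstile> Ty Col A"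
  by (auto intro: ty_incl resize_col kind_incl.intros)

lemma props_iff_prop [simp]: "\<Gamma> \<tturnstile> Ty PropS A \<longleftrightarrow> \<Gamma> \<tturnstile> Ty Prop A"
  by (auto intro: ty_incl resize_prop kind_incl.intros)

lemma set_eq_iff_col_eq [simp]: "\<Gamma> \<tturnstile> TyEq Set A B \<longleftrightarrow> \<Gamma> \<tturnstile> TyEq Col A B"
  by (auto intro: ty_eq_incl resize_col_eq kind_incl.intros)

lemma props_eq_iff_prop_eq [simp]: "\<Gamma> \<tturnstile> TyEq PropS A B \<longleftrightarrow> \<Gamma> \<tturnstile> TyEq Prop A B"
  by (auto intro: ty_eq_incl resize_prop_eq kind_incl.intros)

lemma prop_col: "\<Gamma> \<tturnstile> Ty Prop A \<Longrightarrow> \<Gamma> \<tturnstile> Ty Col A"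
  by (auto intro: ty_incl kind_incl.intros)

lemma prop_eq_col_eq: "\<Gamma> \<tturnstile> TyEq Prop A B \<Longrightarrow> \<Gamma> \<tturnstile> TyEq Col A B"
  by (auto intro: ty_eq_incl kind_incl.intros)

section \<open>Typed substitutions\<close>

text \<open>Typed substitutions play the role of the morphisms of a Kripke model. The rules below that
  discharge a hypothesis, or a variable, quantify over all typed substitutions for the current
  context instead of extending it, so that nested hypotheses lead to composites of substitutions
  and not to towers of weakenings.\<close>

definition wsub :: "ctx \<Rightarrow> (nat \<Rightarrow> tm) \<Rightarrow> ctx \<Rightarrow> bool" where
  "wsub \<Delta> \<sigma> \<Gamma> \<longleftrightarrow> \<Delta> \<tturnstile> Ctx \<and> (\<forall>i < length \<Gamma>. \<Delta> \<tturnstile> Tm (\<sigma> i) (sub_ty \<sigma> (var_ty \<Gamma> i)))"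

lemma var_ty_simps [simp]:
  "var_ty (A # \<Gamma>) 0 = sub_ty (shift (Suc 0)) A"
  "var_ty (A # \<Gamma>) (Suc i) = sub_ty (shift (Suc 0)) (var_ty \<Gamma> i)"
  by (simp_all add: var_ty_def)

lemma wsub_ctx: "wsub \<Delta> \<sigma> \<Gamma> \<Longrightarrow> \<Delta> \<tturnstile> Ctx"
  by (simp add: wsub_def)

lemma subst: "\<Gamma> \<tturnstile> J \<Longrightarrow> wsub \<Delta> \<sigma> \<Gamma> \<Longrightarrow> \<Delta> \<tturnstile> sub_judgement \<sigma> J"
  unfolding wsub_def by (auto intro: substitution)

lemma subst_ty: "\<Gamma> \<tturnstile> Ty k A \<Longrightarrow> wsub \<Delta> \<sigma> \<Gamma> \<Longrightarrow> \<Delta> \<tturnstile> Ty k (sub_ty \<sigma> A)"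
  using subst[of \<Gamma> "Ty k A"] by simp

lemma subst_tm: "\<Gamma> \<tturnstile> Tm a A \<Longrightarrow> wsub \<Delta> \<sigma> \<Gamma> \<Longrightarrow> \<Delta> \<tturnstile> Tm (sub_tm \<sigma> a) (sub_ty \<sigma> A)"
  using subst[of \<Gamma> "Tm a A"] by simp

lemma subst_prf: "\<Gamma> \<tturnstile> Tm TT A \<Longrightarrow> wsub \<Delta> \<sigma> \<Gamma> \<Longrightarrow> \<Delta> \<tturnstile> Tm TT (sub_ty \<sigma> A)"
  using subst[of \<Gamma> "Tm TT A"] by simp

lemma subst_tm_eq:
  "\<Gamma> \<tturnstile> TmEq a b A \<Longrightarrow> wsub \<Delta> \<sigma> \<Gamma> \<Longrightarrow> \<Delta> \<tturnstile> TmEq (sub_tm \<sigma> a) (sub_tm \<sigma> b) (sub_ty \<sigma> A)"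
  using subst[of \<Gamma> "TmEq a b A"] by simp

lemma wsub_id: "\<Gamma> \<tturnstile> Ctx \<Longrightarrow> wsub \<Gamma> Var \<Gamma>"
  by (simp add: wsub_def var)

lemma ctx_cons: "\<Gamma> \<tturnstile> Ty Col A \<Longrightarrow> A # \<Gamma> \<tturnstile> Ctx"
  by (auto intro: ctx_ext derives_ctx)

lemma wsub_comp: "wsub \<Delta> \<sigma> \<Gamma> \<Longrightarrow> wsub \<Theta> \<tau> \<Delta> \<Longrightarrow> wsub \<Theta> (\<sigma> \<odot> \<tau>) \<Gamma>"
  unfolding wsub_def[of \<Theta> "\<sigma> \<odot> \<tau>"]
proof (intro conjI allI impI)
  fix i assume "wsub \<Delta> \<sigma> \<Gamma>" "wsub \<Theta> \<tau> \<Delta>" "i < length \<Gamma>"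
  then have "\<Delta> \<tturnstile> Tm (\<sigma> i) (sub_ty \<sigma> (var_ty \<Gamma> i))"
    by (simp add: wsub_def)
  from subst_tm[OF this \<open>wsub \<Theta> \<tau> \<Delta>\<close>]
  show "\<Theta> \<tturnstile> Tm ((\<sigma> \<odot> \<tau>) i) (sub_ty (\<sigma> \<odot> \<tau>) (var_ty \<Gamma> i))" by simp
qed (auto simp: wsub_def)

lemma wsub_shift: "\<Gamma> \<tturnstile> Ty Col A \<Longrightarrow> wsub (A # \<Gamma>) (shift (Suc 0)) \<Gamma>"
  unfolding wsub_def
proof (intro conjI allI impI)
  fix i assume A: "\<Gamma> \<tturnstile> Ty Col A" and i: "i < length \<Gamma>"
  show "A # \<Gamma> \<tturnstile> Tm (shift (Suc 0) i) (sub_ty (shift (Suc 0)) (var_ty \<Gamma> i))"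
    using var[OF ctx_cons[OF A], of "Suc i"] i by simp
qed (rule ctx_cons)

lemma wsub_scons:
  "wsub \<Delta> \<sigma> \<Gamma> \<Longrightarrow> \<Delta> \<tturnstile> Tm a (sub_ty \<sigma> A) \<Longrightarrow> wsub \<Delta> (a \<cdot> \<sigma>) (A # \<Gamma>)"
  unfolding wsub_def[of _ "a \<cdot> \<sigma>"]
proof (intro conjI allI impI)
  fix i assume s: "wsub \<Delta> \<sigma> \<Gamma>" and a: "\<Delta> \<tturnstile> Tm a (sub_ty \<sigma> A)" and i: "i < length (A # \<Gamma>)"
  show "\<Delta> \<tturnstile> Tm ((a \<cdot> \<sigma>) i) (sub_ty (a \<cdot> \<sigma>) (var_ty (A # \<Gamma>) i))"
    using s a i by (cases i) (simp_all add: wsub_def)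
qed (simp add: wsub_def)

lemma wsub_inst: "\<Gamma> \<tturnstile> Tm a A \<Longrightarrow> wsub \<Gamma> (a \<cdot> Var) (A # \<Gamma>)"
  by (intro wsub_scons wsub_id) (auto intro: derives_ctx)

lemma wsub_lift:
  assumes "wsub \<Delta> \<sigma> \<Gamma>" "\<Gamma> \<tturnstile> Ty Col A"
  shows "wsub (sub_ty \<sigma> A # \<Delta>) (Var 0 \<cdot> (\<sigma> \<odot> shift (Suc 0))) (A # \<Gamma>)"
proof -
  have A: "\<Delta> \<tturnstile> Ty Col (sub_ty \<sigma> A)" using subst_ty[OF assms(2,1)] .
  show ?thesis
    using wsub_comp[OF assms(1) wsub_shift[OF A]] var[OF ctx_cons[OF A], of 0]
    by (intro wsub_scons) simp_all
qed

section \<open>Natural deduction over typed substitutions\<close>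

abbreviation nn :: "ty \<Rightarrow> ty" where "nn \<phi> \<equiv> Neg (Neg \<phi>)"

lemma bot_prop: "\<Gamma> \<tturnstile> Ctx \<Longrightarrow> \<Gamma> \<tturnstile> Ty Prop Bot"
  using bot_form[of emTT_imp \<Gamma>] by simp

lemma impl_prop: "\<Gamma> \<tturnstile> Ty Prop \<phi> \<Longrightarrow> \<Gamma> \<tturnstile> Ty Prop \<psi> \<Longrightarrow> \<Gamma> \<tturnstile> Ty Prop (Impl \<phi> \<psi>)"
  by (rule impl_form) simp_all

lemma conj_prop: "\<Gamma> \<tturnstile> Ty Prop \<phi> \<Longrightarrow> \<Gamma> \<tturnstile> Ty Prop \<psi> \<Longrightarrow> \<Gamma> \<tturnstile> Ty Prop (Conj \<phi> \<psi>)"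
  by (rule conj_form) simp_all

lemma disj_prop: "\<Gamma> \<tturnstile> Ty Prop \<phi> \<Longrightarrow> \<Gamma> \<tturnstile> Ty Prop \<psi> \<Longrightarrow> \<Gamma> \<tturnstile> Ty Prop (Disj \<phi> \<psi>)"
  by (rule disj_form) simp_all

lemma exi_prop: "\<Gamma> \<tturnstile> Ty Col A \<Longrightarrow> A # \<Gamma> \<tturnstile> Ty Prop \<phi> \<Longrightarrow> \<Gamma> \<tturnstile> Ty Prop (Exi A \<phi>)"
  by (rule exi_form) simp_all

lemma forall_prop: "\<Gamma> \<tturnstile> Ty Col A \<Longrightarrow> A # \<Gamma> \<tturnstile> Ty Prop \<phi> \<Longrightarrow> \<Gamma> \<tturnstile> Ty Prop (Forall A \<phi>)"
  by (rule forall_form) simp_all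

lemma eq_prop: "\<Gamma> \<tturnstile> Ty Col A \<Longrightarrow> \<Gamma> \<tturnstile> Tm a A \<Longrightarrow> \<Gamma> \<tturnstile> Tm b A \<Longrightarrow> \<Gamma> \<tturnstile> Ty Prop (EqP A a b)"
  by (rule eq_form) simp_all

lemma neg_prop: "\<Gamma> \<tturnstile> Ty Prop \<phi> \<Longrightarrow> \<Gamma> \<tturnstile> Ty Prop (Neg \<phi>)"
  by (intro impl_prop bot_prop) (auto intro: derives_ctx)

lemma hyp: "\<Gamma> \<tturnstile> Ty Prop \<phi> \<Longrightarrow> \<phi> # \<Gamma> \<tturnstile> Tm TT (sub_ty (shift (Suc 0)) \<phi>)"
  using var[OF ctx_cons[OF prop_col], of \<Gamma> \<phi> 0] subst_ty[OF _ wsub_shift[OF prop_col], of \<Gamma> Prop \<phi> \<phi>]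
  by (auto intro: proof_true)

text \<open>The premise is used only for the substitution that weakens by \<open>\<phi>\<close>, where the hypothesis is
  the new variable.\<close>

lemma impl_I:
  assumes "\<Gamma> \<tturnstile> Ty Prop \<phi>" "\<Gamma> \<tturnstile> Ty Prop \<psi>"
    and "\<And>\<Delta> \<sigma>. wsub \<Delta> \<sigma> \<Gamma> \<Longrightarrow> \<Delta> \<tturnstile> Tm TT (sub_ty \<sigma> \<phi>) \<Longrightarrow> \<Delta> \<tturnstile> Tm TT (sub_ty \<sigma> \<psi>)"
  shows "\<Gamma> \<tturnstile> Tm TT (Impl \<phi> \<psi>)"
  using assms(3)[OF wsub_shift[OF prop_col] hyp] assms(1,2) by (intro impl_intro) simp_all

lemma impl_E:
  assumes "\<Gamma> \<tturnstile> Tm TT (Impl \<phi> \<psi>)" "\<Gamma> \<tturnstile> Tm TT \<phi>" "\<Gamma> \<tturnstile> Ty Prop \<phi>" "\<Gamma> \<tturnstile> Ty Prop \<psi>"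
  shows "\<Gamma> \<tturnstile> Tm TT \<psi>"
  using assms by (auto intro: impl_elim)

lemma neg_I:
  assumes "\<Gamma> \<tturnstile> Ty Prop \<phi>"
    and "\<And>\<Delta> \<sigma>. wsub \<Delta> \<sigma> \<Gamma> \<Longrightarrow> \<Delta> \<tturnstile> Tm TT (sub_ty \<sigma> \<phi>) \<Longrightarrow> \<Delta> \<tturnstile> Tm TT Bot"
  shows "\<Gamma> \<tturnstile> Tm TT (Neg \<phi>)"
  using assms by (intro impl_I bot_prop) (auto intro: derives_ctx)

lemma neg_E:
  assumes "\<Gamma> \<tturnstile> Tm TT (Neg \<phi>)" "\<Gamma> \<tturnstile> Tm TT \<phi>" "\<Gamma> \<tturnstile> Ty Prop \<phi>"
  shows "\<Gamma> \<tturnstile> Tm TT Bot"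
  using assms by (intro impl_E[OF assms] bot_prop) (auto intro: derives_ctx)

lemma nn_I:
  assumes p: "\<Gamma> \<tturnstile> Ty Prop \<phi>" and t: "\<Gamma> \<tturnstile> Tm TT \<phi>"
  shows "\<Gamma> \<tturnstile> Tm TT (nn \<phi>)"
proof (rule neg_I[OF neg_prop[OF p]])
  fix \<Delta> \<sigma> assume s: "wsub \<Delta> \<sigma> \<Gamma>" and n: "\<Delta> \<tturnstile> Tm TT (sub_ty \<sigma> (Neg \<phi>))"
  from neg_E[of \<Delta> "sub_ty \<sigma> \<phi>"] n subst_ty[OF p s] subst_prf[OF t s]
  show "\<Delta> \<tturnstile> Tm TT Bot" by simp
qed

text \<open>Double negation is a monad: under \<open>\<not>\<not>\<phi>\<close> one may assume \<open>\<phi>\<close> as long as the goal is doubly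
  negated.\<close>

lemma nn_bind:
  assumes p: "\<Gamma> \<tturnstile> Ty Prop \<phi>" and q: "\<Gamma> \<tturnstile> Ty Prop \<psi>" and t: "\<Gamma> \<tturnstile> Tm TT (nn \<phi>)"
    and f: "\<And>\<Delta> \<sigma>. wsub \<Delta> \<sigma> \<Gamma> \<Longrightarrow> \<Delta> \<tturnstile> Tm TT (sub_ty \<sigma> \<phi>) \<Longrightarrow> \<Delta> \<tturnstile> Tm TT (nn (sub_ty \<sigma> \<psi>))"
  shows "\<Gamma> \<tturnstile> Tm TT (nn \<psi>)"
proof (rule neg_I[OF neg_prop[OF q]])
  fix \<Delta> \<sigma> assume s: "wsub \<Delta> \<sigma> \<Gamma>" and n: "\<Delta> \<tturnstile> Tm TT (sub_ty \<sigma> (Neg \<psi>))"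
  note p' = subst_ty[OF p s] and q' = subst_ty[OF q s]
  have "\<Delta> \<tturnstile> Tm TT (Neg (sub_ty \<sigma> \<phi>))"
  proof (rule neg_I[OF p'])
    fix \<Theta> \<tau> assume r: "wsub \<Theta> \<tau> \<Delta>" and h: "\<Theta> \<tturnstile> Tm TT (sub_ty \<tau> (sub_ty \<sigma> \<phi>))"
    have "\<Theta> \<tturnstile> Tm TT (nn (sub_ty (\<sigma> \<odot> \<tau>) \<psi>))"
      using f[OF wsub_comp[OF s r]] h by simp
    moreover have "\<Theta> \<tturnstile> Tm TT (Neg (sub_ty (\<sigma> \<odot> \<tau>) \<psi>))" using subst_prf[OF n r] by simp
    moreover have "\<Theta> \<tturnstile> Ty Prop (sub_ty (\<sigma> \<odot> \<tau>) \<psi>)" using subst_ty[OF q' r] by simp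
    ultimately show "\<Theta> \<tturnstile> Tm TT Bot" by (auto intro: neg_E neg_prop)
  qed
  then show "\<Delta> \<tturnstile> Tm TT Bot"
    using neg_E[OF _ _ neg_prop[OF p']] subst_prf[OF t s] by simp
qed

lemma nn_map:
  assumes "\<Gamma> \<tturnstile> Ty Prop \<phi>" "\<Gamma> \<tturnstile> Ty Prop \<psi>" "\<Gamma> \<tturnstile> Tm TT (nn \<phi>)"
    and "\<And>\<Delta> \<sigma>. wsub \<Delta> \<sigma> \<Gamma> \<Longrightarrow> \<Delta> \<tturnstile> Tm TT (sub_ty \<sigma> \<phi>) \<Longrightarrow> \<Delta> \<tturnstile> Tm TT (sub_ty \<sigma> \<psi>)"
  shows "\<Gamma> \<tturnstile> Tm TT (nn \<psi>)"
  using assms by (intro nn_bind[OF assms(1,2,3)] nn_I) (auto intro: subst_ty)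

lemma top_prop: "\<Gamma> \<tturnstile> Ctx \<Longrightarrow> \<Gamma> \<tturnstile> Ty Prop Top"
  by (intro neg_prop bot_prop)

lemma top_true: "\<Gamma> \<tturnstile> Ctx \<Longrightarrow> \<Gamma> \<tturnstile> Tm TT Top"
  by (rule neg_I) (simp_all add: bot_prop)

lemma iff_prop: "\<Gamma> \<tturnstile> Ty Prop \<phi> \<Longrightarrow> \<Gamma> \<tturnstile> Ty Prop \<psi> \<Longrightarrow> \<Gamma> \<tturnstile> Ty Prop (Iff \<phi> \<psi>)"
  by (intro conj_prop impl_prop)

lemma iff_I:
  assumes p: "\<Gamma> \<tturnstile> Ty Prop \<phi>" and q: "\<Gamma> \<tturnstile> Ty Prop \<psi>"
    and "\<And>\<Delta> \<sigma>. wsub \<Delta> \<sigma> \<Gamma> \<Longrightarrow> \<Delta> \<tturnstile> Tm TT (sub_ty \<sigma> \<phi>) \<Longrightarrow> \<Delta> \<tturnstile> Tm TT (sub_ty \<sigma> \<psi>)"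
    and "\<And>\<Delta> \<sigma>. wsub \<Delta> \<sigma> \<Gamma> \<Longrightarrow> \<Delta> \<tturnstile> Tm TT (sub_ty \<sigma> \<psi>) \<Longrightarrow> \<Delta> \<tturnstile> Tm TT (sub_ty \<sigma> \<phi>)"
  shows "\<Gamma> \<tturnstile> Tm TT (Iff \<phi> \<psi>)"
  using assms by (intro conj_intro impl_prop impl_I)

lemma forall_I:
  assumes "\<Gamma> \<tturnstile> Ty Col A" "A # \<Gamma> \<tturnstile> Ty Prop \<phi>"
    and "\<And>\<Delta> \<sigma> a. wsub \<Delta> \<sigma> \<Gamma> \<Longrightarrow> \<Delta> \<tturnstile> Tm a (sub_ty \<sigma> A) \<Longrightarrow> \<Delta> \<tturnstile> Tm TT (sub_ty (a \<cdot> \<sigma>) \<phi>)"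
  shows "\<Gamma> \<tturnstile> Tm TT (Forall A \<phi>)"
proof -
  have "A # \<Gamma> \<tturnstile> Tm (Var 0) (sub_ty (shift (Suc 0)) A)"
    using var[OF ctx_cons[OF assms(1)], of 0] by simp
  from assms(3)[OF wsub_shift[OF assms(1)] this] assms(1,2) show ?thesis
    by (intro forall_intro) simp_all
qed

lemma forall_E:
  assumes "\<Gamma> \<tturnstile> Tm TT (Forall A \<phi>)" "\<Gamma> \<tturnstile> Ty Col A" "A # \<Gamma> \<tturnstile> Ty Prop \<phi>" "\<Gamma> \<tturnstile> Tm a A"
  shows "\<Gamma> \<tturnstile> Tm TT (sub_ty (a \<cdot> Var) \<phi>)"
  using forall_elim[OF assms(2,3,1,4)] by simp

text \<open>By congruence of \<open>EqP\<close>, the type \<open>a = b\<close> is equal to the type \<open>a = a\<close>, which reflexivity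
  inhabits.\<close>

lemma eq_I:
  assumes "\<Gamma> \<tturnstile> TmEq a b A" "\<Gamma> \<tturnstile> Ty Col A" "\<Gamma> \<tturnstile> Tm a A"
  shows "\<Gamma> \<tturnstile> Tm TT (EqP A a b)"
proof (rule tm_conv)
  show "\<Gamma> \<tturnstile> Tm TT (EqP A a a)" using assms by (auto intro: eq_intro)
  show "\<Gamma> \<tturnstile> TyEq Col (EqP A a a) (EqP A a b)"
    using assms by (intro prop_eq_col_eq eq_form_cong) (auto intro: ty_refl tm_refl)
qed

lemma eq_E:
  assumes "\<Gamma> \<tturnstile> Tm TT (EqP A a b)" "\<Gamma> \<tturnstile> Ty Col A" "\<Gamma> \<tturnstile> Tm a A" "\<Gamma> \<tturnstile> Tm b A"
  shows "\<Gamma> \<tturnstile> TmEq a b A"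
  using assms by (auto intro: eq_reflection)

text \<open>Thanks to reflection, a doubly negated equation may be used as a judgemental equality
  while proving a doubly negated goal.\<close>

lemma nn_eq_map:
  assumes A: "\<Gamma> \<tturnstile> Ty Col A" "\<Gamma> \<tturnstile> Tm a A" "\<Gamma> \<tturnstile> Tm b A" and h: "\<Gamma> \<tturnstile> Tm TT (nn (EqP A a b))"
    and p: "\<Gamma> \<tturnstile> Ty Prop \<psi>"
    and f: "\<And>\<Delta> \<sigma>. wsub \<Delta> \<sigma> \<Gamma> \<Longrightarrow> \<Delta> \<tturnstile> TmEq (sub_tm \<sigma> a) (sub_tm \<sigma> b) (sub_ty \<sigma> A)
      \<Longrightarrow> \<Delta> \<tturnstile> Tm TT (sub_ty \<sigma> \<psi>)"
  shows "\<Gamma> \<tturnstile> Tm TT (nn \<psi>)"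
proof (rule nn_map[OF eq_prop[OF A] p h])
  fix \<Delta> \<sigma> assume s: "wsub \<Delta> \<sigma> \<Gamma>" and t: "\<Delta> \<tturnstile> Tm TT (sub_ty \<sigma> (EqP A a b))"
  show "\<Delta> \<tturnstile> Tm TT (sub_ty \<sigma> \<psi>)"
    using f[OF s] eq_E[of \<Delta> "sub_ty \<sigma> A" "sub_tm \<sigma> a" "sub_tm \<sigma> b"] t A s
    by (auto intro: subst_ty subst_tm)
qed

lemma nn_eq_cong:
  assumes A: "\<Gamma> \<tturnstile> Ty Col A" "\<Gamma> \<tturnstile> Tm a A" "\<Gamma> \<tturnstile> Tm b A" and h: "\<Gamma> \<tturnstile> Tm TT (nn (EqP A a b))"
    and C: "\<Gamma> \<tturnstile> Ty Col C" "\<Gamma> \<tturnstile> Tm c C" "\<Gamma> \<tturnstile> Tm d C"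
    and f: "\<And>\<Delta> \<sigma>. wsub \<Delta> \<sigma> \<Gamma> \<Longrightarrow> \<Delta> \<tturnstile> TmEq (sub_tm \<sigma> a) (sub_tm \<sigma> b) (sub_ty \<sigma> A)
      \<Longrightarrow> \<Delta> \<tturnstile> TmEq (sub_tm \<sigma> c) (sub_tm \<sigma> d) (sub_ty \<sigma> C)"
  shows "\<Gamma> \<tturnstile> Tm TT (nn (EqP C c d))"
  using C by (intro nn_eq_map[OF A h eq_prop[OF C]]) (auto intro!: eq_I f intro: subst_ty subst_tm)

text \<open>Excluded middle is available in the proof of a doubly negated proposition.\<close>

lemma nn_cases:
  assumes p: "\<Gamma> \<tturnstile> Ty Prop \<phi>" and q: "\<Gamma> \<tturnstile> Ty Prop \<psi>"
    and pos: "\<And>\<Delta> \<sigma>. wsub \<Delta> \<sigma> \<Gamma> \<Longrightarrow> \<Delta> \<tturnstile> Tm TT (sub_ty \<sigma> \<phi>) \<Longrightarrow> \<Delta> \<tturnstile> Tm TT (sub_ty \<sigma> \<psi>)"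
    and neg: "\<And>\<Delta> \<sigma>. wsub \<Delta> \<sigma> \<Gamma> \<Longrightarrow> \<Delta> \<tturnstile> Tm TT (Neg (sub_ty \<sigma> \<phi>)) \<Longrightarrow> \<Delta> \<tturnstile> Tm TT (sub_ty \<sigma> \<psi>)"
  shows "\<Gamma> \<tturnstile> Tm TT (nn \<psi>)"
proof (rule neg_I[OF neg_prop[OF q]])
  fix \<Delta> \<sigma> assume s: "wsub \<Delta> \<sigma> \<Gamma>" and "\<Delta> \<tturnstile> Tm TT (sub_ty \<sigma> (Neg \<psi>))"
  then have n: "\<Delta> \<tturnstile> Tm TT (Neg (sub_ty \<sigma> \<psi>))" by simp
  note p' = subst_ty[OF p s] and q' = subst_ty[OF q s]
  have "\<Delta> \<tturnstile> Tm TT (Neg (sub_ty \<sigma> \<phi>))"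
  proof (rule neg_I[OF p'])
    fix \<Theta> \<tau> assume r: "wsub \<Theta> \<tau> \<Delta>" and t: "\<Theta> \<tturnstile> Tm TT (sub_ty \<tau> (sub_ty \<sigma> \<phi>))"
    show "\<Theta> \<tturnstile> Tm TT Bot"
      using neg_E[of \<Theta> "sub_ty \<tau> (sub_ty \<sigma> \<psi>)"] subst_prf[OF n r] pos[OF wsub_comp[OF s r]] t
        subst_ty[OF q' r]
      by simp
  qed
  from neg_E[OF n neg[OF s this] q'] show "\<Delta> \<tturnstile> Tm TT Bot" .
qed

lemma nn_lem:
  assumes p: "\<Gamma> \<tturnstile> Ty Prop \<phi>"
  shows "\<Gamma> \<tturnstile> Tm TT (nn (Disj \<phi> (Neg \<phi>)))"
proof (rule nn_cases[OF p disj_prop[OF p neg_prop[OF p]]])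
  fix \<Delta> \<sigma> assume s: "wsub \<Delta> \<sigma> \<Gamma>"
  note p' = subst_ty[OF p s]
  show "\<Delta> \<tturnstile> Tm TT (sub_ty \<sigma> \<phi>) \<Longrightarrow> \<Delta> \<tturnstile> Tm TT (sub_ty \<sigma> (Disj \<phi> (Neg \<phi>)))"
    using disj_intro1[OF p' neg_prop[OF p']] by simp
  show "\<Delta> \<tturnstile> Tm TT (Neg (sub_ty \<sigma> \<phi>)) \<Longrightarrow> \<Delta> \<tturnstile> Tm TT (sub_ty \<sigma> (Disj \<phi> (Neg \<phi>)))"
    using disj_intro2[OF p' neg_prop[OF p']] by simp
qed

lemma nn_eq_sym:
  assumes A: "\<Gamma> \<tturnstile> Ty Col A" "\<Gamma> \<tturnstile> Tm a A" "\<Gamma> \<tturnstile> Tm b A" and n: "\<Gamma> \<tturnstile> Tm TT (nn (EqP A a b))"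
  shows "\<Gamma> \<tturnstile> Tm TT (nn (EqP A b a))"
  by (rule nn_eq_cong[OF A n A(1,3,2)]) (rule tm_sym)

lemma nn_eq_trans:
  assumes A: "\<Gamma> \<tturnstile> Ty Col A" "\<Gamma> \<tturnstile> Tm a A" "\<Gamma> \<tturnstile> Tm b A" "\<Gamma> \<tturnstile> Tm c A"
    and n: "\<Gamma> \<tturnstile> Tm TT (nn (EqP A a b))" and m: "\<Gamma> \<tturnstile> Tm TT (nn (EqP A b c))"
  shows "\<Gamma> \<tturnstile> Tm TT (nn (EqP A a c))"
proof (rule nn_bind[OF eq_prop[OF A(1,2,3)] eq_prop[OF A(1,2,4)] n])
  fix \<Delta> \<sigma> assume s: "wsub \<Delta> \<sigma> \<Gamma>" and e: "\<Delta> \<tturnstile> Tm TT (sub_ty \<sigma> (EqP A a b))"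
  let ?A = "sub_ty \<sigma> A" and ?a = "sub_tm \<sigma> a" and ?b = "sub_tm \<sigma> b" and ?c = "sub_tm \<sigma> c"
  note A' = subst_ty[OF A(1) s] and t = subst_tm[OF A(2) s] subst_tm[OF A(3) s] subst_tm[OF A(4) s]
  have ab: "\<Delta> \<tturnstile> TmEq ?a ?b ?A" using e by (intro eq_E[OF _ A' t(1,2)]) simp
  have m': "\<Delta> \<tturnstile> Tm TT (nn (EqP ?A ?b ?c))" using subst_prf[OF m s] by simp
  have "\<Delta> \<tturnstile> Tm TT (nn (EqP ?A ?a ?c))"
    by (rule nn_eq_cong[OF A' t(2,3) m' A' t(1,3)]) (rule tm_trans[OF subst_tm_eq[OF ab]])
  then show "\<Delta> \<tturnstile> Tm TT (nn (sub_ty \<sigma> (EqP A a c)))" by simp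
qed

section \<open>Stability under double negation\<close>

text \<open>Stability is required after every typed substitution, which makes it invariant under
  substitution and weakening by mere composition.\<close>

definition pstable :: "ctx \<Rightarrow> ty \<Rightarrow> bool" where
  "pstable \<Gamma> \<phi> \<longleftrightarrow> (\<forall>\<Delta> \<sigma>. wsub \<Delta> \<sigma> \<Gamma> \<longrightarrow> \<Delta> \<tturnstile> Tm TT (nn (sub_ty \<sigma> \<phi>)) \<longrightarrow> \<Delta> \<tturnstile> Tm TT (sub_ty \<sigma> \<phi>))"

text \<open>Equality is stable when a doubly negated equation implies a judgemental equality. The
  conclusion is judgemental so that no separate appeal to reflection is needed later.\<close>

definition stable :: "ctx \<Rightarrow> ty \<Rightarrow> bool" where
  "stable \<Gamma> A \<longleftrightarrow> (\<forall>\<Delta> \<sigma> a b. wsub \<Delta> \<sigma> \<Gamma> \<longrightarrow> \<Delta> \<tturnstile> Tm a (sub_ty \<sigma> A) \<longrightarrow> \<Delta> \<tturnstile> Tm b (sub_ty \<sigma> A)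
     \<longrightarrow> \<Delta> \<tturnstile> Tm TT (nn (EqP (sub_ty \<sigma> A) a b)) \<longrightarrow> \<Delta> \<tturnstile> TmEq a b (sub_ty \<sigma> A))"

lemma pstable_sub: "pstable \<Gamma> \<phi> \<Longrightarrow> wsub \<Delta> \<sigma> \<Gamma> \<Longrightarrow> pstable \<Delta> (sub_ty \<sigma> \<phi>)"
  unfolding pstable_def by (auto dest: wsub_comp)

lemma stable_sub: "stable \<Gamma> A \<Longrightarrow> wsub \<Delta> \<sigma> \<Gamma> \<Longrightarrow> stable \<Delta> (sub_ty \<sigma> A)"
  unfolding stable_def by (auto dest: wsub_comp)

lemma pstableD: "pstable \<Gamma> \<phi> \<Longrightarrow> \<Gamma> \<tturnstile> Tm TT (nn \<phi>) \<Longrightarrow> \<Gamma> \<tturnstile> Tm TT \<phi>"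
  unfolding pstable_def using wsub_id[OF derives_ctx, of \<Gamma>] by (metis sub_Var(1))

lemma stableD:
  "stable \<Gamma> A \<Longrightarrow> \<Gamma> \<tturnstile> Tm TT (nn (EqP A a b)) \<Longrightarrow> \<Gamma> \<tturnstile> Tm a A \<Longrightarrow> \<Gamma> \<tturnstile> Tm b A \<Longrightarrow> \<Gamma> \<tturnstile> TmEq a b A"
  unfolding stable_def using wsub_id[OF derives_ctx, of \<Gamma>] by (metis sub_Var(1))

text \<open>Three negations amount to one. This covers the translations of disjunction and existential
  quantification, which are themselves double negations.\<close>

lemma pstable_neg:
  assumes p: "\<Gamma> \<tturnstile> Ty Prop \<phi>"
  shows "pstable \<Gamma> (Neg \<phi>)"
  unfolding pstable_def
proof (intro allI impI)
  fix \<Delta> \<sigma> assume s: "wsub \<Delta> \<sigma> \<Gamma>" and h: "\<Delta> \<tturnstile> Tm TT (nn (sub_ty \<sigma> (Neg \<phi>)))"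
  note p' = subst_ty[OF p s]
  show "\<Delta> \<tturnstile> Tm TT (sub_ty \<sigma> (Neg \<phi>))"
    unfolding sub_ty.simps
  proof (rule neg_I[OF p'])
    fix \<Theta> \<tau> assume r: "wsub \<Theta> \<tau> \<Delta>" and t: "\<Theta> \<tturnstile> Tm TT (sub_ty \<tau> (sub_ty \<sigma> \<phi>))"
    note p'' = subst_ty[OF p' r]
    have "\<Theta> \<tturnstile> Tm TT (Neg (nn (sub_ty \<tau> (sub_ty \<sigma> \<phi>))))" using subst_prf[OF h r] by simp
    then show "\<Theta> \<tturnstile> Tm TT Bot" using nn_I[OF p'' t] p'' by (blast intro: neg_E neg_prop)
  qed
qed

lemma pstable_bot: "pstable \<Gamma> Bot"
  unfolding pstable_def
proof (intro allI impI)
  fix \<Delta> \<sigma> assume s: "wsub \<Delta> \<sigma> \<Gamma>" and h: "\<Delta> \<tturnstile> Tm TT (nn (sub_ty \<sigma> Bot))"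
  have b: "\<Delta> \<tturnstile> Ty Prop Bot" using s by (auto intro: bot_prop wsub_ctx)
  have "\<Delta> \<tturnstile> Tm TT (Neg Bot)" by (rule neg_I[OF b]) simp
  then show "\<Delta> \<tturnstile> Tm TT (sub_ty \<sigma> Bot)" using h b by (auto intro: neg_E neg_prop)
qed

lemma pstable_conj:
  assumes p: "\<Gamma> \<tturnstile> Ty Prop \<phi>" and q: "\<Gamma> \<tturnstile> Ty Prop \<psi>" and "pstable \<Gamma> \<phi>" "pstable \<Gamma> \<psi>"
  shows "pstable \<Gamma> (Conj \<phi> \<psi>)"
  unfolding pstable_def sub_ty.simps
proof (intro allI impI)
  fix \<Delta> \<sigma> assume s: "wsub \<Delta> \<sigma> \<Gamma>" and h: "\<Delta> \<tturnstile> Tm TT (nn (Conj (sub_ty \<sigma> \<phi>) (sub_ty \<sigma> \<psi>)))"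
  note p' = subst_ty[OF p s] and q' = subst_ty[OF q s]
  have "\<Delta> \<tturnstile> Tm TT (nn (sub_ty \<sigma> \<phi>))"
    by (rule nn_map[OF conj_prop[OF p' q'] p' h])
      (auto simp del: sub_sub intro: conj_elim1[OF subst_ty[OF p'] subst_ty[OF q']])
  moreover have "\<Delta> \<tturnstile> Tm TT (nn (sub_ty \<sigma> \<psi>))"
    by (rule nn_map[OF conj_prop[OF p' q'] q' h])
      (auto simp del: sub_sub intro: conj_elim2[OF subst_ty[OF p'] subst_ty[OF q']])
  ultimately show "\<Delta> \<tturnstile> Tm TT (Conj (sub_ty \<sigma> \<phi>) (sub_ty \<sigma> \<psi>))"
    using assms p' q' s by (auto intro!: conj_intro intro: pstableD pstable_sub)
qed

lemma pstable_impl: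
  assumes p: "\<Gamma> \<tturnstile> Ty Prop \<phi>" and q: "\<Gamma> \<tturnstile> Ty Prop \<psi>" and st: "pstable \<Gamma> \<psi>"
  shows "pstable \<Gamma> (Impl \<phi> \<psi>)"
  unfolding pstable_def sub_ty.simps
proof (intro allI impI)
  fix \<Delta> \<sigma> assume s: "wsub \<Delta> \<sigma> \<Gamma>" and h: "\<Delta> \<tturnstile> Tm TT (nn (Impl (sub_ty \<sigma> \<phi>) (sub_ty \<sigma> \<psi>)))"
  note p' = subst_ty[OF p s] and q' = subst_ty[OF q s]
  show "\<Delta> \<tturnstile> Tm TT (Impl (sub_ty \<sigma> \<phi>) (sub_ty \<sigma> \<psi>))"
  proof (rule impl_I[OF p' q'])
    fix \<Theta> \<tau> assume r: "wsub \<Theta> \<tau> \<Delta>" and t: "\<Theta> \<tturnstile> Tm TT (sub_ty \<tau> (sub_ty \<sigma> \<phi>))"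
    let ?p = "sub_ty \<tau> (sub_ty \<sigma> \<phi>)" and ?q = "sub_ty \<tau> (sub_ty \<sigma> \<psi>)"
    note p'' = subst_ty[OF p' r] and q'' = subst_ty[OF q' r]
    have "\<Theta> \<tturnstile> Tm TT (nn (Impl ?p ?q))" using subst_prf[OF h r] by simp
    then have "\<Theta> \<tturnstile> Tm TT (nn ?q)"
    proof (rule nn_map[OF impl_prop[OF p'' q''] q''])
      fix \<Xi> \<upsilon> assume u: "wsub \<Xi> \<upsilon> \<Theta>" and i: "\<Xi> \<tturnstile> Tm TT (sub_ty \<upsilon> (Impl ?p ?q))"
      show "\<Xi> \<tturnstile> Tm TT (sub_ty \<upsilon> ?q)"
        using i impl_E[OF _ subst_prf[OF t u] subst_ty[OF p'' u] subst_ty[OF q'' u]] by simp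
    qed
    then show "\<Theta> \<tturnstile> Tm TT ?q" by (rule pstableD[OF pstable_sub[OF pstable_sub[OF st s] r]])
  qed
qed

lemma pstable_forall:
  assumes A: "\<Gamma> \<tturnstile> Ty Col A" and q: "A # \<Gamma> \<tturnstile> Ty Prop \<psi>" and st: "pstable (A # \<Gamma>) \<psi>"
  shows "pstable \<Gamma> (Forall A \<psi>)"
  unfolding pstable_def
proof (intro allI impI)
  fix \<Delta> \<sigma> assume s: "wsub \<Delta> \<sigma> \<Gamma>" and h: "\<Delta> \<tturnstile> Tm TT (nn (sub_ty \<sigma> (Forall A \<psi>)))"
  let ?A = "sub_ty \<sigma> A" and ?\<psi> = "sub_ty (lift_sub \<sigma>) \<psi>"
  have A': "\<Delta> \<tturnstile> Ty Col ?A" by (rule subst_ty[OF A s])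
  have q': "?A # \<Delta> \<tturnstile> Ty Prop ?\<psi>" using subst_ty[OF q wsub_lift[OF s A]] by simp
  have st': "pstable (?A # \<Delta>) ?\<psi>" using pstable_sub[OF st wsub_lift[OF s A]] by simp
  have "\<Delta> \<tturnstile> Tm TT (Forall ?A ?\<psi>)"
  proof (rule forall_I[OF A' q'])
    fix \<Theta> \<tau> a assume r: "wsub \<Theta> \<tau> \<Delta>" and a: "\<Theta> \<tturnstile> Tm a (sub_ty \<tau> ?A)"
    note w = wsub_scons[OF r a]
    have F: "\<Theta> \<tturnstile> Ty Prop (sub_ty \<tau> (Forall ?A ?\<psi>))"
      using subst_ty[OF forall_prop[OF A' q'] r] .
    have "\<Theta> \<tturnstile> Tm TT (nn (sub_ty \<tau> (Forall ?A ?\<psi>)))" using subst_prf[OF h r] by simp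
    then have "\<Theta> \<tturnstile> Tm TT (nn (sub_ty (a \<cdot> \<tau>) ?\<psi>))"
    proof (rule nn_map[OF F subst_ty[OF q' w]])
      fix \<Xi> \<upsilon> assume u: "wsub \<Xi> \<upsilon> \<Theta>" and i: "\<Xi> \<tturnstile> Tm TT (sub_ty \<upsilon> (sub_ty \<tau> (Forall ?A ?\<psi>)))"
      note ru = wsub_comp[OF r u]
      have "\<Xi> \<tturnstile> Tm TT (Forall (sub_ty (\<tau> \<odot> \<upsilon>) ?A) (sub_ty (lift_sub (\<tau> \<odot> \<upsilon>)) ?\<psi>))"
        using i by simp
      from forall_E[OF this subst_ty[OF A' ru], of "sub_tm \<upsilon> a"]
        subst_ty[OF q' wsub_lift[OF ru A']] subst_tm[OF a u]
      show "\<Xi> \<tturnstile> Tm TT (sub_ty \<upsilon> (sub_ty (a \<cdot> \<tau>) ?\<psi>))" by simp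
    qed
    then show "\<Theta> \<tturnstile> Tm TT (sub_ty (a \<cdot> \<tau>) ?\<psi>)" by (rule pstableD[OF pstable_sub[OF st' w]])
  qed
  then show "\<Delta> \<tturnstile> Tm TT (sub_ty \<sigma> (Forall A \<psi>))" by simp
qed

lemma pstable_eq:
  assumes "\<Gamma> \<tturnstile> Ty Col A" "\<Gamma> \<tturnstile> Tm a A" "\<Gamma> \<tturnstile> Tm b A" "stable \<Gamma> A"
  shows "pstable \<Gamma> (EqP A a b)"
  unfolding pstable_def sub_ty.simps
proof (intro allI impI)
  fix \<Delta> \<sigma> assume s: "wsub \<Delta> \<sigma> \<Gamma>"
    and h: "\<Delta> \<tturnstile> Tm TT (nn (EqP (sub_ty \<sigma> A) (sub_tm \<sigma> a) (sub_tm \<sigma> b)))"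
  note A = subst_ty[OF assms(1) s] and a = subst_tm[OF assms(2) s] and b = subst_tm[OF assms(3) s]
  show "\<Delta> \<tturnstile> Tm TT (EqP (sub_ty \<sigma> A) (sub_tm \<sigma> a) (sub_tm \<sigma> b))"
    by (rule eq_I[OF stableD[OF stable_sub[OF assms(4) s] h a b] A a])
qed

text \<open>Propositions are collections too, so they belong to the recursion on type formation; proof
  irrelevance settles their case.\<close>

lemma stable_prop:
  assumes "\<Gamma> \<tturnstile> Ty Prop \<phi>"
  shows "stable \<Gamma> \<phi>"
  unfolding stable_def using assms by (auto intro: proof_irrelevance subst_ty)

section \<open>Induction towards propositions\<close>

text \<open>The eliminators of the calculus produce specific terms. When the motive is a proposition,
  proof irrelevance allows each to be replaced by \<open>TT\<close>; the lemmas below thus read the eliminators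
  as induction principles.\<close>

lemma inst_prf:
  assumes "A # \<Gamma> \<tturnstile> Ty Prop \<chi>" "\<Gamma> \<tturnstile> Tm p A" "\<Gamma> \<tturnstile> Tm t (sub_ty (p \<cdot> Var) \<chi>)"
  shows "\<Gamma> \<tturnstile> Tm TT (sub_ty (p \<cdot> Var) \<chi>)"
  using assms by (auto intro: proof_true subst_ty[OF assms(1) wsub_inst])

lemma var0: "\<Gamma> \<tturnstile> Ty Col A \<Longrightarrow> A # \<Gamma> \<tturnstile> Tm (Var 0) (sub_ty (shift (Suc 0)) A)"
  using var[OF ctx_cons, of \<Gamma> A 0] by simp

lemma n0_ind:
  assumes p: "\<Gamma> \<tturnstile> Tm p N0" and X: "\<Gamma> \<tturnstile> Ty Prop \<chi>"
  shows "\<Gamma> \<tturnstile> Tm TT \<chi>"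
proof -
  have N: "\<Gamma> \<tturnstile> Ty Col N0" using n0_form[OF derives_ctx[OF p]] by simp
  have X': "N0 # \<Gamma> \<tturnstile> Ty Prop (sub_ty (shift (Suc 0)) \<chi>)" by (rule subst_ty[OF X wsub_shift[OF N]])
  from inst_prf[OF X' p] n0_elim[OF prop_col[OF X'] p] show ?thesis by simp
qed

lemma n1_ind:
  assumes p: "\<Gamma> \<tturnstile> Tm p N1" and X: "N1 # \<Gamma> \<tturnstile> Ty Prop \<chi>"
    and h: "\<Gamma> \<tturnstile> Tm TT (sub_ty (Star \<cdot> Var) \<chi>)"
  shows "\<Gamma> \<tturnstile> Tm TT (sub_ty (p \<cdot> Var) \<chi>)"
  using inst_prf[OF X p] n1_elim[OF prop_col[OF X] p, of TT] h by simp

lemma plus_ind: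
  assumes A: "\<Gamma> \<tturnstile> Ty Col A" and B: "\<Gamma> \<tturnstile> Ty Col B" and p: "\<Gamma> \<tturnstile> Tm p (Plus A B)"
    and X: "Plus A B # \<Gamma> \<tturnstile> Ty Prop \<chi>"
    and l: "\<And>\<Delta> \<sigma> a. wsub \<Delta> \<sigma> \<Gamma> \<Longrightarrow> \<Delta> \<tturnstile> Tm a (sub_ty \<sigma> A) \<Longrightarrow> \<Delta> \<tturnstile> Tm TT (sub_ty (InL a \<cdot> \<sigma>) \<chi>)"
    and r: "\<And>\<Delta> \<sigma> b. wsub \<Delta> \<sigma> \<Gamma> \<Longrightarrow> \<Delta> \<tturnstile> Tm b (sub_ty \<sigma> B) \<Longrightarrow> \<Delta> \<tturnstile> Tm TT (sub_ty (InR b \<cdot> \<sigma>) \<chi>)"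
  shows "\<Gamma> \<tturnstile> Tm TT (sub_ty (p \<cdot> Var) \<chi>)"
  using inst_prf[OF X p] plus_elim[OF _ _ prop_col[OF X] p, of TT TT] A B
    l[OF wsub_shift[OF A] var0[OF A]] r[OF wsub_shift[OF B] var0[OF B]] by simp

lemma sigma_ind:
  assumes A: "\<Gamma> \<tturnstile> Ty Col A" and B: "A # \<Gamma> \<tturnstile> Ty Col B" and p: "\<Gamma> \<tturnstile> Tm p (Sigma A B)"
    and X: "Sigma A B # \<Gamma> \<tturnstile> Ty Prop \<chi>"
    and h: "\<And>\<Delta> \<sigma> a b. wsub \<Delta> \<sigma> \<Gamma> \<Longrightarrow> \<Delta> \<tturnstile> Tm a (sub_ty \<sigma> A) \<Longrightarrow> \<Delta> \<tturnstile> Tm b (sub_ty (a \<cdot> \<sigma>) B)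
      \<Longrightarrow> \<Delta> \<tturnstile> Tm TT (sub_ty (Pr a b \<cdot> \<sigma>) \<chi>)"
  shows "\<Gamma> \<tturnstile> Tm TT (sub_ty (p \<cdot> Var) \<chi>)"
proof -
  have w: "wsub (B # A # \<Gamma>) (shift (Suc (Suc 0))) \<Gamma>"
    using wsub_comp[OF wsub_shift[OF A] wsub_shift[OF B]] by simp
  have a: "B # A # \<Gamma> \<tturnstile> Tm (Var (Suc 0)) (sub_ty (shift (Suc (Suc 0))) A)"
    using subst_tm[OF var0[OF A] wsub_shift[OF B]] by simp
  have b: "B # A # \<Gamma> \<tturnstile> Tm (Var 0) (sub_ty (Var (Suc 0) \<cdot> shift (Suc (Suc 0))) B)"
    using var0[OF B] by simp
  from h[OF w a b] inst_prf[OF X p] sigma_elim[OF A B prop_col[OF X] p, of TT] show ?thesis by simp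
qed

text \<open>The eliminator asks that the branch respect the relation. For a proposition this is
  automatic: the branch is the constant \<open>TT\<close>.\<close>

lemma quot_ind:
  assumes A: "\<Gamma> \<tturnstile> Ty Col A" and R: "sub_ty (shift (Suc 0)) A # A # \<Gamma> \<tturnstile> Ty Prop R"
    and Q: "\<Gamma> \<tturnstile> Ty Col (Quot A R)" and p: "\<Gamma> \<tturnstile> Tm p (Quot A R)"
    and X: "Quot A R # \<Gamma> \<tturnstile> Ty Prop \<chi>"
    and h: "\<And>\<Delta> \<sigma> a. wsub \<Delta> \<sigma> \<Gamma> \<Longrightarrow> \<Delta> \<tturnstile> Tm a (sub_ty \<sigma> A) \<Longrightarrow> \<Delta> \<tturnstile> Tm TT (sub_ty (Cls a \<cdot> \<sigma>) \<chi>)"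
  shows "\<Gamma> \<tturnstile> Tm TT (sub_ty (p \<cdot> Var) \<chi>)"
proof -
  let ?A = "sub_ty (shift (Suc 0)) A"
  have A': "A # \<Gamma> \<tturnstile> Ty Col ?A" by (rule subst_ty[OF A wsub_shift[OF A]])
  have w: "wsub (?A # A # \<Gamma>) (shift (Suc (Suc 0))) \<Gamma>"
    using wsub_comp[OF wsub_shift[OF A] wsub_shift[OF A']] by simp
  from wsub_comp[OF w wsub_shift[OF prop_col[OF R]]]
  have w': "wsub (R # ?A # A # \<Gamma>) (shift (Suc (Suc (Suc 0)))) \<Gamma>" by simp
  have "?A # A # \<Gamma> \<tturnstile> Tm (Var (Suc 0)) (sub_ty (shift (Suc (Suc 0))) A)"
    using subst_tm[OF var0[OF A] wsub_shift[OF A']] by simp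
  from subst_tm[OF this wsub_shift[OF prop_col[OF R]]]
  have a: "R # ?A # A # \<Gamma> \<tturnstile> Tm (Var (Suc (Suc 0))) (sub_ty (shift (Suc (Suc (Suc 0)))) A)" by simp
  from tm_refl[OF h[OF w' a]] h[OF wsub_shift[OF A] var0[OF A]] inst_prf[OF X p]
    quot_elim[OF _ _ _ prop_col[OF X] p, of TT] A R Q
  show ?thesis by simp
qed

text \<open>In the branch for \<open>cons\<close> the variables are, from the outside in, the tail, the head and
  the induction hypothesis; the last one serves only to make the hypothesis true.\<close>

lemma list_ind:
  assumes A: "\<Gamma> \<tturnstile> Ty Col A" and p: "\<Gamma> \<tturnstile> Tm p (LIST A)"
    and X: "LIST A # \<Gamma> \<tturnstile> Ty Prop \<chi>"
    and n: "\<Gamma> \<tturnstile> Tm TT (sub_ty (LNil \<cdot> Var) \<chi>)"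
    and h: "\<And>\<Delta> \<sigma> s a. wsub \<Delta> \<sigma> \<Gamma> \<Longrightarrow> \<Delta> \<tturnstile> Tm s (LIST (sub_ty \<sigma> A)) \<Longrightarrow> \<Delta> \<tturnstile> Tm a (sub_ty \<sigma> A)
      \<Longrightarrow> \<Delta> \<tturnstile> Tm TT (sub_ty (s \<cdot> \<sigma>) \<chi>) \<Longrightarrow> \<Delta> \<tturnstile> Tm TT (sub_ty (LCons s a \<cdot> \<sigma>) \<chi>)"
  shows "\<Gamma> \<tturnstile> Tm TT (sub_ty (p \<cdot> Var) \<chi>)"
proof -
  have L: "\<Gamma> \<tturnstile> Ty Col (LIST A)" using list_form[of emTT_imp \<Gamma> A] A by simp
  let ?A = "sub_ty (shift (Suc 0)) A"
  let ?X = "sub_ty (Var (Suc 0) \<cdot> shift (Suc (Suc 0))) \<chi>"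
  note wL = wsub_shift[OF L]
  have A': "LIST A # \<Gamma> \<tturnstile> Ty Col ?A" by (rule subst_ty[OF A wL])
  note wA = wsub_shift[OF A']
  have X': "?A # LIST A # \<Gamma> \<tturnstile> Ty Prop ?X"
    using subst_ty[OF X wA] by simp
  note wX = wsub_shift[OF prop_col[OF X']]
  let ?\<Delta> = "?X # ?A # LIST A # \<Gamma>"
  have w: "wsub ?\<Delta> (shift (Suc (Suc (Suc 0)))) \<Gamma>"
    using wsub_comp[OF wL wsub_comp[OF wA wX]] by simp
  have s: "?\<Delta> \<tturnstile> Tm (Var (Suc (Suc 0))) (LIST (sub_ty (shift (Suc (Suc (Suc 0)))) A))"
    using subst_tm[OF var0[OF L] wsub_comp[OF wA wX]] by simp
  have a: "?\<Delta> \<tturnstile> Tm (Var (Suc 0)) (sub_ty (shift (Suc (Suc (Suc 0)))) A)"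
    using subst_tm[OF var0[OF A'] wX] by simp
  have x: "?\<Delta> \<tturnstile> Tm TT (sub_ty (Var (Suc (Suc 0)) \<cdot> shift (Suc (Suc (Suc 0)))) \<chi>)"
    using hyp[OF X'] by simp
  from h[OF w s a x] n inst_prf[OF X p] list_elim[OF _ prop_col[OF X] p, of TT TT] A
  show ?thesis by simp
qed

section \<open>Stability of equality in the type constructors\<close>

text \<open>Stability of equality at two given elements. Being a proposition of the calculus, it can
  be proved with the induction principles above, in one argument at a time.\<close>

abbreviation stab_at :: "ty \<Rightarrow> tm \<Rightarrow> tm \<Rightarrow> ty" where
  "stab_at A a b \<equiv> Impl (nn (EqP A a b)) (EqP A a b)"

lemma stab_at_prop:
  "\<Gamma> \<tturnstile> Ty Col A \<Longrightarrow> \<Gamma> \<tturnstile> Tm a A \<Longrightarrow> \<Gamma> \<tturnstile> Tm b A \<Longrightarrow> \<Gamma> \<tturnstile> Ty Prop (stab_at A a b)"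
  by (intro impl_prop neg_prop eq_prop)

lemma stab_at_I:
  assumes "\<Gamma> \<tturnstile> Ty Col A" "\<Gamma> \<tturnstile> Tm a A" "\<Gamma> \<tturnstile> Tm b A"
    and "\<And>\<Delta> \<sigma>. wsub \<Delta> \<sigma> \<Gamma> \<Longrightarrow> \<Delta> \<tturnstile> Tm TT (nn (EqP (sub_ty \<sigma> A) (sub_tm \<sigma> a) (sub_tm \<sigma> b)))
      \<Longrightarrow> \<Delta> \<tturnstile> TmEq (sub_tm \<sigma> a) (sub_tm \<sigma> b) (sub_ty \<sigma> A)"
  shows "\<Gamma> \<tturnstile> Tm TT (stab_at A a b)"
  using assms(1-3) by (auto intro!: impl_I neg_prop eq_prop eq_I assms(4) intro: subst_ty subst_tm)

lemma stableI:
  assumes A: "\<Gamma> \<tturnstile> Ty Col A"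
    and h: "\<And>\<Delta> \<sigma> a b. wsub \<Delta> \<sigma> \<Gamma> \<Longrightarrow> \<Delta> \<tturnstile> Tm a (sub_ty \<sigma> A) \<Longrightarrow> \<Delta> \<tturnstile> Tm b (sub_ty \<sigma> A)
      \<Longrightarrow> \<Delta> \<tturnstile> Tm TT (stab_at (sub_ty \<sigma> A) a b)"
  shows "stable \<Gamma> A"
  unfolding stable_def
proof (intro allI impI)
  fix \<Delta> \<sigma> a b
  assume s: "wsub \<Delta> \<sigma> \<Gamma>" and a: "\<Delta> \<tturnstile> Tm a (sub_ty \<sigma> A)" and b: "\<Delta> \<tturnstile> Tm b (sub_ty \<sigma> A)"
    and n: "\<Delta> \<tturnstile> Tm TT (nn (EqP (sub_ty \<sigma> A) a b))"
  note A' = subst_ty[OF A s]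
  show "\<Delta> \<tturnstile> TmEq a b (sub_ty \<sigma> A)"
    using impl_E[OF h[OF s a b] n neg_prop[OF neg_prop[OF eq_prop[OF A' a b]]] eq_prop[OF A' a b]]
    by (rule eq_E) (fact A' a b)+
qed

lemma stable_n0: "\<Gamma> \<tturnstile> Ctx \<Longrightarrow> stable \<Gamma> N0"
proof (rule stableI)
  assume "\<Gamma> \<tturnstile> Ctx" then show N: "\<Gamma> \<tturnstile> Ty Col N0" using n0_form[of emTT_imp \<Gamma>] by simp
  fix \<Delta> \<sigma> a b assume "wsub \<Delta> \<sigma> \<Gamma>" "\<Delta> \<tturnstile> Tm a (sub_ty \<sigma> N0)" "\<Delta> \<tturnstile> Tm b (sub_ty \<sigma> N0)"
  then show "\<Delta> \<tturnstile> Tm TT (stab_at (sub_ty \<sigma> N0) a b)"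
    using subst_ty[OF N] by (intro n0_ind[of \<Delta> a] stab_at_prop) auto
qed

lemma n1_eta:
  assumes p: "\<Gamma> \<tturnstile> Tm p N1"
  shows "\<Gamma> \<tturnstile> TmEq p Star N1"
proof -
  have N: "\<Gamma>' \<tturnstile> Ty Col N1" "\<Gamma>' \<tturnstile> Tm Star N1" if "\<Gamma>' \<tturnstile> Ctx" for \<Gamma>'
    using n1_form[OF that] n1_intro[OF that] by simp_all
  note N1 = N[OF derives_ctx[OF p]] and N2 = N[OF ctx_cons[OF N(1)[OF derives_ctx[OF p]]]]
  have "N1 # \<Gamma> \<tturnstile> Ty Prop (EqP N1 (Var 0) Star)"
    using var0[OF N1(1)] N2 by (intro eq_prop) simp_all
  from n1_ind[OF p this] eq_intro[OF N1] have "\<Gamma> \<tturnstile> Tm TT (EqP N1 p Star)" by simp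
  then show ?thesis by (rule eq_E[OF _ N1(1) p N1(2)])
qed

lemma stable_n1: "\<Gamma> \<tturnstile> Ctx \<Longrightarrow> stable \<Gamma> N1"
  unfolding stable_def sub_ty.simps by (intro allI impI tm_trans[OF n1_eta tm_sym[OF n1_eta]])

subsection \<open>Truth values that tell constructors apart\<close>

text \<open>There is no universe into which one could eliminate to separate two constructors. The
  collection of truth values serves instead: a map that sends one constructor to \<open>\<top>\<close> and the other
  to \<open>\<bottom>\<close> turns an equation between them into the equivalence of \<open>\<top>\<close> and \<open>\<bottom>\<close>.\<close>

lemma code_top_bot:
  assumes "\<Gamma> \<tturnstile> TmEq (Code Top) (Code Bot) P1"
  shows "\<Gamma> \<tturnstile> Tm TT Bot"
proof -
  have c: "\<Gamma> \<tturnstile> Ctx" by (rule derives_ctx[OF assms])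
  have b: "\<Gamma> \<tturnstile> Ty Prop Bot" "\<Gamma> \<tturnstile> Ty Prop Top" by (intro bot_prop neg_prop c)+
  have "\<Gamma> \<tturnstile> Tm TT (Iff Top Bot)" using code_eff[OF _ _ assms] b by simp
  then have "\<Gamma> \<tturnstile> Tm TT (Impl Top Bot)" using b by (auto intro: conj_elim1 neg_prop impl_prop)
  then show ?thesis using top_true[OF c] b by (auto intro: impl_E)
qed

lemma p1_col: "\<Gamma> \<tturnstile> Ctx \<Longrightarrow> \<Gamma> \<tturnstile> Ty Col P1"
  by (rule p1_form)

lemma code_tm: "\<Gamma> \<tturnstile> Ty Prop \<phi> \<Longrightarrow> \<Gamma> \<tturnstile> Tm (Code \<phi>) P1"
  using code_intro[of emTT_imp \<Gamma> \<phi>] by simp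

lemma code_top_bot_tm:
  assumes "\<Gamma> \<tturnstile> Ctx"
  shows "\<Gamma> \<tturnstile> Tm (Code Top) P1" "\<Gamma> \<tturnstile> Tm (Code Bot) P1"
  using assms by (auto intro!: code_tm neg_prop bot_prop)

subsection \<open>Sums\<close>

lemma plus_col: "\<Gamma> \<tturnstile> Ty Col A \<Longrightarrow> \<Gamma> \<tturnstile> Ty Col B \<Longrightarrow> \<Gamma> \<tturnstile> Ty Col (Plus A B)"
  using plus_form[of emTT_imp \<Gamma> A B] by simp

lemma inl_tm: "\<Gamma> \<tturnstile> Ty Col A \<Longrightarrow> \<Gamma> \<tturnstile> Ty Col B \<Longrightarrow> \<Gamma> \<tturnstile> Tm a A \<Longrightarrow> \<Gamma> \<tturnstile> Tm (InL a) (Plus A B)"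
  using inl_intro[of emTT_imp \<Gamma> A B] by simp

lemma inr_tm: "\<Gamma> \<tturnstile> Ty Col A \<Longrightarrow> \<Gamma> \<tturnstile> Ty Col B \<Longrightarrow> \<Gamma> \<tturnstile> Tm b B \<Longrightarrow> \<Gamma> \<tturnstile> Tm (InR b) (Plus A B)"
  using inr_intro[of emTT_imp \<Gamma> A B] by simp

text \<open>Recursion with a constant motive. It will be used to build partial inverses of the
  constructors and the truth value that separates them.\<close>

lemma plus_rec_eq:
  assumes A: "\<Gamma> \<tturnstile> Ty Col A" and B: "\<Gamma> \<tturnstile> Ty Col B" and C: "\<Gamma> \<tturnstile> Ty Col C"
    and l: "A # \<Gamma> \<tturnstile> Tm l (sub_ty (shift (Suc 0)) C)" and r: "B # \<Gamma> \<tturnstile> Tm r (sub_ty (shift (Suc 0)) C)"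
  shows "\<Gamma> \<tturnstile> TmEq p q (Plus A B) \<Longrightarrow> \<Gamma> \<tturnstile> TmEq (ElPlus p l r) (ElPlus q l r) C"
    and "\<Gamma> \<tturnstile> Tm a A \<Longrightarrow> \<Gamma> \<tturnstile> TmEq (ElPlus (InL a) l r) (sub_tm (a \<cdot> Var) l) C"
    and "\<Gamma> \<tturnstile> Tm b B \<Longrightarrow> \<Gamma> \<tturnstile> TmEq (ElPlus (InR b) l r) (sub_tm (b \<cdot> Var) r) C"
proof -
  have L: "Plus A B # \<Gamma> \<tturnstile> Ty Col (sub_ty (shift (Suc 0)) C)"
    by (rule subst_ty[OF C wsub_shift[OF plus_col[OF A B]]])
  show "\<Gamma> \<tturnstile> TmEq p q (Plus A B) \<Longrightarrow> \<Gamma> \<tturnstile> TmEq (ElPlus p l r) (ElPlus q l r) C"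
    using plus_elim_cong[OF _ _ L, of p q l l r r] A B tm_refl[OF l] tm_refl[OF r] by simp
  show "\<Gamma> \<tturnstile> Tm a A \<Longrightarrow> \<Gamma> \<tturnstile> TmEq (ElPlus (InL a) l r) (sub_tm (a \<cdot> Var) l) C"
    using inl_beta[OF _ _ L, of a l r] A B l r by simp
  show "\<Gamma> \<tturnstile> Tm b B \<Longrightarrow> \<Gamma> \<tturnstile> TmEq (ElPlus (InR b) l r) (sub_tm (b \<cdot> Var) r) C"
    using inr_beta[OF _ _ L, of b l r] A B l r by simp
qed

text \<open>The retraction is the case distinction that returns the argument of \<open>inl\<close>; on \<open>inr\<close> it may
  return anything in \<open>A\<close>, for which \<open>a\<close> itself is at hand.\<close>

lemma inl_inj:
  assumes A: "\<Gamma> \<tturnstile> Ty Col A" and B: "\<Gamma> \<tturnstile> Ty Col B" and a: "\<Gamma> \<tturnstile> Tm a A" and a': "\<Gamma> \<tturnstile> Tm a' A"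
    and e: "\<Gamma> \<tturnstile> TmEq (InL a) (InL a') (Plus A B)"
  shows "\<Gamma> \<tturnstile> TmEq a a' A"
proof -
  note rec = plus_rec_eq[OF A B A var0[OF A] subst_tm[OF a wsub_shift[OF B]]]
  from tm_trans[OF tm_trans[OF tm_sym[OF rec(2)[OF a]] rec(1)[OF e]] rec(2)[OF a']] show ?thesis by simp
qed

lemma inr_inj:
  assumes A: "\<Gamma> \<tturnstile> Ty Col A" and B: "\<Gamma> \<tturnstile> Ty Col B" and b: "\<Gamma> \<tturnstile> Tm b B" and b': "\<Gamma> \<tturnstile> Tm b' B"
    and e: "\<Gamma> \<tturnstile> TmEq (InR b) (InR b') (Plus A B)"
  shows "\<Gamma> \<tturnstile> TmEq b b' B"
proof -
  note rec = plus_rec_eq[OF A B B subst_tm[OF b wsub_shift[OF A]] var0[OF B]]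
  from tm_trans[OF tm_trans[OF tm_sym[OF rec(3)[OF b]] rec(1)[OF e]] rec(3)[OF b']] show ?thesis by simp
qed

lemma inl_neq_inr:
  assumes A: "\<Gamma> \<tturnstile> Ty Col A" and B: "\<Gamma> \<tturnstile> Ty Col B" and a: "\<Gamma> \<tturnstile> Tm a A" and b: "\<Gamma> \<tturnstile> Tm b B"
    and e: "\<Gamma> \<tturnstile> TmEq (InL a) (InR b) (Plus A B)"
  shows "\<Gamma> \<tturnstile> Tm TT Bot"
proof -
  have l: "A # \<Gamma> \<tturnstile> Tm (Code Top) (sub_ty (shift (Suc 0)) P1)"
    using code_top_bot_tm[OF ctx_cons[OF A]] by simp
  have r: "B # \<Gamma> \<tturnstile> Tm (Code Bot) (sub_ty (shift (Suc 0)) P1)"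
    using code_top_bot_tm[OF ctx_cons[OF B]] by simp
  note rec = plus_rec_eq[OF A B p1_col[OF derives_ctx[OF A]] l r]
  from tm_trans[OF tm_trans[OF tm_sym[OF rec(2)[OF a]] rec(1)[OF e]] rec(3)[OF b]]
  show ?thesis by (intro code_top_bot) simp
qed

text \<open>If \<open>c = d\<close> and \<open>a = b\<close> imply each other, stability passes from the second equation to the
  first. In the applications \<open>a\<close> and \<open>b\<close> are the arguments of a constructor.\<close>

lemma stab_at_components:
  assumes C: "\<Gamma> \<tturnstile> Ty Col C" "\<Gamma> \<tturnstile> Tm c C" "\<Gamma> \<tturnstile> Tm d C"
    and A: "\<Gamma> \<tturnstile> Ty Col A" "\<Gamma> \<tturnstile> Tm a A" "\<Gamma> \<tturnstile> Tm b A" and st: "stable \<Gamma> A"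
    and inv: "\<And>\<Delta> \<sigma>. wsub \<Delta> \<sigma> \<Gamma> \<Longrightarrow> \<Delta> \<tturnstile> TmEq (sub_tm \<sigma> c) (sub_tm \<sigma> d) (sub_ty \<sigma> C)
      \<Longrightarrow> \<Delta> \<tturnstile> TmEq (sub_tm \<sigma> a) (sub_tm \<sigma> b) (sub_ty \<sigma> A)"
    and fwd: "\<And>\<Delta> \<sigma>. wsub \<Delta> \<sigma> \<Gamma> \<Longrightarrow> \<Delta> \<tturnstile> TmEq (sub_tm \<sigma> a) (sub_tm \<sigma> b) (sub_ty \<sigma> A)
      \<Longrightarrow> \<Delta> \<tturnstile> TmEq (sub_tm \<sigma> c) (sub_tm \<sigma> d) (sub_ty \<sigma> C)"
  shows "\<Gamma> \<tturnstile> Tm TT (stab_at C c d)"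
proof (rule stab_at_I[OF C])
  fix \<Delta> \<sigma> assume s: "wsub \<Delta> \<sigma> \<Gamma>"
    and n: "\<Delta> \<tturnstile> Tm TT (nn (EqP (sub_ty \<sigma> C) (sub_tm \<sigma> c) (sub_tm \<sigma> d)))"
  note C' = subst_ty[OF C(1) s] subst_tm[OF C(2) s] subst_tm[OF C(3) s]
  note A' = subst_ty[OF A(1) s] subst_tm[OF A(2) s] subst_tm[OF A(3) s]
  have "\<Delta> \<tturnstile> Tm TT (nn (EqP (sub_ty \<sigma> A) (sub_tm \<sigma> a) (sub_tm \<sigma> b)))"
    by (rule nn_eq_cong[OF C' n A']) (use inv[OF wsub_comp[OF s]] in simp)
  from stableD[OF stable_sub[OF st s] this A'(2,3)]
  show "\<Delta> \<tturnstile> TmEq (sub_tm \<sigma> c) (sub_tm \<sigma> d) (sub_ty \<sigma> C)" by (rule fwd[OF s])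
qed

text \<open>Equality of distinct constructors is absurd; so is its double negation, and an absurdity
  proves the equation itself.\<close>

lemma stab_at_absurd:
  assumes C: "\<Gamma> \<tturnstile> Ty Col C" "\<Gamma> \<tturnstile> Tm c C" "\<Gamma> \<tturnstile> Tm d C"
    and inv: "\<And>\<Delta> \<sigma>. wsub \<Delta> \<sigma> \<Gamma> \<Longrightarrow> \<Delta> \<tturnstile> TmEq (sub_tm \<sigma> c) (sub_tm \<sigma> d) (sub_ty \<sigma> C)
      \<Longrightarrow> \<Delta> \<tturnstile> Tm TT Bot"
  shows "\<Gamma> \<tturnstile> Tm TT (stab_at C c d)"
proof (rule stab_at_I[OF C])
  fix \<Delta> \<sigma> assume s: "wsub \<Delta> \<sigma> \<Gamma>"
    and n: "\<Delta> \<tturnstile> Tm TT (nn (EqP (sub_ty \<sigma> C) (sub_tm \<sigma> c) (sub_tm \<sigma> d)))"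
  note C' = subst_ty[OF C(1) s] subst_tm[OF C(2) s] subst_tm[OF C(3) s]
  have "\<Delta> \<tturnstile> Tm TT (nn Bot)"
    using inv[OF wsub_comp[OF s]] by (intro nn_eq_map[OF C' n] bot_prop derives_ctx[OF n]) simp
  then have "\<Delta> \<tturnstile> Tm TT Bot" by (rule pstableD[OF pstable_bot])
  then show "\<Delta> \<tturnstile> TmEq (sub_tm \<sigma> c) (sub_tm \<sigma> d) (sub_ty \<sigma> C)"
    by (intro eq_E[OF bot_elim C'] eq_prop C')
qed

lemma stab_at_sym:
  assumes h: "\<Gamma> \<tturnstile> Tm TT (stab_at C d c)" and C: "\<Gamma> \<tturnstile> Ty Col C" "\<Gamma> \<tturnstile> Tm c C" "\<Gamma> \<tturnstile> Tm d C"
  shows "\<Gamma> \<tturnstile> Tm TT (stab_at C c d)"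
proof (rule stab_at_I[OF C])
  fix \<Delta> \<sigma> assume s: "wsub \<Delta> \<sigma> \<Gamma>"
    and n: "\<Delta> \<tturnstile> Tm TT (nn (EqP (sub_ty \<sigma> C) (sub_tm \<sigma> c) (sub_tm \<sigma> d)))"
  note C' = subst_ty[OF C(1) s] subst_tm[OF C(2) s] subst_tm[OF C(3) s]
  have n': "\<Delta> \<tturnstile> Tm TT (nn (EqP (sub_ty \<sigma> C) (sub_tm \<sigma> d) (sub_tm \<sigma> c)))"
    by (rule nn_eq_cong[OF C' n C'(1,3,2)]) (rule tm_sym)
  have e: "\<Delta> \<tturnstile> Ty Prop (EqP (sub_ty \<sigma> C) (sub_tm \<sigma> d) (sub_tm \<sigma> c))" by (rule eq_prop[OF C'(1,3,2)])
  show "\<Delta> \<tturnstile> TmEq (sub_tm \<sigma> c) (sub_tm \<sigma> d) (sub_ty \<sigma> C)"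
    using impl_E[OF _ n' neg_prop[OF neg_prop[OF e]] e] subst_prf[OF h s]
    by (intro tm_sym[OF eq_E[OF _ C'(1,3,2)]]) simp
qed

lemma stab_at_plus_ind:
  assumes A: "\<Gamma> \<tturnstile> Ty Col A" and B: "\<Gamma> \<tturnstile> Ty Col B"
    and p: "\<Gamma> \<tturnstile> Tm p (Plus A B)" and q: "\<Gamma> \<tturnstile> Tm q (Plus A B)"
    and l: "\<And>\<Delta> \<sigma> a. wsub \<Delta> \<sigma> \<Gamma> \<Longrightarrow> \<Delta> \<tturnstile> Tm a (sub_ty \<sigma> A)
      \<Longrightarrow> \<Delta> \<tturnstile> Tm TT (stab_at (sub_ty \<sigma> (Plus A B)) (InL a) (sub_tm \<sigma> q))"
    and r: "\<And>\<Delta> \<sigma> b. wsub \<Delta> \<sigma> \<Gamma> \<Longrightarrow> \<Delta> \<tturnstile> Tm b (sub_ty \<sigma> B)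
      \<Longrightarrow> \<Delta> \<tturnstile> Tm TT (stab_at (sub_ty \<sigma> (Plus A B)) (InR b) (sub_tm \<sigma> q))"
  shows "\<Gamma> \<tturnstile> Tm TT (stab_at (Plus A B) p q)"
proof -
  let ?P = "Plus A B"
  note P = plus_col[OF A B] and w = wsub_shift[OF plus_col[OF A B]]
  have "\<Gamma> \<tturnstile> Tm TT (sub_ty (p \<cdot> Var) (stab_at (sub_ty (shift (Suc 0)) ?P) (Var 0) (sub_tm (shift (Suc
      0)) q)))"
  proof (rule plus_ind[OF A B p])
    show "?P # \<Gamma> \<tturnstile> Ty Prop (stab_at (sub_ty (shift (Suc 0)) ?P) (Var 0) (sub_tm (shift (Suc 0)) q))"
      by (rule stab_at_prop[OF subst_ty[OF P w] var0[OF P] subst_tm[OF q w]])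
  qed (use l r in simp_all)
  then show ?thesis by simp
qed

lemma stab_at_inl:
  assumes A: "\<Gamma> \<tturnstile> Ty Col A" and B: "\<Gamma> \<tturnstile> Ty Col B" and sA: "stable \<Gamma> A"
    and a: "\<Gamma> \<tturnstile> Tm a A" and b: "\<Gamma> \<tturnstile> Tm b A"
  shows "\<Gamma> \<tturnstile> Tm TT (stab_at (Plus A B) (InL a) (InL b))"
proof (rule stab_at_components[OF plus_col[OF A B] inl_tm[OF A B a] inl_tm[OF A B b] A a b sA])
  fix \<Delta> \<sigma> assume s: "wsub \<Delta> \<sigma> \<Gamma>"
  note A' = subst_ty[OF A s] and B' = subst_ty[OF B s]
  show "\<Delta> \<tturnstile> TmEq (sub_tm \<sigma> (InL a)) (sub_tm \<sigma> (InL b)) (sub_ty \<sigma> (Plus A B))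
    \<Longrightarrow> \<Delta> \<tturnstile> TmEq (sub_tm \<sigma> a) (sub_tm \<sigma> b) (sub_ty \<sigma> A)"
    using inl_inj[OF A' B' subst_tm[OF a s] subst_tm[OF b s]] by simp
  show "\<Delta> \<tturnstile> TmEq (sub_tm \<sigma> a) (sub_tm \<sigma> b) (sub_ty \<sigma> A)
    \<Longrightarrow> \<Delta> \<tturnstile> TmEq (sub_tm \<sigma> (InL a)) (sub_tm \<sigma> (InL b)) (sub_ty \<sigma> (Plus A B))"
    using A' B' by (simp add: inl_cong)
qed

lemma stab_at_inr:
  assumes A: "\<Gamma> \<tturnstile> Ty Col A" and B: "\<Gamma> \<tturnstile> Ty Col B" and sB: "stable \<Gamma> B"
    and a: "\<Gamma> \<tturnstile> Tm a B" and b: "\<Gamma> \<tturnstile> Tm b B"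
  shows "\<Gamma> \<tturnstile> Tm TT (stab_at (Plus A B) (InR a) (InR b))"
proof (rule stab_at_components[OF plus_col[OF A B] inr_tm[OF A B a] inr_tm[OF A B b] B a b sB])
  fix \<Delta> \<sigma> assume s: "wsub \<Delta> \<sigma> \<Gamma>"
  note A' = subst_ty[OF A s] and B' = subst_ty[OF B s]
  show "\<Delta> \<tturnstile> TmEq (sub_tm \<sigma> (InR a)) (sub_tm \<sigma> (InR b)) (sub_ty \<sigma> (Plus A B))
    \<Longrightarrow> \<Delta> \<tturnstile> TmEq (sub_tm \<sigma> a) (sub_tm \<sigma> b) (sub_ty \<sigma> B)"
    using inr_inj[OF A' B' subst_tm[OF a s] subst_tm[OF b s]] by simp
  show "\<Delta> \<tturnstile> TmEq (sub_tm \<sigma> a) (sub_tm \<sigma> b) (sub_ty \<sigma> B)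
    \<Longrightarrow> \<Delta> \<tturnstile> TmEq (sub_tm \<sigma> (InR a)) (sub_tm \<sigma> (InR b)) (sub_ty \<sigma> (Plus A B))"
    using A' B' by (simp add: inr_cong)
qed

lemma stab_at_inl_inr:
  assumes A: "\<Gamma> \<tturnstile> Ty Col A" and B: "\<Gamma> \<tturnstile> Ty Col B" and a: "\<Gamma> \<tturnstile> Tm a A" and b: "\<Gamma> \<tturnstile> Tm b B"
  shows "\<Gamma> \<tturnstile> Tm TT (stab_at (Plus A B) (InL a) (InR b))"
proof (rule stab_at_absurd[OF plus_col[OF A B] inl_tm[OF A B a] inr_tm[OF A B b]])
  fix \<Delta> \<sigma> assume s: "wsub \<Delta> \<sigma> \<Gamma>"
    and e: "\<Delta> \<tturnstile> TmEq (sub_tm \<sigma> (InL a)) (sub_tm \<sigma> (InR b)) (sub_ty \<sigma> (Plus A B))"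
  then show "\<Delta> \<tturnstile> Tm TT Bot"
    using inl_neq_inr[OF subst_ty[OF A s] subst_ty[OF B s] subst_tm[OF a s] subst_tm[OF b s]] by simp
qed

lemma stab_at_plus_inl:
  assumes A: "\<Gamma> \<tturnstile> Ty Col A" and B: "\<Gamma> \<tturnstile> Ty Col B" and sA: "stable \<Gamma> A"
    and a: "\<Gamma> \<tturnstile> Tm a A" and q: "\<Gamma> \<tturnstile> Tm q (Plus A B)"
  shows "\<Gamma> \<tturnstile> Tm TT (stab_at (Plus A B) q (InL a))"
proof (rule stab_at_plus_ind[OF A B q inl_tm[OF A B a]])
  fix \<Delta> \<sigma> b assume s: "wsub \<Delta> \<sigma> \<Gamma>"
  note A = subst_ty[OF A s] and B = subst_ty[OF B s] and a = subst_tm[OF a s] and sA = stable_sub[OF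
      sA s]
  show "\<Delta> \<tturnstile> Tm b (sub_ty \<sigma> A)
    \<Longrightarrow> \<Delta> \<tturnstile> Tm TT (stab_at (sub_ty \<sigma> (Plus A B)) (InL b) (sub_tm \<sigma> (InL a)))"
    using stab_at_inl[OF A B sA _ a] by simp
  show "\<Delta> \<tturnstile> Tm b (sub_ty \<sigma> B)
    \<Longrightarrow> \<Delta> \<tturnstile> Tm TT (stab_at (sub_ty \<sigma> (Plus A B)) (InR b) (sub_tm \<sigma> (InL a)))"
    using stab_at_sym[OF stab_at_inl_inr[OF A B a] plus_col[OF A B] inr_tm[OF A B] inl_tm[OF A B a]]
    by simp
qed

lemma stab_at_plus_inr:
  assumes A: "\<Gamma> \<tturnstile> Ty Col A" and B: "\<Gamma> \<tturnstile> Ty Col B" and sB: "stable \<Gamma> B"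
    and a: "\<Gamma> \<tturnstile> Tm a B" and q: "\<Gamma> \<tturnstile> Tm q (Plus A B)"
  shows "\<Gamma> \<tturnstile> Tm TT (stab_at (Plus A B) q (InR a))"
proof (rule stab_at_plus_ind[OF A B q inr_tm[OF A B a]])
  fix \<Delta> \<sigma> b assume s: "wsub \<Delta> \<sigma> \<Gamma>"
  note A = subst_ty[OF A s] and B = subst_ty[OF B s] and a = subst_tm[OF a s] and sB = stable_sub[OF
      sB s]
  show "\<Delta> \<tturnstile> Tm b (sub_ty \<sigma> A)
    \<Longrightarrow> \<Delta> \<tturnstile> Tm TT (stab_at (sub_ty \<sigma> (Plus A B)) (InL b) (sub_tm \<sigma> (InR a)))"
    using stab_at_inl_inr[OF A B _ a] by simp
  show "\<Delta> \<tturnstile> Tm b (sub_ty \<sigma> B)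
    \<Longrightarrow> \<Delta> \<tturnstile> Tm TT (stab_at (sub_ty \<sigma> (Plus A B)) (InR b) (sub_tm \<sigma> (InR a)))"
    using stab_at_inr[OF A B sB _ a] by simp
qed

lemma stable_plus:
  assumes A: "\<Gamma> \<tturnstile> Ty Col A" and B: "\<Gamma> \<tturnstile> Ty Col B" and sA: "stable \<Gamma> A" and sB: "stable \<Gamma> B"
  shows "stable \<Gamma> (Plus A B)"
proof (rule stableI[OF plus_col[OF A B]])
  fix \<Delta> \<sigma> p q
  assume s: "wsub \<Delta> \<sigma> \<Gamma>"
    and p: "\<Delta> \<tturnstile> Tm p (sub_ty \<sigma> (Plus A B))" and q: "\<Delta> \<tturnstile> Tm q (sub_ty \<sigma> (Plus A B))"
  note A = subst_ty[OF A s] and B = subst_ty[OF B s]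
    and sA = stable_sub[OF sA s] and sB = stable_sub[OF sB s]
  have "\<Delta> \<tturnstile> Tm TT (stab_at (Plus (sub_ty \<sigma> A) (sub_ty \<sigma> B)) p q)"
  proof (rule stab_at_plus_ind[OF A B])
    fix \<Theta> \<tau> a assume r: "wsub \<Theta> \<tau> \<Delta>"
    note A = subst_ty[OF A r] and B = subst_ty[OF B r]
      and sA = stable_sub[OF sA r] and sB = stable_sub[OF sB r]
    have q: "\<Theta> \<tturnstile> Tm (sub_tm \<tau> q) (Plus (sub_ty \<tau> (sub_ty \<sigma> A)) (sub_ty \<tau> (sub_ty \<sigma> B)))"
      using subst_tm[OF q r] by simp
    show "\<Theta> \<tturnstile> Tm a (sub_ty \<tau> (sub_ty \<sigma> A))
      \<Longrightarrow> \<Theta> \<tturnstile> Tm TT (stab_at (sub_ty \<tau> (Plus (sub_ty \<sigma> A) (sub_ty \<sigma> B))) (InL a) (sub_tm \<tau> q))"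
      using stab_at_sym[OF stab_at_plus_inl[OF A B sA _ q] plus_col[OF A B] inl_tm[OF A B] q] by simp
    show "\<Theta> \<tturnstile> Tm a (sub_ty \<tau> (sub_ty \<sigma> B))
      \<Longrightarrow> \<Theta> \<tturnstile> Tm TT (stab_at (sub_ty \<tau> (Plus (sub_ty \<sigma> A) (sub_ty \<sigma> B))) (InR a) (sub_tm \<tau> q))"
      using stab_at_sym[OF stab_at_plus_inr[OF A B sB _ q] plus_col[OF A B] inr_tm[OF A B] q] by simp
  qed (use p q in simp_all)
  then show "\<Delta> \<tturnstile> Tm TT (stab_at (sub_ty \<sigma> (Plus A B)) p q)" by simp
qed

subsection \<open>Indexed sums\<close>

text \<open>Dependent types respect judgemental equality of their argument. Indexed sums need this to
  compare second components, which a priori lie in different types.\<close>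

lemma scons_ty_eq:
  assumes B: "A # \<Gamma> \<tturnstile> Ty k B" and s: "wsub \<Delta> \<sigma> \<Gamma>"
    and e: "\<Delta> \<tturnstile> TmEq a b (sub_ty \<sigma> A)" and a: "\<Delta> \<tturnstile> Tm a (sub_ty \<sigma> A)" and b: "\<Delta> \<tturnstile> Tm b (sub_ty \<sigma> A)"
  shows "\<Delta> \<tturnstile> TyEq k (sub_ty (a \<cdot> \<sigma>) B) (sub_ty (b \<cdot> \<sigma>) B)"
proof (rule substitution_ty_eq[OF B wsub_ctx[OF s]])
  show "\<forall>i<length (A # \<Gamma>). \<Delta> \<tturnstile> TmEq ((a \<cdot> \<sigma>) i) ((b \<cdot> \<sigma>) i) (sub_ty (a \<cdot> \<sigma>) (var_ty (A # \<Gamma>) i))"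
  proof (intro allI impI)
    fix i assume "i < length (A # \<Gamma>)"
    then show "\<Delta> \<tturnstile> TmEq ((a \<cdot> \<sigma>) i) ((b \<cdot> \<sigma>) i) (sub_ty (a \<cdot> \<sigma>) (var_ty (A # \<Gamma>) i))"
      using e s by (cases i) (auto simp: wsub_def intro: tm_refl)
  qed
qed (use wsub_scons[OF s a, unfolded wsub_def] wsub_scons[OF s b, unfolded wsub_def] in blast)+

lemma sigma_col: "\<Gamma> \<tturnstile> Ty Col A \<Longrightarrow> A # \<Gamma> \<tturnstile> Ty Col B \<Longrightarrow> \<Gamma> \<tturnstile> Ty Col (Sigma A B)"
  by (rule sigma_form) simp_all

abbreviation FST :: "tm \<Rightarrow> tm" where "FST p \<equiv> ElSigma p (Var (Suc 0))"
abbreviation SND :: "tm \<Rightarrow> tm" where "SND p \<equiv> ElSigma p (Var 0)"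

lemma fst_rules:
  assumes A: "\<Gamma> \<tturnstile> Ty Col A" and B: "A # \<Gamma> \<tturnstile> Ty Col B"
  shows "\<Gamma> \<tturnstile> Tm p (Sigma A B) \<Longrightarrow> \<Gamma> \<tturnstile> Tm (FST p) A"
    and "\<Gamma> \<tturnstile> TmEq p q (Sigma A B) \<Longrightarrow> \<Gamma> \<tturnstile> TmEq (FST p) (FST q) A"
    and "\<Gamma> \<tturnstile> Tm a A \<Longrightarrow> \<Gamma> \<tturnstile> Tm b (sub_ty (a \<cdot> Var) B) \<Longrightarrow> \<Gamma> \<tturnstile> TmEq (FST (Pr a b)) a A"
proof -
  have L: "Sigma A B # \<Gamma> \<tturnstile> Ty Col (sub_ty (shift (Suc 0)) A)"
    by (rule subst_ty[OF A wsub_shift[OF sigma_col[OF A B]]])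
  have m: "B # A # \<Gamma> \<tturnstile> Tm (Var (Suc 0)) (sub_ty (shift (Suc (Suc 0))) A)"
    using subst_tm[OF var0[OF A] wsub_shift[OF B]] by simp
  show "\<Gamma> \<tturnstile> Tm p (Sigma A B) \<Longrightarrow> \<Gamma> \<tturnstile> Tm (FST p) A"
    using sigma_elim[OF A B L, of p "Var (Suc 0)"] m by simp
  show "\<Gamma> \<tturnstile> TmEq p q (Sigma A B) \<Longrightarrow> \<Gamma> \<tturnstile> TmEq (FST p) (FST q) A"
    using sigma_elim_cong[OF A B L, of p q "Var (Suc 0)" "Var (Suc 0)"] tm_refl[OF m] by simp
  show "\<Gamma> \<tturnstile> Tm a A \<Longrightarrow> \<Gamma> \<tturnstile> Tm b (sub_ty (a \<cdot> Var) B) \<Longrightarrow> \<Gamma> \<tturnstile> TmEq (FST (Pr a b)) a A"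
    using sigma_beta[OF A B L, of a b "Var (Suc 0)"] m by simp
qed

lemma pair_tm:
  "\<Gamma> \<tturnstile> Ty Col A \<Longrightarrow> A # \<Gamma> \<tturnstile> Ty Col B \<Longrightarrow> \<Gamma> \<tturnstile> Tm a A \<Longrightarrow> \<Gamma> \<tturnstile> Tm b (sub_ty (a \<cdot> Var) B)
    \<Longrightarrow> \<Gamma> \<tturnstile> Tm (Pr a b) (Sigma A B)"
  using pair_intro[of emTT_imp \<Gamma> A B a b] by simp

text \<open>The second projection has the dependent type \<open>B(fst z)\<close> as its motive. In the branch this
  must be compared with \<open>B(x)\<close>, which the \<open>\<beta>\<close>-equality of the first projection provides.\<close>

lemma snd_rules:
  assumes A: "\<Gamma> \<tturnstile> Ty Col A" and B: "A # \<Gamma> \<tturnstile> Ty Col B"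
  shows "\<Gamma> \<tturnstile> Tm p (Sigma A B) \<Longrightarrow> \<Gamma> \<tturnstile> Tm (SND p) (sub_ty (FST p \<cdot> Var) B)"
    and "\<Gamma> \<tturnstile> TmEq p q (Sigma A B) \<Longrightarrow> \<Gamma> \<tturnstile> TmEq (SND p) (SND q) (sub_ty (FST p \<cdot> Var) B)"
    and "\<Gamma> \<tturnstile> Tm a A \<Longrightarrow> \<Gamma> \<tturnstile> Tm b (sub_ty (a \<cdot> Var) B)
      \<Longrightarrow> \<Gamma> \<tturnstile> TmEq (SND (Pr a b)) b (sub_ty (FST (Pr a b) \<cdot> Var) B)"
proof -
  let ?L = "sub_ty (FST (Var 0) \<cdot> shift (Suc 0)) B"
  note S = sigma_col[OF A B]
  note wS = wsub_shift[OF S]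
  have A1: "Sigma A B # \<Gamma> \<tturnstile> Ty Col (sub_ty (shift (Suc 0)) A)" by (rule subst_ty[OF A wS])
  have B1: "sub_ty (shift (Suc 0)) A # Sigma A B # \<Gamma> \<tturnstile> Ty Col (sub_ty (Var 0 \<cdot> shift (Suc (Suc 0))) B)"
    using subst_ty[OF B wsub_lift[OF wS A]] by simp
  have "Sigma A B # \<Gamma> \<tturnstile> Tm (FST (Var 0)) (sub_ty (shift (Suc 0)) A)"
    by (rule fst_rules(1)[OF A1 B1]) (use var0[OF S] in simp)
  then have L: "Sigma A B # \<Gamma> \<tturnstile> Ty Col ?L"
    by (rule subst_ty[OF B wsub_scons[OF wS]])
  have w: "wsub (B # A # \<Gamma>) (shift (Suc (Suc 0))) \<Gamma>"
    using wsub_comp[OF wsub_shift[OF A] wsub_shift[OF B]] by simp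
  note A2 = subst_ty[OF A w]
  have B2: "sub_ty (shift (Suc (Suc 0))) A # B # A # \<Gamma> \<tturnstile> Ty Col (sub_ty (Var 0 \<cdot> shift (Suc (Suc (Suc
      0)))) B)"
    using subst_ty[OF B wsub_lift[OF w A]] by simp
  have x: "B # A # \<Gamma> \<tturnstile> Tm (Var (Suc 0)) (sub_ty (shift (Suc (Suc 0))) A)"
    using subst_tm[OF var0[OF A] wsub_shift[OF B]] by simp
  have y: "B # A # \<Gamma> \<tturnstile> Tm (Var 0) (sub_ty (Var (Suc 0) \<cdot> shift (Suc (Suc 0))) B)"
    using var0[OF B] by simp
  have xy: "B # A # \<Gamma> \<tturnstile> Tm (Pr (Var (Suc 0)) (Var 0)) (sub_ty (shift (Suc (Suc 0))) (Sigma A B))"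
    using pair_tm[OF A2 B2 x] y by simp
  have "B # A # \<Gamma> \<tturnstile> TmEq (FST (Pr (Var (Suc 0)) (Var 0))) (Var (Suc 0)) (sub_ty (shift (Suc (Suc 0)))
      A)"
    using fst_rules(3)[OF A2 B2 x] y by simp
  then have "B # A # \<Gamma> \<tturnstile> TyEq Col (sub_ty (Var (Suc 0) \<cdot> shift (Suc (Suc 0))) B)
    (sub_ty (FST (Pr (Var (Suc 0)) (Var 0)) \<cdot> shift (Suc (Suc 0))) B)"
    using fst_rules(1)[OF A2 B2] xy by (intro scons_ty_eq[OF B w tm_sym x]) simp_all
  from tm_conv[OF y this]
  have m: "B # A # \<Gamma> \<tturnstile> Tm (Var 0) (sub_ty (FST (Pr (Var (Suc 0)) (Var 0)) \<cdot> shift (Suc (Suc 0))) B)" .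
  show "\<Gamma> \<tturnstile> Tm p (Sigma A B) \<Longrightarrow> \<Gamma> \<tturnstile> Tm (SND p) (sub_ty (FST p \<cdot> Var) B)"
    using sigma_elim[OF A B L, of p "Var 0"] m by simp
  show "\<Gamma> \<tturnstile> TmEq p q (Sigma A B) \<Longrightarrow> \<Gamma> \<tturnstile> TmEq (SND p) (SND q) (sub_ty (FST p \<cdot> Var) B)"
    using sigma_elim_cong[OF A B L, of p q "Var 0" "Var 0"] tm_refl[OF m] by simp
  show "\<Gamma> \<tturnstile> Tm a A \<Longrightarrow> \<Gamma> \<tturnstile> Tm b (sub_ty (a \<cdot> Var) B)
      \<Longrightarrow> \<Gamma> \<tturnstile> TmEq (SND (Pr a b)) b (sub_ty (FST (Pr a b) \<cdot> Var) B)"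
    using sigma_beta[OF A B L, of a b "Var 0"] m by simp
qed

lemma sigma_eta:
  assumes A: "\<Gamma> \<tturnstile> Ty Col A" and B: "A # \<Gamma> \<tturnstile> Ty Col B" and p: "\<Gamma> \<tturnstile> Tm p (Sigma A B)"
  shows "\<Gamma> \<tturnstile> TmEq p (Pr (FST p) (SND p)) (Sigma A B)"
proof -
  let ?S = "Sigma A B"
  let ?\<chi> = "EqP (sub_ty (shift (Suc 0)) ?S) (Var 0) (Pr (FST (Var 0)) (SND (Var 0)))"
  note S = sigma_col[OF A B]
  have eta_tm: "\<Gamma> \<tturnstile> Tm (Pr (FST p) (SND p)) (Sigma A B)"
    if "\<Gamma> \<tturnstile> Ty Col A" "A # \<Gamma> \<tturnstile> Ty Col B" "\<Gamma> \<tturnstile> Tm p (Sigma A B)" for \<Gamma> A B p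
    using that by (intro pair_tm fst_rules(1) snd_rules(1))
  have B1: "sub_ty (shift (Suc 0)) A # ?S # \<Gamma> \<tturnstile> Ty Col (sub_ty (Var 0 \<cdot> shift (Suc (Suc 0))) B)"
    using subst_ty[OF B wsub_lift[OF wsub_shift[OF S] A]] by simp
  have X: "?S # \<Gamma> \<tturnstile> Ty Prop ?\<chi>"
    using eta_tm[OF subst_ty[OF A wsub_shift[OF S]] B1, of "Var 0"] var0[OF S]
    by (intro eq_prop subst_ty[OF S wsub_shift[OF S]]) simp_all
  have "\<Gamma> \<tturnstile> Tm TT (sub_ty (p \<cdot> Var) ?\<chi>)"
  proof (rule sigma_ind[OF A B p X])
    fix \<Delta> \<sigma> a b
    assume s: "wsub \<Delta> \<sigma> \<Gamma>" and a: "\<Delta> \<tturnstile> Tm a (sub_ty \<sigma> A)" and b: "\<Delta> \<tturnstile> Tm b (sub_ty (a \<cdot> \<sigma>) B)"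
    let ?A = "sub_ty \<sigma> A" and ?B = "sub_ty (lift_sub \<sigma>) B"
    have A': "\<Delta> \<tturnstile> Ty Col ?A" by (rule subst_ty[OF A s])
    have B': "?A # \<Delta> \<tturnstile> Ty Col ?B" using subst_ty[OF B wsub_lift[OF s A]] by simp
    have b': "\<Delta> \<tturnstile> Tm b (sub_ty (a \<cdot> Var) ?B)" using b by simp
    note ab = pair_tm[OF A' B' a b']
    have e: "\<Delta> \<tturnstile> TmEq (FST (Pr a b)) a ?A" by (rule fst_rules(3)[OF A' B' a b'])
    have "\<Delta> \<tturnstile> TyEq Col (sub_ty (FST (Pr a b) \<cdot> Var) ?B) (sub_ty (a \<cdot> Var) ?B)"
      using scons_ty_eq[OF B' wsub_id[OF wsub_ctx[OF s]], of "FST (Pr a b)" a] e a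
        fst_rules(1)[OF A' B' ab] by simp
    from tm_eq_conv[OF snd_rules(3)[OF A' B' a b'] this]
    have f: "\<Delta> \<tturnstile> TmEq (SND (Pr a b)) b (sub_ty (a \<cdot> Var) ?B)" .
    have "\<Delta> \<tturnstile> TmEq (Pr a b) (Pr (FST (Pr a b)) (SND (Pr a b))) (Sigma ?A ?B)"
      using pair_cong[OF A' B' tm_sym[OF e]] tm_sym[OF f] by simp
    from eq_I[OF this sigma_col[OF A' B'] ab]
    show "\<Delta> \<tturnstile> Tm TT (sub_ty (Pr a b \<cdot> \<sigma>) ?\<chi>)" by simp
  qed
  then show ?thesis using eta_tm[OF A B p] by (intro eq_E[OF _ S p]) simp_all
qed

text \<open>Equality of pairs is equality of first components followed by equality of second
  components. Stability must be applied in this order: only once the first components are known to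
  be equal do the second ones have a common type, in which their doubly negated equation can be
  stated.\<close>

lemma stable_sigma:
  assumes A: "\<Gamma> \<tturnstile> Ty Col A" and B: "A # \<Gamma> \<tturnstile> Ty Col B" and sA: "stable \<Gamma> A" and sB: "stable (A # \<Gamma>) B"
  shows "stable \<Gamma> (Sigma A B)"
  unfolding stable_def
proof (intro allI impI)
  fix \<Delta> \<sigma> p q
  assume s: "wsub \<Delta> \<sigma> \<Gamma>"
  let ?A = "sub_ty \<sigma> A" and ?B = "sub_ty (lift_sub \<sigma>) B"
  let ?S = "Sigma ?A ?B"
  have S: "sub_ty \<sigma> (Sigma A B) = ?S" by simp
  assume p: "\<Delta> \<tturnstile> Tm p (sub_ty \<sigma> (Sigma A B))" and q: "\<Delta> \<tturnstile> Tm q (sub_ty \<sigma> (Sigma A B))"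
    and n: "\<Delta> \<tturnstile> Tm TT (nn (EqP (sub_ty \<sigma> (Sigma A B)) p q))"
  note p = p[unfolded S] and q = q[unfolded S] and n = n[unfolded S]
  have A: "\<Delta> \<tturnstile> Ty Col ?A" and B: "?A # \<Delta> \<tturnstile> Ty Col ?B"
    and sA: "stable \<Delta> ?A" and sB: "stable (?A # \<Delta>) ?B"
    using subst_ty[OF A s] subst_ty[OF B wsub_lift[OF s A]] stable_sub[OF sA s]
      stable_sub[OF sB wsub_lift[OF s A]] by simp_all
  note Sc = sigma_col[OF A B]
  note fp = fst_rules(1)[OF A B p] and fq = fst_rules(1)[OF A B q]
  have B': "A' # \<Theta> \<tturnstile> Ty Col B'" if "A' = sub_ty \<tau> ?A" "B' = sub_ty (lift_sub \<tau>) ?B" "wsub \<Theta> \<tau> \<Delta>" for \<Theta>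
      \<tau> A' B'
    using subst_ty[OF B wsub_lift[OF that(3) A]] that by simp
  have "\<Delta> \<tturnstile> Tm TT (nn (EqP ?A (FST p) (FST q)))"
  proof (rule nn_eq_cong[OF Sc p q n A fp fq])
    fix \<Theta> \<tau> assume r: "wsub \<Theta> \<tau> \<Delta>"
      and e: "\<Theta> \<tturnstile> TmEq (sub_tm \<tau> p) (sub_tm \<tau> q) (sub_ty \<tau> ?S)"
    show "\<Theta> \<tturnstile> TmEq (sub_tm \<tau> (FST p)) (sub_tm \<tau> (FST q)) (sub_ty \<tau> ?A)"
      using fst_rules(2)[OF subst_ty[OF A r] B'[OF refl refl r], of "sub_tm \<tau> p" "sub_tm \<tau> q"] e by simp
  qed
  from stableD[OF sA this fp fq] have f: "\<Delta> \<tturnstile> TmEq (FST p) (FST q) ?A" .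
  let ?C = "sub_ty (FST p \<cdot> Var) ?B"
  have C: "\<Delta> \<tturnstile> Ty Col ?C" by (rule subst_ty[OF B wsub_inst[OF fp]])
  have sC: "stable \<Delta> ?C" by (rule stable_sub[OF sB wsub_inst[OF fp]])
  note gp = snd_rules(1)[OF A B p]
  have "\<Delta> \<tturnstile> TyEq Col (sub_ty (FST q \<cdot> Var) ?B) ?C"
    using scons_ty_eq[OF B wsub_id[OF wsub_ctx[OF s]], of "FST q" "FST p"] tm_sym[OF f] fp fq by simp
  from tm_conv[OF snd_rules(1)[OF A B q] this] have gq: "\<Delta> \<tturnstile> Tm (SND q) ?C" .
  have "\<Delta> \<tturnstile> Tm TT (nn (EqP ?C (SND p) (SND q)))"
  proof (rule nn_eq_cong[OF Sc p q n C gp gq])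
    fix \<Theta> \<tau> assume r: "wsub \<Theta> \<tau> \<Delta>"
      and e: "\<Theta> \<tturnstile> TmEq (sub_tm \<tau> p) (sub_tm \<tau> q) (sub_ty \<tau> ?S)"
    show "\<Theta> \<tturnstile> TmEq (sub_tm \<tau> (SND p)) (sub_tm \<tau> (SND q)) (sub_ty \<tau> ?C)"
      using snd_rules(2)[OF subst_ty[OF A r] B'[OF refl refl r], of "sub_tm \<tau> p" "sub_tm \<tau> q"] e by simp
  qed
  from stableD[OF sC this gp gq] have g: "\<Delta> \<tturnstile> TmEq (SND p) (SND q) ?C" .
  have "\<Delta> \<tturnstile> TmEq (Pr (FST p) (SND p)) (Pr (FST q) (SND q)) ?S"
    using pair_cong[OF A B f] g by simp
  then show "\<Delta> \<tturnstile> TmEq p q (sub_ty \<sigma> (Sigma A B))"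
    unfolding S by (rule tm_trans[OF tm_trans[OF sigma_eta[OF A B p]] tm_sym[OF sigma_eta[OF A B q]]])
qed

subsection \<open>Dependent products\<close>

lemma pi_col: "\<Gamma> \<tturnstile> Ty Col A \<Longrightarrow> A # \<Gamma> \<tturnstile> Ty Col B \<Longrightarrow> \<Gamma> \<tturnstile> Ty Col (Pi A B)"
  using pi_form[of emTT_imp \<Gamma> A B] by simp

lemma ap_tm:
  "\<Gamma> \<tturnstile> Ty Col A \<Longrightarrow> A # \<Gamma> \<tturnstile> Ty Col B \<Longrightarrow> \<Gamma> \<tturnstile> Tm f (Pi A B) \<Longrightarrow> \<Gamma> \<tturnstile> Tm a A
    \<Longrightarrow> \<Gamma> \<tturnstile> Tm (Ap f a) (sub_ty (a \<cdot> Var) B)"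
  using pi_elim[of emTT_imp \<Gamma> A B f a] by simp

text \<open>By \<open>\<eta>\<close>, functions that agree on a generic argument are equal. So a doubly negated equation
  of functions is settled by stability of the codomain at that argument.\<close>

lemma stable_pi:
  assumes A: "\<Gamma> \<tturnstile> Ty Col A" and B: "A # \<Gamma> \<tturnstile> Ty Col B" and sB: "stable (A # \<Gamma>) B"
  shows "stable \<Gamma> (Pi A B)"
  unfolding stable_def
proof (intro allI impI)
  fix \<Delta> \<sigma> f g
  assume s: "wsub \<Delta> \<sigma> \<Gamma>"
  let ?A = "sub_ty \<sigma> A" and ?B = "sub_ty (lift_sub \<sigma>) B"
  let ?P = "Pi ?A ?B"
  have P: "sub_ty \<sigma> (Pi A B) = ?P" by simp
  assume f: "\<Delta> \<tturnstile> Tm f (sub_ty \<sigma> (Pi A B))" and g: "\<Delta> \<tturnstile> Tm g (sub_ty \<sigma> (Pi A B))"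
    and n: "\<Delta> \<tturnstile> Tm TT (nn (EqP (sub_ty \<sigma> (Pi A B)) f g))"
  note f = f[unfolded P] and g = g[unfolded P] and n = n[unfolded P]
  have A: "\<Delta> \<tturnstile> Ty Col ?A" and B: "?A # \<Delta> \<tturnstile> Ty Col ?B" and sB: "stable (?A # \<Delta>) ?B"
    using subst_ty[OF A s] subst_ty[OF B wsub_lift[OF s A]]
      stable_sub[OF sB wsub_lift[OF s A]] by simp_all
  note w = wsub_shift[OF A]
  let ?w = "sub_tm (shift (Suc 0))" and ?W = "sub_ty (shift (Suc 0))"
  have Bw: "A' # \<Theta> \<tturnstile> Ty Col B'" if "A' = sub_ty \<tau> ?A" "B' = sub_ty (lift_sub \<tau>) ?B" "wsub \<Theta> \<tau> \<Delta>" for \<Theta>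
      \<tau> A' B'
    using subst_ty[OF B wsub_lift[OF that(3) A]] that by simp
  have app: "?A # \<Delta> \<tturnstile> Tm (Ap (?w h) (Var 0)) ?B" if h: "\<Delta> \<tturnstile> Tm h ?P" for h
    using ap_tm[OF subst_ty[OF A w] Bw[OF refl refl w], of "?w h" "Var 0"] subst_tm[OF h w] var0[OF A]
    by simp
  \<comment> \<open>both functions are applied to a fresh variable\<close>
  have nw: "?A # \<Delta> \<tturnstile> Tm TT (nn (EqP (?W ?P) (?w f) (?w g)))"
    using subst_prf[OF n w] by simp
  have "?A # \<Delta> \<tturnstile> Tm TT (nn (EqP ?B (Ap (?w f) (Var 0)) (Ap (?w g) (Var 0))))"
  proof (rule nn_eq_cong[OF subst_ty[OF pi_col[OF A B] w] subst_tm[OF f w] subst_tm[OF g w] nw B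
      app[OF f] app[OF g]])
    fix \<Theta> \<tau> assume r: "wsub \<Theta> \<tau> (?A # \<Delta>)"
      and e: "\<Theta> \<tturnstile> TmEq (sub_tm \<tau> (?w f)) (sub_tm \<tau> (?w g)) (sub_ty \<tau> (?W ?P))"
    have x: "\<Theta> \<tturnstile> TmEq (\<tau> 0) (\<tau> 0) (sub_ty (shift (Suc 0) \<odot> \<tau>) ?A)"
      using tm_refl[OF subst_tm[OF var0[OF A] r]] by simp
    \<comment> \<open>a substitution is its value at the last variable together with its restriction to the others\<close>
    have t: "\<tau> 0 \<cdot> (shift (Suc 0) \<odot> \<tau>) = \<tau>"
    proof
      fix i show "(\<tau> 0 \<cdot> (shift (Suc 0) \<odot> \<tau>)) i = \<tau> i" by (cases i) simp_all
    qed
    note wr = wsub_comp[OF w r]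
    have "\<Theta> \<tturnstile> TmEq (Ap (sub_tm \<tau> (?w f)) (\<tau> 0)) (Ap (sub_tm \<tau> (?w g)) (\<tau> 0))
      (sub_ty (\<tau> 0 \<cdot> (shift (Suc 0) \<odot> \<tau>)) ?B)"
      using pi_elim_cong[of emTT_imp \<Theta> "sub_ty (shift (Suc 0) \<odot> \<tau>) ?A"
        "sub_ty (lift_sub (shift (Suc 0) \<odot> \<tau>)) ?B"
          "sub_tm \<tau> (?w f)" "sub_tm \<tau> (?w g)" "\<tau> 0" "\<tau> 0"]
         subst_ty[OF A wr] Bw[OF refl refl wr] e x by simp
    then show "\<Theta> \<tturnstile> TmEq (sub_tm \<tau> (Ap (?w f) (Var 0))) (sub_tm \<tau> (Ap (?w g) (Var 0))) (sub_ty \<tau> ?B)"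
      unfolding t by simp
  qed
  from stableD[OF sB this app[OF f] app[OF g]]
  have "\<Delta> \<tturnstile> TmEq (Lam (Ap (?w f) (Var 0))) (Lam (Ap (?w g) (Var 0))) ?P"
    using pi_intro_cong[of emTT_imp \<Delta> ?A ?B] A B by simp
  moreover have "\<Delta> \<tturnstile> TmEq (Lam (Ap (?w h) (Var 0))) h ?P" if "\<Delta> \<tturnstile> Tm h ?P" for h
    using pi_eta[of emTT_imp \<Delta> ?A ?B h] A B that by simp
  ultimately show "\<Delta> \<tturnstile> TmEq f g (sub_ty \<sigma> (Pi A B))"
    unfolding P using f g by (blast intro: tm_trans tm_sym)
qed

subsection \<open>Lists\<close>

lemma list_col: "\<Gamma> \<tturnstile> Ty Col A \<Longrightarrow> \<Gamma> \<tturnstile> Ty Col (LIST A)"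
  using list_form[of emTT_imp \<Gamma> A] by simp

lemma nil_tm: "\<Gamma> \<tturnstile> Ty Col A \<Longrightarrow> \<Gamma> \<tturnstile> Tm LNil (LIST A)"
  using nil_intro[of emTT_imp \<Gamma> A] by simp

lemma cons_tm: "\<Gamma> \<tturnstile> Ty Col A \<Longrightarrow> \<Gamma> \<tturnstile> Tm s (LIST A) \<Longrightarrow> \<Gamma> \<tturnstile> Tm a A \<Longrightarrow> \<Gamma> \<tturnstile> Tm (LCons s a) (LIST A)"
  using cons_intro[of emTT_imp \<Gamma> A] by simp

lemma list_rec_eq:
  assumes A: "\<Gamma> \<tturnstile> Ty Col A" and C: "\<Gamma> \<tturnstile> Ty Col C" and n: "\<Gamma> \<tturnstile> Tm n C"
    and l: "sub_ty (shift (Suc (Suc 0))) C # sub_ty (shift (Suc 0)) A # LIST A # \<Gamma>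
      \<tturnstile> Tm l (sub_ty (shift (Suc (Suc (Suc 0)))) C)"
  shows "\<Gamma> \<tturnstile> TmEq s t (LIST A) \<Longrightarrow> \<Gamma> \<tturnstile> TmEq (ElList s n l) (ElList t n l) C"
    and "\<Gamma> \<tturnstile> TmEq (ElList LNil n l) n C"
    and "\<Gamma> \<tturnstile> Tm s (LIST A) \<Longrightarrow> \<Gamma> \<tturnstile> Tm a A
      \<Longrightarrow> \<Gamma> \<tturnstile> TmEq (ElList (LCons s a) n l) (sub_tm (ElList s n l \<cdot> a \<cdot> s \<cdot> Var) l) C"
proof -
  have L: "LIST A # \<Gamma> \<tturnstile> Ty Col (sub_ty (shift (Suc 0)) C)"
    by (rule subst_ty[OF C wsub_shift[OF list_col[OF A]]])
  show "\<Gamma> \<tturnstile> TmEq s t (LIST A) \<Longrightarrow> \<Gamma> \<tturnstile> TmEq (ElList s n l) (ElList t n l) C"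
    using list_elim_cong[OF _ L, of s t n n l l] A tm_refl[OF n] tm_refl[OF l] by simp
  show "\<Gamma> \<tturnstile> TmEq (ElList LNil n l) n C"
    using nil_beta[OF _ L, of n l] A n l by simp
  show "\<Gamma> \<tturnstile> Tm s (LIST A) \<Longrightarrow> \<Gamma> \<tturnstile> Tm a A
      \<Longrightarrow> \<Gamma> \<tturnstile> TmEq (ElList (LCons s a) n l) (sub_tm (ElList s n l \<cdot> a \<cdot> s \<cdot> Var) l) C"
    using cons_beta[OF _ L, of s a n l] A n l by simp
qed

context
  fixes \<Gamma> A assumes A: "\<Gamma> \<tturnstile> Ty Col A"
begin

lemma list_branch_ctx:
  assumes C: "\<Gamma> \<tturnstile> Ty Col C"
  defines "\<Delta> \<equiv> sub_ty (shift (Suc (Suc 0))) C # sub_ty (shift (Suc 0)) A # LIST A # \<Gamma>"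
  shows "\<Delta> \<tturnstile> Tm (Var (Suc (Suc 0))) (LIST (sub_ty (shift (Suc (Suc (Suc 0)))) A))"
    and "\<Delta> \<tturnstile> Tm (Var (Suc 0)) (sub_ty (shift (Suc (Suc (Suc 0)))) A)"
    and "\<Delta> \<tturnstile> Ctx"
proof -
  note L = list_col[OF A]
  note wL = wsub_shift[OF L]
  have A': "LIST A # \<Gamma> \<tturnstile> Ty Col (sub_ty (shift (Suc 0)) A)" by (rule subst_ty[OF A wL])
  note wA = wsub_shift[OF A']
  have C': "sub_ty (shift (Suc 0)) A # LIST A # \<Gamma> \<tturnstile> Ty Col (sub_ty (shift (Suc (Suc 0))) C)"
    using subst_ty[OF C wsub_comp[OF wL wA]] by simp
  note wC = wsub_shift[OF C']
  show "\<Delta> \<tturnstile> Tm (Var (Suc (Suc 0))) (LIST (sub_ty (shift (Suc (Suc (Suc 0)))) A))"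
    using subst_tm[OF var0[OF L] wsub_comp[OF wA wC]] by (simp add: \<Delta>_def)
  show "\<Delta> \<tturnstile> Tm (Var (Suc 0)) (sub_ty (shift (Suc (Suc (Suc 0)))) A)"
    using subst_tm[OF var0[OF A'] wC] by (simp add: \<Delta>_def)
  show "\<Delta> \<tturnstile> Ctx" using ctx_cons[OF C'] by (simp add: \<Delta>_def)
qed

lemma cons_inj_tail:
  assumes s: "\<Gamma> \<tturnstile> Tm s (LIST A)" and t: "\<Gamma> \<tturnstile> Tm t (LIST A)" and a: "\<Gamma> \<tturnstile> Tm a A" and b: "\<Gamma> \<tturnstile> Tm b A"
    and e: "\<Gamma> \<tturnstile> TmEq (LCons s a) (LCons t b) (LIST A)"
  shows "\<Gamma> \<tturnstile> TmEq s t (LIST A)"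
proof -
  note rec = list_rec_eq[OF A list_col[OF A] nil_tm[OF A], of "Var (Suc (Suc 0))"]
  show ?thesis
    using tm_trans[OF tm_trans[OF tm_sym[OF rec(3)[OF _ s a]] rec(1)[OF _ e]] rec(3)[OF _ t b]]
      list_branch_ctx(1)[OF list_col[OF A]] by simp
qed

text \<open>Taking the head of a list needs a value for the empty list, for which \<open>a\<close> serves.\<close>

lemma cons_inj_head:
  assumes s: "\<Gamma> \<tturnstile> Tm s (LIST A)" and t: "\<Gamma> \<tturnstile> Tm t (LIST A)" and a: "\<Gamma> \<tturnstile> Tm a A" and b: "\<Gamma> \<tturnstile> Tm b A"
    and e: "\<Gamma> \<tturnstile> TmEq (LCons s a) (LCons t b) (LIST A)"
  shows "\<Gamma> \<tturnstile> TmEq a b A"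
proof -
  note rec = list_rec_eq[OF A A a list_branch_ctx(2)[OF A]]
  from tm_trans[OF tm_trans[OF tm_sym[OF rec(3)[OF s a]] rec(1)[OF e]] rec(3)[OF t b]]
  show ?thesis by simp
qed

lemma nil_neq_cons:
  assumes s: "\<Gamma> \<tturnstile> Tm s (LIST A)" and a: "\<Gamma> \<tturnstile> Tm a A"
    and e: "\<Gamma> \<tturnstile> TmEq LNil (LCons s a) (LIST A)"
  shows "\<Gamma> \<tturnstile> Tm TT Bot"
proof -
  note c = derives_ctx[OF e]
  note rec = list_rec_eq[OF A p1_col[OF c] code_top_bot_tm(1)[OF c], of "Code Bot"]
  show ?thesis
    using tm_trans[OF tm_trans[OF tm_sym[OF rec(2)] rec(1)[OF _ e]] rec(3)[OF _ s a]]
      code_top_bot_tm(2)[OF list_branch_ctx(3)[OF p1_col[OF c]]] by (intro code_top_bot) simp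
qed

end

lemma stab_at_list_cases:
  assumes A: "\<Gamma> \<tturnstile> Ty Col A" and p: "\<Gamma> \<tturnstile> Tm p (LIST A)" and q: "\<Gamma> \<tturnstile> Tm q (LIST A)"
    and n: "\<Gamma> \<tturnstile> Tm TT (stab_at (LIST A) p LNil)"
    and c: "\<And>\<Delta> \<sigma> s a. wsub \<Delta> \<sigma> \<Gamma> \<Longrightarrow> \<Delta> \<tturnstile> Tm s (LIST (sub_ty \<sigma> A)) \<Longrightarrow> \<Delta> \<tturnstile> Tm a (sub_ty \<sigma> A)
      \<Longrightarrow> \<Delta> \<tturnstile> Tm TT (stab_at (LIST (sub_ty \<sigma> A)) (sub_tm \<sigma> p) (LCons s a))"
  shows "\<Gamma> \<tturnstile> Tm TT (stab_at (LIST A) p q)"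
proof -
  note P = list_col[OF A] and w = wsub_shift[OF list_col[OF A]]
  have "\<Gamma> \<tturnstile> Tm TT (sub_ty (q \<cdot> Var) (stab_at (sub_ty (shift (Suc 0)) (LIST A)) (sub_tm (shift (Suc 0))
      p) (Var 0)))"
  proof (rule list_ind[OF A q])
    show "LIST A # \<Gamma> \<tturnstile> Ty Prop (stab_at (sub_ty (shift (Suc 0)) (LIST A)) (sub_tm (shift (Suc 0)) p)
        (Var 0))"
      by (rule stab_at_prop[OF subst_ty[OF P w] subst_tm[OF p w] var0[OF P]])
  qed (use n c in simp_all)
  then show ?thesis by simp
qed

lemma stab_at_nil_cons:
  assumes A: "\<Gamma> \<tturnstile> Ty Col A" and t: "\<Gamma> \<tturnstile> Tm s (LIST A)" "\<Gamma> \<tturnstile> Tm a A"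
  shows "\<Gamma> \<tturnstile> Tm TT (stab_at (LIST A) LNil (LCons s a))"
proof (rule stab_at_absurd[OF list_col[OF A] nil_tm[OF A] cons_tm[OF A t]])
  fix \<Delta> \<sigma> assume s: "wsub \<Delta> \<sigma> \<Gamma>"
    and "\<Delta> \<tturnstile> TmEq (sub_tm \<sigma> LNil) (sub_tm \<sigma> (LCons s a)) (sub_ty \<sigma> (LIST A))"
  then show "\<Delta> \<tturnstile> Tm TT Bot"
    using nil_neq_cons[OF subst_ty[OF A s]] subst_tm[OF t(1) s] subst_tm[OF t(2) s] by simp
qed

text \<open>The double negation of \<open>cons(s,a) = cons(t,b)\<close> yields those of \<open>s = t\<close> and of \<open>a = b\<close>. The
  former is removed by the induction hypothesis, the latter by stability of \<open>A\<close>.\<close>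

lemma stab_at_cons:
  assumes A: "\<Gamma> \<tturnstile> Ty Col A" and sA: "stable \<Gamma> A"
    and s: "\<Gamma> \<tturnstile> Tm s (LIST A)" and t: "\<Gamma> \<tturnstile> Tm t (LIST A)" and a: "\<Gamma> \<tturnstile> Tm a A" and b: "\<Gamma> \<tturnstile> Tm b A"
    and IH: "\<Gamma> \<tturnstile> Tm TT (stab_at (LIST A) s t)"
  shows "\<Gamma> \<tturnstile> Tm TT (stab_at (LIST A) (LCons s a) (LCons t b))"
proof (rule stab_at_I[OF list_col[OF A] cons_tm[OF A s a] cons_tm[OF A t b]])
  fix \<Delta> \<sigma> assume w: "wsub \<Delta> \<sigma> \<Gamma>"
  let ?A = "sub_ty \<sigma> A" and ?s = "sub_tm \<sigma> s" and ?a = "sub_tm \<sigma> a" and ?t = "sub_tm \<sigma> t" and ?b =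
      "sub_tm \<sigma> b"
  note A = subst_ty[OF A w] and a = subst_tm[OF a w] and b = subst_tm[OF b w] and sA = stable_sub[OF
      sA w]
  have s: "\<Delta> \<tturnstile> Tm ?s (LIST ?A)" and t: "\<Delta> \<tturnstile> Tm ?t (LIST ?A)" and IH:
      "\<Delta> \<tturnstile> Tm TT (stab_at (LIST ?A) ?s ?t)"
    using subst_tm[OF s w] subst_tm[OF t w] subst_prf[OF IH w] by simp_all
  note L = list_col[OF A] and sa = cons_tm[OF A s a] and tb = cons_tm[OF A t b] and st = eq_prop[OF
      list_col[OF A] s t]
  assume "\<Delta> \<tturnstile> Tm TT (nn (EqP (sub_ty \<sigma> (LIST A)) (sub_tm \<sigma> (LCons s a)) (sub_tm \<sigma> (LCons t b))))"
  then have n: "\<Delta> \<tturnstile> Tm TT (nn (EqP (LIST ?A) (LCons ?s ?a) (LCons ?t ?b)))" by simp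
  have ns: "\<Delta> \<tturnstile> Tm TT (nn (EqP (LIST ?A) ?s ?t))"
  proof (rule nn_eq_cong[OF L sa tb n L s t])
    fix \<Theta> \<tau> assume r: "wsub \<Theta> \<tau> \<Delta>"
      and "\<Theta> \<tturnstile> TmEq (sub_tm \<tau> (LCons ?s ?a)) (sub_tm \<tau> (LCons ?t ?b)) (sub_ty \<tau> (LIST ?A))"
    then show "\<Theta> \<tturnstile> TmEq (sub_tm \<tau> ?s) (sub_tm \<tau> ?t) (sub_ty \<tau> (LIST ?A))"
      using cons_inj_tail[OF subst_ty[OF A r] _ _ subst_tm[OF a r] subst_tm[OF b r],
          of "sub_tm \<tau> ?s" "sub_tm \<tau> ?t"] subst_tm[OF s r] subst_tm[OF t r] by simp
  qed
  have na: "\<Delta> \<tturnstile> Tm TT (nn (EqP ?A ?a ?b))"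
  proof (rule nn_eq_cong[OF L sa tb n A a b])
    fix \<Theta> \<tau> assume r: "wsub \<Theta> \<tau> \<Delta>"
      and "\<Theta> \<tturnstile> TmEq (sub_tm \<tau> (LCons ?s ?a)) (sub_tm \<tau> (LCons ?t ?b)) (sub_ty \<tau> (LIST ?A))"
    then show "\<Theta> \<tturnstile> TmEq (sub_tm \<tau> ?a) (sub_tm \<tau> ?b) (sub_ty \<tau> ?A)"
      using cons_inj_head[OF subst_ty[OF A r] _ _ subst_tm[OF a r] subst_tm[OF b r],
          of "sub_tm \<tau> ?s" "sub_tm \<tau> ?t"] subst_tm[OF s r] subst_tm[OF t r] by simp
  qed
  have "\<Delta> \<tturnstile> TmEq ?s ?t (LIST ?A)"
    by (rule eq_E[OF impl_E[OF IH ns neg_prop[OF neg_prop[OF st]] st] L s t])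
  moreover have "\<Delta> \<tturnstile> TmEq ?a ?b ?A" by (rule stableD[OF sA na a b])
  ultimately show "\<Delta> \<tturnstile> TmEq (sub_tm \<sigma> (LCons s a)) (sub_tm \<sigma> (LCons t b)) (sub_ty \<sigma> (LIST A))"
    using A by (simp add: cons_cong)
qed

text \<open>The second list must be universally quantified in the induction on the first one, since
  the induction hypothesis is applied to the tail of the second list.\<close>

abbreviation list_stab_from :: "ty \<Rightarrow> tm \<Rightarrow> ty" where
  "list_stab_from A s \<equiv> Forall (LIST A) (stab_at (LIST (wk_ty (Suc 0) A)) (wk_tm (Suc 0) s) (Var 0))"

lemma list_stab_from_body:
  assumes A: "\<Gamma> \<tturnstile> Ty Col A" and s: "\<Gamma> \<tturnstile> Tm s (LIST A)"
  shows "LIST A # \<Gamma> \<tturnstile> Ty Prop (stab_at (LIST (wk_ty (Suc 0) A)) (wk_tm (Suc 0) s) (Var 0))"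
proof -
  note L = list_col[OF A]
  show ?thesis
    using stab_at_prop[OF subst_ty[OF L wsub_shift[OF L]] subst_tm[OF s wsub_shift[OF L]] var0[OF L]]
      by simp
qed

lemma list_stab_from_E:
  assumes A: "\<Gamma> \<tturnstile> Ty Col A" and s: "\<Gamma> \<tturnstile> Tm s (LIST A)"
    and h: "\<Gamma> \<tturnstile> Tm TT (list_stab_from A s)" and t: "\<Gamma> \<tturnstile> Tm t (LIST A)"
  shows "\<Gamma> \<tturnstile> Tm TT (stab_at (LIST A) s t)"
  using forall_E[OF h list_col[OF A] list_stab_from_body[OF A s] t] by simp

lemma list_stab_from_I:
  assumes A: "\<Gamma> \<tturnstile> Ty Col A" and s: "\<Gamma> \<tturnstile> Tm s (LIST A)"
    and n: "\<Gamma> \<tturnstile> Tm TT (stab_at (LIST A) s LNil)"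
    and c: "\<And>\<Delta> \<sigma> t b. wsub \<Delta> \<sigma> \<Gamma> \<Longrightarrow> \<Delta> \<tturnstile> Tm t (LIST (sub_ty \<sigma> A)) \<Longrightarrow> \<Delta> \<tturnstile> Tm b (sub_ty \<sigma> A)
      \<Longrightarrow> \<Delta> \<tturnstile> Tm TT (stab_at (LIST (sub_ty \<sigma> A)) (sub_tm \<sigma> s) (LCons t b))"
  shows "\<Gamma> \<tturnstile> Tm TT (list_stab_from A s)"
proof (rule forall_I[OF list_col[OF A] list_stab_from_body[OF A s]])
  fix \<Delta> \<sigma> t assume w: "wsub \<Delta> \<sigma> \<Gamma>" and "\<Delta> \<tturnstile> Tm t (sub_ty \<sigma> (LIST A))"
  then have t: "\<Delta> \<tturnstile> Tm t (LIST (sub_ty \<sigma> A))" by simp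
  have s': "\<Delta> \<tturnstile> Tm (sub_tm \<sigma> s) (LIST (sub_ty \<sigma> A))" using subst_tm[OF s w] by simp
  have "\<Delta> \<tturnstile> Tm TT (stab_at (LIST (sub_ty \<sigma> A)) (sub_tm \<sigma> s) t)"
    by (rule stab_at_list_cases[OF subst_ty[OF A w] s' t])
      (use subst_prf[OF n w] c[OF wsub_comp[OF w]] in simp_all)
  then show "\<Delta> \<tturnstile> Tm TT (sub_ty (t \<cdot> \<sigma>) (stab_at (LIST (wk_ty (Suc 0) A)) (wk_tm (Suc 0) s) (Var 0)))"
    by simp
qed

lemma stable_list:
  assumes A: "\<Gamma> \<tturnstile> Ty Col A" and sA: "stable \<Gamma> A"
  shows "stable \<Gamma> (LIST A)"
proof (rule stableI[OF list_col[OF A]])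
  fix \<Delta> \<sigma> p q
  assume s: "wsub \<Delta> \<sigma> \<Gamma>"
  note A = subst_ty[OF A s] and sA = stable_sub[OF sA s]
  let ?A = "sub_ty \<sigma> A"
  assume "\<Delta> \<tturnstile> Tm p (sub_ty \<sigma> (LIST A))" "\<Delta> \<tturnstile> Tm q (sub_ty \<sigma> (LIST A))"
  then have p: "\<Delta> \<tturnstile> Tm p (LIST ?A)" and q: "\<Delta> \<tturnstile> Tm q (LIST ?A)" by simp_all
  have "\<Delta> \<tturnstile> Tm TT (sub_ty (p \<cdot> Var) (list_stab_from (wk_ty (Suc 0) ?A) (Var 0)))"
  proof (rule list_ind[OF A p])
    note L = list_col[OF A]
    note A1 = subst_ty[OF A wsub_shift[OF L]]
    show "LIST ?A # \<Delta> \<tturnstile> Ty Prop (list_stab_from (wk_ty (Suc 0) ?A) (Var 0))"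
      by (intro forall_prop list_col list_stab_from_body A1) (use var0[OF L] in simp)
    have "\<Delta> \<tturnstile> Tm TT (list_stab_from ?A LNil)"
    proof (rule list_stab_from_I[OF A nil_tm[OF A]])
      show "\<Delta> \<tturnstile> Tm TT (stab_at (LIST ?A) LNil LNil)"
        by (rule stab_at_I[OF L nil_tm[OF A] nil_tm[OF A]]) (rule tm_refl[OF subst_tm[OF nil_tm[OF A]]])
    qed (use stab_at_nil_cons[OF subst_ty[OF A]] in simp)
    then show "\<Delta> \<tturnstile> Tm TT (sub_ty (LNil \<cdot> Var) (list_stab_from (wk_ty (Suc 0) ?A) (Var 0)))" by simp
  next
    fix \<Theta> \<tau> s a assume r: "wsub \<Theta> \<tau> \<Delta>"
    let ?A' = "sub_ty \<tau> ?A"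
    assume s: "\<Theta> \<tturnstile> Tm s (LIST ?A')" and a: "\<Theta> \<tturnstile> Tm a ?A'"
      and "\<Theta> \<tturnstile> Tm TT (sub_ty (s \<cdot> \<tau>) (list_stab_from (wk_ty (Suc 0) ?A) (Var 0)))"
    then have IH: "\<Theta> \<tturnstile> Tm TT (list_stab_from ?A' s)" by simp
    note A = subst_ty[OF A r] and sA = stable_sub[OF sA r]
    note sa = cons_tm[OF A s a]
    have "\<Theta> \<tturnstile> Tm TT (list_stab_from ?A' (LCons s a))"
    proof (rule list_stab_from_I[OF A sa])
      show "\<Theta> \<tturnstile> Tm TT (stab_at (LIST ?A') (LCons s a) LNil)"
        by (rule stab_at_sym[OF stab_at_nil_cons[OF A s a] list_col[OF A] sa nil_tm[OF A]])
      fix \<Xi> \<upsilon> t b assume u: "wsub \<Xi> \<upsilon> \<Theta>"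
        and t: "\<Xi> \<tturnstile> Tm t (LIST (sub_ty \<upsilon> ?A'))" and b: "\<Xi> \<tturnstile> Tm b (sub_ty \<upsilon> ?A')"
      have s': "\<Xi> \<tturnstile> Tm (sub_tm \<upsilon> s) (LIST (sub_ty \<upsilon> ?A'))" using subst_tm[OF s u] by simp
      have IH': "\<Xi> \<tturnstile> Tm TT (list_stab_from (sub_ty \<upsilon> ?A') (sub_tm \<upsilon> s))" using subst_prf[OF IH u] by
          simp
      note A' = subst_ty[OF A u]
      from stab_at_cons[OF A' stable_sub[OF sA u] s' t subst_tm[OF a u] b list_stab_from_E[OF A' s'
        IH' t]]
      show "\<Xi> \<tturnstile> Tm TT (stab_at (LIST (sub_ty \<upsilon> ?A')) (sub_tm \<upsilon> (LCons s a)) (LCons t b))" by simp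
    qed
    then show "\<Theta> \<tturnstile> Tm TT (sub_ty (LCons s a \<cdot> \<tau>) (list_stab_from (wk_ty (Suc 0) ?A) (Var 0)))" by simp
  qed
  then have "\<Delta> \<tturnstile> Tm TT (list_stab_from ?A p)" by simp
  from list_stab_from_E[OF A p this q] show "\<Delta> \<tturnstile> Tm TT (stab_at (sub_ty \<sigma> (LIST A)) p q)" by simp
qed

subsection \<open>Quotients\<close>

lemma cls_tm:
  "\<Gamma> \<tturnstile> Ty Col A \<Longrightarrow> sub_ty (shift (Suc 0)) A # A # \<Gamma> \<tturnstile> Ty Prop R \<Longrightarrow> \<Gamma> \<tturnstile> Ty Col (Quot A R)
    \<Longrightarrow> \<Gamma> \<tturnstile> Tm a A \<Longrightarrow> \<Gamma> \<tturnstile> Tm (Cls a) (Quot A R)"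
  using cls_intro[of emTT_imp \<Gamma> A R a] by simp

lemma cls_eqI:
  "\<Gamma> \<tturnstile> Ty Col A \<Longrightarrow> sub_ty (shift (Suc 0)) A # A # \<Gamma> \<tturnstile> Ty Prop R \<Longrightarrow> \<Gamma> \<tturnstile> Ty Col (Quot A R)
    \<Longrightarrow> \<Gamma> \<tturnstile> Tm a A \<Longrightarrow> \<Gamma> \<tturnstile> Tm b A \<Longrightarrow> \<Gamma> \<tturnstile> Tm TT (sub_ty (b \<cdot> a \<cdot> Var) R)
    \<Longrightarrow> \<Gamma> \<tturnstile> TmEq (Cls a) (Cls b) (Quot A R)"
  using quot_eq[of emTT_imp \<Gamma> A R a b] by simp

lemma cls_eqD:
  "\<Gamma> \<tturnstile> TmEq (Cls a) (Cls b) (Quot A R)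
    \<Longrightarrow> \<Gamma> \<tturnstile> Ty Col A \<Longrightarrow> sub_ty (shift (Suc 0)) A # A # \<Gamma> \<tturnstile> Ty Prop R \<Longrightarrow> \<Gamma> \<tturnstile> Ty Col (Quot A R)
    \<Longrightarrow> \<Gamma> \<tturnstile> Tm a A \<Longrightarrow> \<Gamma> \<tturnstile> Tm b A \<Longrightarrow> \<Gamma> \<tturnstile> Tm TT (sub_ty (b \<cdot> a \<cdot> Var) R)"
  using quot_eff[of emTT_imp \<Gamma> A R a b] by simp

lemma wsub_lift2:
  assumes s: "wsub \<Delta> \<sigma> \<Gamma>" and A: "\<Gamma> \<tturnstile> Ty Col A"
  shows "wsub (sub_ty (shift (Suc 0)) (sub_ty \<sigma> A) # sub_ty \<sigma> A # \<Delta>) (lift_sub (lift_sub \<sigma>))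
    (sub_ty (shift (Suc 0)) A # A # \<Gamma>)"
  using wsub_lift[OF wsub_lift[OF s A] subst_ty[OF A wsub_shift[OF A]]] by simp

lemma stab_at_quot_ind:
  assumes A: "\<Gamma> \<tturnstile> Ty Col A" and R: "sub_ty (shift (Suc 0)) A # A # \<Gamma> \<tturnstile> Ty Prop R"
    and Q: "\<Gamma> \<tturnstile> Ty Col (Quot A R)" and p: "\<Gamma> \<tturnstile> Tm p (Quot A R)" and q: "\<Gamma> \<tturnstile> Tm q (Quot A R)"
    and h: "\<And>\<Delta> \<sigma> a. wsub \<Delta> \<sigma> \<Gamma> \<Longrightarrow> \<Delta> \<tturnstile> Tm a (sub_ty \<sigma> A)
      \<Longrightarrow> \<Delta> \<tturnstile> Tm TT (stab_at (sub_ty \<sigma> (Quot A R)) (Cls a) (sub_tm \<sigma> q))"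
  shows "\<Gamma> \<tturnstile> Tm TT (stab_at (Quot A R) p q)"
proof -
  note w = wsub_shift[OF Q]
  have "\<Gamma> \<tturnstile> Tm TT (sub_ty (p \<cdot> Var) (stab_at (sub_ty (shift (Suc 0)) (Quot A R)) (Var 0) (sub_tm
      (shift (Suc 0)) q)))"
  proof (rule quot_ind[OF A R Q p])
    show "Quot A R # \<Gamma> \<tturnstile> Ty Prop (stab_at (sub_ty (shift (Suc 0)) (Quot A R)) (Var 0) (sub_tm (shift
        (Suc 0)) q))"
      by (rule stab_at_prop[OF subst_ty[OF Q w] var0[OF Q] subst_tm[OF q w]])
  qed (use h in simp)
  then show ?thesis by simp
qed

text \<open>Effectiveness turns a doubly negated equation of classes into a doubly negated instance of
  the relation, from which the double negation can be removed by assumption.\<close>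

lemma stable_quot:
  assumes A: "\<Gamma> \<tturnstile> Ty Col A" and R: "sub_ty (shift (Suc 0)) A # A # \<Gamma> \<tturnstile> Ty Prop R"
    and Q: "\<Gamma> \<tturnstile> Ty Col (Quot A R)" and sR: "pstable (sub_ty (shift (Suc 0)) A # A # \<Gamma>) R"
  shows "stable \<Gamma> (Quot A R)"
proof (rule stableI[OF Q])
  have cls: "\<Gamma> \<tturnstile> Tm TT (stab_at (Quot A R) (Cls a) (Cls b))"
    if A: "\<Gamma> \<tturnstile> Ty Col A" and R: "sub_ty (shift (Suc 0)) A # A # \<Gamma> \<tturnstile> Ty Prop R"
      and Q: "\<Gamma> \<tturnstile> Ty Col (Quot A R)" and sR: "pstable (sub_ty (shift (Suc 0)) A # A # \<Gamma>) R"
      and a: "\<Gamma> \<tturnstile> Tm a A" and b: "\<Gamma> \<tturnstile> Tm b A" for \<Gamma> A R a b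
  proof (rule stab_at_I[OF Q cls_tm[OF A R Q a] cls_tm[OF A R Q b]])
    fix \<Delta> \<sigma> assume s: "wsub \<Delta> \<sigma> \<Gamma>"
    let ?A = "sub_ty \<sigma> A" and ?R = "sub_ty (lift_sub (lift_sub \<sigma>)) R" and ?a = "sub_tm \<sigma> a" and ?b =
        "sub_tm \<sigma> b"
    have q: "sub_ty \<sigma> (Quot A R) = Quot ?A ?R" by simp
    assume n: "\<Delta> \<tturnstile> Tm TT (nn (EqP (sub_ty \<sigma> (Quot A R)) (sub_tm \<sigma> (Cls a)) (sub_tm \<sigma> (Cls b))))"
    then have n: "\<Delta> \<tturnstile> Tm TT (nn (EqP (Quot ?A ?R) (Cls ?a) (Cls ?b)))" by simp
    note A' = subst_ty[OF A s] and R' = subst_ty[OF R wsub_lift2[OF s A]] and Q' = subst_ty[OF Q s,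
        unfolded q]
      and a = subst_tm[OF a s] and b = subst_tm[OF b s]
    have w: "wsub \<Delta> (?b \<cdot> ?a \<cdot> Var) (sub_ty (shift (Suc 0)) ?A # ?A # \<Delta>)"
      using a b by (intro wsub_scons wsub_id wsub_ctx[OF s]) simp_all
    have "\<Delta> \<tturnstile> Tm TT (nn (sub_ty (?b \<cdot> ?a \<cdot> Var) ?R))"
    proof (rule nn_eq_map[OF Q' cls_tm[OF A' R' Q' a] cls_tm[OF A' R' Q' b] n subst_ty[OF R' w]])
      fix \<Theta> \<tau> assume r: "wsub \<Theta> \<tau> \<Delta>" and e: "\<Theta> \<tturnstile> TmEq (sub_tm \<tau> (Cls ?a)) (sub_tm \<tau> (Cls ?b)) (sub_ty
          \<tau> (Quot ?A ?R))"
      show "\<Theta> \<tturnstile> Tm TT (sub_ty \<tau> (sub_ty (?b \<cdot> ?a \<cdot> Var) ?R))"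
        using cls_eqD[of \<Theta> "sub_tm \<tau> ?a" "sub_tm \<tau> ?b" "sub_ty \<tau> ?A"
          "sub_ty (lift_sub (lift_sub \<tau>)) ?R"] e
          subst_ty[OF A' r] subst_ty[OF R' wsub_lift2[OF r A']] subst_ty[OF Q' r] subst_tm[OF a r]
              subst_tm[OF b r] by simp
    qed
    then have "\<Delta> \<tturnstile> Tm TT (sub_ty (?b \<cdot> ?a \<cdot> Var) ?R)"
      by (rule pstableD[OF pstable_sub[OF pstable_sub[OF sR wsub_lift2[OF s A]] w]])
    from cls_eqI[OF A' R' Q' a b this]
    show "\<Delta> \<tturnstile> TmEq (sub_tm \<sigma> (Cls a)) (sub_tm \<sigma> (Cls b)) (sub_ty \<sigma> (Quot A R))" by simp
  qed
  fix \<Delta> \<sigma> p q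
  assume s: "wsub \<Delta> \<sigma> \<Gamma>"
  let ?A = "sub_ty \<sigma> A" and ?R = "sub_ty (lift_sub (lift_sub \<sigma>)) R"
  have Qs: "sub_ty \<sigma> (Quot A R) = Quot ?A ?R" by simp
  assume p: "\<Delta> \<tturnstile> Tm p (sub_ty \<sigma> (Quot A R))" and q: "\<Delta> \<tturnstile> Tm q (sub_ty \<sigma> (Quot A R))"
  note A' = subst_ty[OF A s] and R' = subst_ty[OF R wsub_lift2[OF s A]] and Q' = subst_ty[OF Q s,
      unfolded Qs]
    and sR' = pstable_sub[OF sR wsub_lift2[OF s A]] and p = p[unfolded Qs] and q = q[unfolded Qs]
  show "\<Delta> \<tturnstile> Tm TT (stab_at (sub_ty \<sigma> (Quot A R)) p q)"
    unfolding Qs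
  proof (rule stab_at_quot_ind[OF A' R' Q' p q])
    fix \<Theta> \<tau> a assume r: "wsub \<Theta> \<tau> \<Delta>" and a: "\<Theta> \<tturnstile> Tm a (sub_ty \<tau> ?A)"
    let ?A' = "sub_ty \<tau> ?A" and ?R' = "sub_ty (lift_sub (lift_sub \<tau>)) ?R"
    have Qr: "sub_ty \<tau> (Quot ?A ?R) = Quot ?A' ?R'" by simp
    note A'' = subst_ty[OF A' r] and R'' = subst_ty[OF R' wsub_lift2[OF r A']] and Q'' = subst_ty[OF
        Q' r, unfolded Qr]
      and sR'' = pstable_sub[OF sR' wsub_lift2[OF r A']] and q' = subst_tm[OF q r, unfolded Qr]
    show "\<Theta> \<tturnstile> Tm TT (stab_at (sub_ty \<tau> (Quot ?A ?R)) (Cls a) (sub_tm \<tau> q))"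
      unfolding Qr
    proof (rule stab_at_sym[OF stab_at_quot_ind[OF A'' R'' Q'' q' cls_tm[OF A'' R'' Q'' a]] Q''
        cls_tm[OF A'' R'' Q'' a] q'])
      fix \<Xi> \<upsilon> b assume u: "wsub \<Xi> \<upsilon> \<Theta>" and b: "\<Xi> \<tturnstile> Tm b (sub_ty \<upsilon> ?A')"
      let ?A'' = "sub_ty \<upsilon> ?A'" and ?R'' = "sub_ty (lift_sub (lift_sub \<upsilon>)) ?R'"
      have Qu: "sub_ty \<upsilon> (Quot ?A' ?R') = Quot ?A'' ?R''" by simp
      show "\<Xi> \<tturnstile> Tm TT (stab_at (sub_ty \<upsilon> (Quot ?A' ?R')) (Cls b) (sub_tm \<upsilon> (Cls a)))"
        unfolding Qu sub_tm.simps
        by (rule cls[OF subst_ty[OF A'' u] subst_ty[OF R'' wsub_lift2[OF u A'']] subst_ty[OF Q'' u,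
          unfolded Qu]
              pstable_sub[OF sR'' wsub_lift2[OF u A'']] b subst_tm[OF a u]])
    qed
  qed
qed

section \<open>Propositions up to double negation\<close>

text \<open>The replacement of \<open>P(1)\<close>: its quotient by doubly negated equality. As a quotient by a
  stable relation, it has stable equality.\<close>

definition P1nn :: ty where
  "P1nn = Quot P1 (nn (EqP P1 (Var (Suc 0)) (Var 0)))"

lemma sub_P1nn [simp]: "sub_ty \<sigma> P1nn = P1nn"
  by (simp add: P1nn_def)

lemma P1nn_vars:
  assumes "\<Gamma> \<tturnstile> Ctx"
  shows "P1 # P1 # \<Gamma> \<tturnstile> Ctx" "P1 # P1 # \<Gamma> \<tturnstile> Tm (Var (Suc 0)) P1" "P1 # P1 # \<Gamma> \<tturnstile> Tm (Var 0) P1"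
proof -
  note P = p1_col[OF assms]
  note P' = p1_col[OF ctx_cons[OF P]]
  show "P1 # P1 # \<Gamma> \<tturnstile> Ctx" by (rule ctx_cons[OF P'])
  show "P1 # P1 # \<Gamma> \<tturnstile> Tm (Var (Suc 0)) P1" using subst_tm[OF var0[OF P] wsub_shift[OF P']] by simp
  show "P1 # P1 # \<Gamma> \<tturnstile> Tm (Var 0) P1" using var0[OF P'] by simp
qed

lemma P1nn_rel:
  assumes "\<Gamma> \<tturnstile> Ctx"
  shows "sub_ty (shift (Suc 0)) P1 # P1 # \<Gamma> \<tturnstile> Ty Prop (nn (EqP P1 (Var (Suc 0)) (Var 0)))"
  using neg_prop[OF neg_prop[OF eq_prop[OF p1_col P1nn_vars(2,3)]]] P1nn_vars(1) assms by simp

lemma P1nn_col: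
  assumes c: "\<Gamma> \<tturnstile> Ctx"
  shows "\<Gamma> \<tturnstile> Ty Col P1nn"
proof -
  let ?R = "\<lambda>i j. nn (EqP P1 (Var i) (Var j))"
  have v: "\<Gamma> \<tturnstile> Tm (Var i) P1" if "\<Gamma> \<tturnstile> Ctx" "i < length \<Gamma>" "\<Gamma> ! i = P1" for \<Gamma> i
    using var[OF that(1,2)] that(3) by (simp add: var_ty_def)
  have rel: "\<Gamma> \<tturnstile> Ty Prop (?R i j)"
    if "\<Gamma> \<tturnstile> Ctx" "i < length \<Gamma>" "\<Gamma> ! i = P1" "j < length \<Gamma>" "\<Gamma> ! j = P1" for \<Gamma> i j
    using that by (intro neg_prop eq_prop p1_col v)
  have h: "\<Gamma> \<tturnstile> Tm TT (?R (Suc (i + n)) (Suc (j + n)))"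
    if "\<Gamma> \<tturnstile> Ctx" "n < length \<Gamma>" "\<Gamma> ! n = ?R i j"
      "Suc (i + n) < length \<Gamma>" "\<Gamma> ! Suc (i + n) = P1" "Suc (j + n) < length \<Gamma>" "\<Gamma> ! Suc (j + n) = P1"
          for \<Gamma> i j n
    using var[OF that(1,2)] that(3) by (intro proof_true[OF rel[OF that(1,4-7)]]) (simp add: var_ty_def)
  have c1: "P1 # \<Gamma> \<tturnstile> Ctx" by (intro ctx_cons p1_col c)
  have c2: "P1 # P1 # \<Gamma> \<tturnstile> Ctx" by (intro ctx_cons p1_col c1)
  have c3: "P1 # P1 # P1 # \<Gamma> \<tturnstile> Ctx" by (intro ctx_cons p1_col c2)
  have c2': "?R (Suc 0) 0 # P1 # P1 # \<Gamma> \<tturnstile> Ctx" by (rule ctx_cons[OF prop_col[OF rel[OF c2]]]) simp_all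
  have c4: "?R (Suc (Suc 0)) (Suc 0) # P1 # P1 # P1 # \<Gamma> \<tturnstile> Ctx"
    by (rule ctx_cons[OF prop_col[OF rel[OF c3]]]) simp_all
  \<comment> \<open>the hypotheses \<open>R(x,y)\<close> and \<open>R(y,z)\<close> look alike: the second one lives in a context with one more
     variable\<close>
  have c5: "?R (Suc (Suc 0)) (Suc 0) # ?R (Suc (Suc 0)) (Suc 0) # P1 # P1 # P1 # \<Gamma> \<tturnstile> Ctx"
    by (rule ctx_cons[OF prop_col[OF rel[OF c4]]]) simp_all
  have refl: "P1 # \<Gamma> \<tturnstile> Tm TT (?R 0 0)"
    by (intro nn_I eq_prop eq_intro p1_col c1 v) simp_all
  have sym: "?R (Suc 0) 0 # P1 # P1 # \<Gamma> \<tturnstile> Tm TT (?R (Suc 0) (Suc (Suc 0)))"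
    by (rule nn_eq_sym[OF p1_col[OF c2'] v[OF c2'] v[OF c2']])
      (use h[OF c2', of 0 "Suc 0" 0] in simp_all)
  have trans: "?R (Suc (Suc 0)) (Suc 0) # ?R (Suc (Suc 0)) (Suc 0) # P1 # P1 # P1 # \<Gamma>
    \<tturnstile> Tm TT (?R (Suc (Suc (Suc (Suc 0)))) (Suc (Suc 0)))"
    by (rule nn_eq_trans[OF p1_col[OF c5] v[OF c5] v[OF c5, of "Suc (Suc (Suc 0))"] v[OF c5]])
      (use h[OF c5, of 0 "Suc (Suc 0)" "Suc 0"] h[OF c5, of "Suc 0" "Suc (Suc 0)" "Suc 0"] in simp_all)
  show ?thesis
    using quot_form[of emTT_imp \<Gamma> P1 "?R (Suc 0) 0"] p1_col[OF c] P1nn_rel[OF c] refl sym trans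
    by (simp add: P1nn_def)
qed

lemma P1nn_cls: "\<Gamma> \<tturnstile> Tm U P1 \<Longrightarrow> \<Gamma> \<tturnstile> Tm (Cls U) P1nn"
  unfolding P1nn_def using P1nn_col[of \<Gamma>]
  by (intro cls_tm p1_col P1nn_rel) (auto simp: P1nn_def intro: derives_ctx)

lemma P1nn_cls_eqI:
  assumes U: "\<Gamma> \<tturnstile> Tm U P1" and V: "\<Gamma> \<tturnstile> Tm V P1" and e: "\<Gamma> \<tturnstile> Tm TT (nn (EqP P1 U V))"
  shows "\<Gamma> \<tturnstile> TmEq (Cls U) (Cls V) P1nn"
  using cls_eqI[OF p1_col P1nn_rel P1nn_col[unfolded P1nn_def] U V] derives_ctx[OF U] e
  by (simp add: P1nn_def)

lemma P1nn_cls_eqD: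
  assumes e: "\<Gamma> \<tturnstile> TmEq (Cls U) (Cls V) P1nn" and U: "\<Gamma> \<tturnstile> Tm U P1" and V: "\<Gamma> \<tturnstile> Tm V P1"
  shows "\<Gamma> \<tturnstile> Tm TT (nn (EqP P1 U V))"
  using cls_eqD[OF e[unfolded P1nn_def] p1_col P1nn_rel P1nn_col[unfolded P1nn_def] U V]
    derives_ctx[OF U]
  by simp

lemma P1nn_cls_cong:
  assumes e: "\<Gamma> \<tturnstile> TmEq U V P1"
  shows "\<Gamma> \<tturnstile> TmEq (Cls U) (Cls V) P1nn"
  using cls_cong[of emTT_imp \<Gamma> P1 "nn (EqP P1 (Var (Suc 0)) (Var 0))" U V] e derives_ctx[OF e]
    p1_col[of \<Gamma>] P1nn_rel[of \<Gamma>] P1nn_col[of \<Gamma>]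
  by (simp add: P1nn_def)

lemma stable_P1nn:
  assumes c: "\<Gamma> \<tturnstile> Ctx"
  shows "stable \<Gamma> P1nn"
proof -
  have "P1 # P1 # \<Gamma> \<tturnstile> Ty Prop (Neg (EqP P1 (Var (Suc 0)) (Var 0)))"
    by (intro neg_prop eq_prop p1_col P1nn_vars c)
  then have "pstable (sub_ty (shift (Suc 0)) P1 # P1 # \<Gamma>) (nn (EqP P1 (Var (Suc 0)) (Var 0)))"
    by (simp add: pstable_neg)
  from stable_quot[OF p1_col[OF c] P1nn_rel[OF c] P1nn_col[OF c, unfolded P1nn_def] this]
  show ?thesis by (simp add: P1nn_def)
qed

lemma code_eqI:
  "\<Gamma> \<tturnstile> Ty Prop \<phi> \<Longrightarrow> \<Gamma> \<tturnstile> Ty Prop \<psi> \<Longrightarrow> \<Gamma> \<tturnstile> Tm TT (Iff \<phi> \<psi>) \<Longrightarrow> \<Gamma> \<tturnstile> TmEq (Code \<phi>) (Code \<psi>) P1"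
  using code_eq[of emTT_imp \<Gamma> \<phi> \<psi>] by simp

lemma code_eqD:
  "\<Gamma> \<tturnstile> Ty Prop \<phi> \<Longrightarrow> \<Gamma> \<tturnstile> Ty Prop \<psi> \<Longrightarrow> \<Gamma> \<tturnstile> TmEq (Code \<phi>) (Code \<psi>) P1 \<Longrightarrow> \<Gamma> \<tturnstile> Tm TT (Iff \<phi> \<psi>)"
  using code_eff[of emTT_imp \<Gamma> \<phi> \<psi>] by simp

text \<open>Equality of classes gives equality of the codes, and hence equivalence of the
  propositions, only up to double negation. As equivalence of stable propositions is stable,
  nothing is lost.\<close>

lemma P1nn_code_eff:
  assumes p: "\<Gamma> \<tturnstile> Ty Prop \<phi>" and q: "\<Gamma> \<tturnstile> Ty Prop \<psi>" and sp: "pstable \<Gamma> \<phi>" and sq: "pstable \<Gamma> \<psi>"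
    and e: "\<Gamma> \<tturnstile> TmEq (Cls (Code \<phi>)) (Cls (Code \<psi>)) P1nn"
  shows "\<Gamma> \<tturnstile> Tm TT (Iff \<phi> \<psi>)"
proof (rule pstableD)
  note c = code_tm[OF p] code_tm[OF q]
  show "\<Gamma> \<tturnstile> Tm TT (nn (Iff \<phi> \<psi>))"
  proof (rule nn_eq_map[OF p1_col[OF derives_ctx[OF p]] c P1nn_cls_eqD[OF e c] iff_prop[OF p q]])
    fix \<Delta> \<sigma> assume s: "wsub \<Delta> \<sigma> \<Gamma>" and e: "\<Delta> \<tturnstile> TmEq (sub_tm \<sigma> (Code \<phi>)) (sub_tm \<sigma> (Code \<psi>)) (sub_ty \<sigma>
        P1)"
    show "\<Delta> \<tturnstile> Tm TT (sub_ty \<sigma> (Iff \<phi> \<psi>))"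
      using code_eqD[OF subst_ty[OF p s] subst_ty[OF q s]] e by simp
  qed
  show "pstable \<Gamma> (Iff \<phi> \<psi>)" by (intro pstable_conj pstable_impl impl_prop p q sp sq)
qed

lemma code_eq_true:
  assumes p: "\<Gamma> \<tturnstile> Ty Prop \<phi>" and t: "\<Gamma> \<tturnstile> Tm TT \<phi>"
  shows "\<Gamma> \<tturnstile> TmEq (Code \<phi>) (Code Top) P1"
proof (rule code_eqI[OF p top_prop[OF derives_ctx[OF p]] iff_I[OF p top_prop[OF derives_ctx[OF p]]]])
  fix \<Delta> \<sigma> assume s: "wsub \<Delta> \<sigma> \<Gamma>"
  show "\<Delta> \<tturnstile> Tm TT (sub_ty \<sigma> \<phi>)" by (rule subst_prf[OF t s])
  show "\<Delta> \<tturnstile> Tm TT (sub_ty \<sigma> Top)" using top_true[OF wsub_ctx[OF s]] by simp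
qed

lemma code_eq_false:
  assumes p: "\<Gamma> \<tturnstile> Ty Prop \<phi>" and q: "\<Gamma> \<tturnstile> Ty Prop \<psi>"
    and np: "\<Gamma> \<tturnstile> Tm TT (Neg \<phi>)" and nq: "\<Gamma> \<tturnstile> Tm TT (Neg \<psi>)"
  shows "\<Gamma> \<tturnstile> TmEq (Code \<phi>) (Code \<psi>) P1"
proof (rule code_eqI[OF p q iff_I[OF p q]])
  fix \<Delta> \<sigma> assume s: "wsub \<Delta> \<sigma> \<Gamma>"
  note p' = subst_ty[OF p s] and q' = subst_ty[OF q s]
  have n: "\<Delta> \<tturnstile> Tm TT (Neg (sub_ty \<sigma> \<phi>))" "\<Delta> \<tturnstile> Tm TT (Neg (sub_ty \<sigma> \<psi>))"
    using subst_prf[OF np s] subst_prf[OF nq s] by simp_all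
  show "\<Delta> \<tturnstile> Tm TT (sub_ty \<sigma> \<phi>) \<Longrightarrow> \<Delta> \<tturnstile> Tm TT (sub_ty \<sigma> \<psi>)"
    using neg_E[OF n(1) _ p'] by (rule bot_elim[OF _ q'])
  show "\<Delta> \<tturnstile> Tm TT (sub_ty \<sigma> \<psi>) \<Longrightarrow> \<Delta> \<tturnstile> Tm TT (sub_ty \<sigma> \<phi>)"
    using neg_E[OF n(2) _ q'] by (rule bot_elim[OF _ p'])
qed

text \<open>The proposition coded by an element of \<open>P1nn\<close>, as in the \<open>\<eta>\<close>-rule for \<open>P(1)\<close>.\<close>

abbreviation holds_nn :: "tm \<Rightarrow> ty" where "holds_nn U \<equiv> EqP P1nn U (Cls (Code Top))"

lemma holds_nn_prop: "\<Gamma> \<tturnstile> Tm U P1nn \<Longrightarrow> \<Gamma> \<tturnstile> Ty Prop (holds_nn U)"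
  by (intro eq_prop P1nn_col P1nn_cls code_tm top_prop) (auto intro: derives_ctx)

text \<open>The class of \<open>V\<close> equals the class of \<open>\<top>\<close> precisely when \<open>\<not>\<not>(V = [\<top>])\<close>. So the claim
  compares \<open>V\<close>, which codes \<open>V = [\<top>]\<close>, with the code of \<open>\<not>\<not>(V = [\<top>])\<close>, and only up to double
  negation. There \<open>V = [\<top>]\<close> may be taken to be decided, and a decided proposition is equivalent to
  its double negation.\<close>

lemma P1nn_code_eta_cls:
  assumes V: "\<Gamma> \<tturnstile> Tm V P1"
  shows "\<Gamma> \<tturnstile> TmEq (Cls V) (Cls (Code (holds_nn (Cls V)))) P1nn"
proof (rule P1nn_cls_eqI[OF V])
  let ?\<phi> = "EqP P1 V (Code Top)" and ?E = "holds_nn (Cls V)"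
  have top: "\<Delta> \<tturnstile> Tm (Code Top) P1" if "\<Delta> \<tturnstile> Ctx" for \<Delta> by (rule code_tm[OF top_prop[OF that]])
  note c = derives_ctx[OF V]
  have E: "\<Delta> \<tturnstile> Ty Prop (holds_nn (Cls V))" if "\<Delta> \<tturnstile> Tm V P1" for \<Delta> V
    by (rule holds_nn_prop[OF P1nn_cls[OF that]])
  show EV: "\<Gamma> \<tturnstile> Tm (Code ?E) P1" by (rule code_tm[OF E[OF V]])
  show "\<Gamma> \<tturnstile> Tm TT (nn (EqP P1 V (Code ?E)))"
  proof (rule nn_cases[OF eq_prop[OF p1_col[OF c] V top[OF c]] eq_prop[OF p1_col[OF c] V EV]])
    fix \<Delta> \<sigma> assume s: "wsub \<Delta> \<sigma> \<Gamma>"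
    let ?V = "sub_tm \<sigma> V" and ?\<phi>' = "EqP P1 (sub_tm \<sigma> V) (Code Top)"
    note c = wsub_ctx[OF s]
    have V': "\<Delta> \<tturnstile> Tm ?V P1" using subst_tm[OF V s] by simp
    note E' = E[OF V'] and p = eq_prop[OF p1_col[OF c] V' top[OF c]]
    have res: "\<Delta> \<tturnstile> Tm TT (sub_ty \<sigma> (EqP P1 V (Code ?E)))" if "\<Delta> \<tturnstile> TmEq ?V (Code (holds_nn (Cls ?V))) P1"
      using eq_I[OF that p1_col[OF c] V'] by simp
    show "\<Delta> \<tturnstile> Tm TT (sub_ty \<sigma> (EqP P1 V (Code ?E)))" if "\<Delta> \<tturnstile> Tm TT (sub_ty \<sigma> ?\<phi>)"
    proof -
      \<comment> \<open>both \<open>V\<close> and the code on the right are \<open>[\<top>]\<close>\<close>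
      have e: "\<Delta> \<tturnstile> TmEq ?V (Code Top) P1" using that by (intro eq_E p1_col[OF c] V' top[OF c]) simp
      have "\<Delta> \<tturnstile> Tm TT (holds_nn (Cls ?V))"
        by (rule eq_I[OF P1nn_cls_cong[OF e] P1nn_col[OF c] P1nn_cls[OF V']])
      from res[OF tm_trans[OF e tm_sym[OF code_eq_true[OF E' this]]]] show ?thesis .
    qed
    show "\<Delta> \<tturnstile> Tm TT (sub_ty \<sigma> (EqP P1 V (Code ?E)))" if "\<Delta> \<tturnstile> Tm TT (Neg (sub_ty \<sigma> ?\<phi>))"
    proof -
      \<comment> \<open>\<open>V\<close> is the code of \<open>V = [\<top>]\<close>, and both propositions are refutable\<close>
      have n: "\<Delta> \<tturnstile> Tm TT (Neg ?\<phi>')" using that by simp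
      have "\<Delta> \<tturnstile> Tm TT (Neg (holds_nn (Cls ?V)))"
      proof (rule neg_I[OF E'])
        fix \<Theta> \<tau> assume r: "wsub \<Theta> \<tau> \<Delta>" and "\<Theta> \<tturnstile> Tm TT (sub_ty \<tau> (holds_nn (Cls ?V)))"
        then have h: "\<Theta> \<tturnstile> Tm TT (holds_nn (Cls (sub_tm \<tau> ?V)))" by simp
        have V'': "\<Theta> \<tturnstile> Tm (sub_tm \<tau> ?V) P1" using subst_tm[OF V' r] by simp
        note c = wsub_ctx[OF r]
        have "\<Theta> \<tturnstile> TmEq (Cls (sub_tm \<tau> ?V)) (Cls (Code Top)) P1nn"
          by (rule eq_E[OF h P1nn_col[OF c] P1nn_cls[OF V''] P1nn_cls[OF top[OF c]]])
        from P1nn_cls_eqD[OF this V'' top[OF c]] subst_prf[OF n r] eq_prop[OF p1_col[OF c] V'' top[OF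
          c]]
        show "\<Theta> \<tturnstile> Tm TT Bot" by (auto intro: neg_E neg_prop)
      qed
      from code_eq_false[OF p E' n this] tm_trans[OF code_eta[OF V']]
      show ?thesis by (blast intro: res)
    qed
  qed
qed

lemma P1nn_code_eta:
  assumes U: "\<Gamma> \<tturnstile> Tm U P1nn"
  shows "\<Gamma> \<tturnstile> TmEq U (Cls (Code (holds_nn U))) P1nn"
proof -
  have tm: "\<Delta> \<tturnstile> Tm (Cls (Code (holds_nn U))) P1nn" if "\<Delta> \<tturnstile> Tm U P1nn" for \<Delta> U
    by (rule P1nn_cls[OF code_tm[OF holds_nn_prop[OF that]]])
  note c = derives_ctx[OF U]
  note P = p1_col[OF c] and R = P1nn_rel[OF c] and Q = P1nn_col[OF c]
  note c' = ctx_cons[OF Q]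
  let ?\<chi> = "EqP P1nn (Var 0) (Cls (Code (holds_nn (Var 0))))"
  have v: "P1nn # \<Gamma> \<tturnstile> Tm (Var 0) P1nn" using var0[OF Q] by simp
  have X: "P1nn # \<Gamma> \<tturnstile> Ty Prop ?\<chi>" by (rule eq_prop[OF P1nn_col[OF c'] v tm[OF v]])
  have "\<Gamma> \<tturnstile> Tm TT (sub_ty (U \<cdot> Var) ?\<chi>)"
  proof (rule quot_ind[OF P R Q[unfolded P1nn_def] U[unfolded P1nn_def] X[unfolded P1nn_def], folded
      P1nn_def])
    fix \<Delta> \<sigma> V assume s: "wsub \<Delta> \<sigma> \<Gamma>" and "\<Delta> \<tturnstile> Tm V (sub_ty \<sigma> P1)"
    then have V: "\<Delta> \<tturnstile> Tm V P1" by simp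
    show "\<Delta> \<tturnstile> Tm TT (sub_ty (Cls V \<cdot> \<sigma>) ?\<chi>)"
      using eq_I[OF P1nn_code_eta_cls[OF V] P1nn_col[OF wsub_ctx[OF s]] P1nn_cls[OF V]] by simp
  qed
  then show ?thesis using eq_E[OF _ Q U tm[OF U]] by simp
qed

section \<open>Presuppositions of equality judgements\<close>

primrec presup :: "ctx \<Rightarrow> judgement \<Rightarrow> bool" where
  "presup \<Gamma> Ctx = (\<forall>i < length \<Gamma>. \<Gamma> \<tturnstile> Ty Col (var_ty \<Gamma> i))"
| "presup \<Gamma> (Ty k A) = True"
| "presup \<Gamma> (TyEq k A B) = (\<Gamma> \<tturnstile> Ty k A \<and> \<Gamma> \<tturnstile> Ty k B)"
| "presup \<Gamma> (Tm a A) = (\<Gamma> \<tturnstile> Ty Col A)"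
| "presup \<Gamma> (TmEq a b A) = (\<Gamma> \<tturnstile> Ty Col A \<and> \<Gamma> \<tturnstile> Tm a A \<and> \<Gamma> \<tturnstile> Tm b A)"

text \<open>Contexts are excluded because a substitution moves \<open>Ctx\<close> to another context without
  relating the types in the two.\<close>

lemma presup_sub:
  "presup \<Gamma> J \<Longrightarrow> J \<noteq> Ctx \<Longrightarrow> wsub \<Delta> \<sigma> \<Gamma> \<Longrightarrow> presup \<Delta> (sub_judgement \<sigma> J)"
  by (cases J) (auto intro: subst_ty subst_tm)

lemma presup_ctx_ext:
  assumes "presup \<Gamma> Ctx" and A: "\<Gamma> \<tturnstile> Ty Col A"
  shows "presup (A # \<Gamma>) Ctx"
  unfolding presup.simps
proof (intro allI impI)
  fix i assume "i < length (A # \<Gamma>)"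
  then show "A # \<Gamma> \<tturnstile> Ty Col (var_ty (A # \<Gamma>) i)"
    using assms subst_ty[OF _ wsub_shift[OF A], of Col] by (cases i) simp_all
qed

lemma inst_col: "A # \<Gamma> \<tturnstile> Ty Col L \<Longrightarrow> \<Gamma> \<tturnstile> Tm p A \<Longrightarrow> \<Gamma> \<tturnstile> Ty Col (sub_ty (p \<cdot> Var) L)"
  by (rule subst_ty[OF _ wsub_inst])

lemma inst_tm: "A # \<Gamma> \<tturnstile> Tm l L \<Longrightarrow> \<Gamma> \<tturnstile> Tm p A \<Longrightarrow> \<Gamma> \<tturnstile> Tm (sub_tm (p \<cdot> Var) l) (sub_ty (p \<cdot> Var) L)"
  by (rule subst_tm[OF _ wsub_inst])

text \<open>The identity is a typed substitution between contexts that differ by an equal type. The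
  congruence rules for binders need this, as their second premise is stated over the left-hand
  type only.\<close>

lemma ctx_conv:
  assumes J: "A # \<Gamma> \<tturnstile> J" and e: "\<Gamma> \<tturnstile> TyEq Col A A'" and A': "\<Gamma> \<tturnstile> Ty Col A'"
  shows "A' # \<Gamma> \<tturnstile> J"
proof -
  have [simp]: "sub_judgement Var J = J" by (cases J) simp_all
  have "A' # \<Gamma> \<tturnstile> TyEq Col (sub_ty (shift (Suc 0)) A') (sub_ty (shift (Suc 0)) A)"
    using subst[OF ty_sym[OF e] wsub_shift[OF A']] by simp
  from wsub_scons[OF wsub_shift[OF A'] tm_conv[OF var0[OF A'] this]]
  have "wsub (A' # \<Gamma>) Var (A # \<Gamma>)" by simp
  from subst[OF J this] show ?thesis by simp
qed

lemma motive_conv: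
  assumes t: "\<Gamma> \<tturnstile> Tm t (sub_ty (p' \<cdot> Var) L)" and L: "A # \<Gamma> \<tturnstile> Ty Col L"
    and e: "\<Gamma> \<tturnstile> TmEq p p' A" and p: "\<Gamma> \<tturnstile> Tm p A" "\<Gamma> \<tturnstile> Tm p' A"
  shows "\<Gamma> \<tturnstile> Tm t (sub_ty (p \<cdot> Var) L)"
  using tm_conv[OF t] scons_ty_eq[OF L wsub_id[OF derives_ctx[OF t]], of p' p] tm_sym[OF e] p by simp

text \<open>The congruence rule for the eliminator of quotients demands that the left branch \<open>l\<close>
  respect the relation, not that \<open>l'\<close> do. But \<open>l'(x) = l(x) = l(y) = l'(y)\<close>; the last of these
  equations comes in the type over \<open>[y]\<close> and has to be moved to the type over \<open>[x]\<close>.\<close>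

lemma presup_quot_elim_cong:
  assumes A: "\<Gamma> \<tturnstile> Ty Col A" and R: "sub_ty (shift (Suc 0)) A # A # \<Gamma> \<tturnstile> Ty Prop R"
    and Q: "\<Gamma> \<tturnstile> Ty Col (Quot A R)" and L: "Quot A R # \<Gamma> \<tturnstile> Ty Col L"
    and e: "A # \<Gamma> \<tturnstile> TmEq l l' (sub_ty (Cls (Var 0) \<cdot> shift (Suc 0)) L)"
    and c: "R # sub_ty (shift (Suc 0)) A # A # \<Gamma> \<tturnstile> TmEq (sub_tm (Var (Suc (Suc 0)) \<cdot> shift (Suc (Suc
        (Suc 0)))) l)
      (sub_tm (Var (Suc 0) \<cdot> shift (Suc (Suc (Suc 0)))) l) (sub_ty (Cls (Var (Suc (Suc 0))) \<cdot> shift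
          (Suc (Suc (Suc 0)))) L)"
  shows "R # sub_ty (shift (Suc 0)) A # A # \<Gamma> \<tturnstile> TmEq (sub_tm (Var (Suc (Suc 0)) \<cdot> shift (Suc (Suc (Suc
      0)))) l')
      (sub_tm (Var (Suc 0) \<cdot> shift (Suc (Suc (Suc 0)))) l') (sub_ty (Cls (Var (Suc (Suc 0))) \<cdot> shift
          (Suc (Suc (Suc 0)))) L)"
proof -
  let ?A = "sub_ty (shift (Suc 0)) A"
  let ?\<Theta> = "R # ?A # A # \<Gamma>" and ?s = "shift (Suc (Suc (Suc 0)))"
  have A': "A # \<Gamma> \<tturnstile> Ty Col ?A" by (rule subst_ty[OF A wsub_shift[OF A]])
  note wR = wsub_shift[OF prop_col[OF R]]
  have w: "wsub ?\<Theta> ?s \<Gamma>"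
    using wsub_comp[OF wsub_comp[OF wsub_shift[OF A] wsub_shift[OF A']] wR] by simp
  have x: "?\<Theta> \<tturnstile> Tm (Var (Suc (Suc 0))) (sub_ty ?s A)"
    using subst_tm[OF subst_tm[OF var0[OF A] wsub_shift[OF A']] wR] by simp
  have y: "?\<Theta> \<tturnstile> Tm (Var (Suc 0)) (sub_ty ?s A)" using subst_tm[OF var0[OF A'] wR] by simp
  let ?R = "sub_ty (lift_sub (lift_sub ?s)) R"
  have A3: "?\<Theta> \<tturnstile> Ty Col (sub_ty ?s A)" by (rule subst_ty[OF A w])
  note R3 = subst_ty[OF R wsub_lift2[OF w A]]
  have Q3: "?\<Theta> \<tturnstile> Ty Col (Quot (sub_ty ?s A) ?R)" using subst_ty[OF Q w] by simp
  have "?\<Theta> \<tturnstile> Tm TT (sub_ty (Var (Suc 0) \<cdot> Var (Suc (Suc 0)) \<cdot> Var) ?R)"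
    using hyp[OF R] by simp
  from cls_eqI[OF A3 R3 Q3 x y this]
  have xy: "?\<Theta> \<tturnstile> TmEq (Cls (Var (Suc (Suc 0)))) (Cls (Var (Suc 0))) (sub_ty ?s (Quot A R))" by simp
  have "?\<Theta> \<tturnstile> TyEq Col (sub_ty (Cls (Var (Suc 0)) \<cdot> ?s) L) (sub_ty (Cls (Var (Suc (Suc 0))) \<cdot> ?s) L)"
    using cls_tm[OF A3 R3 Q3 x] cls_tm[OF A3 R3 Q3 y] by (intro scons_ty_eq[OF L w tm_sym[OF xy]])
      simp_all
  \<comment> \<open>the equation at \<open>y\<close>, moved to the type over \<open>[x]\<close>\<close>
  from tm_eq_conv[OF _ this] subst_tm_eq[OF e wsub_scons[OF w y]]
  have ly: "?\<Theta> \<tturnstile> TmEq (sub_tm (Var (Suc 0) \<cdot> ?s) l) (sub_tm (Var (Suc 0) \<cdot> ?s) l') (sub_ty (Cls (Var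
      (Suc (Suc 0))) \<cdot> ?s) L)"
    by simp
  have lx: "?\<Theta> \<tturnstile> TmEq (sub_tm (Var (Suc (Suc 0)) \<cdot> ?s) l) (sub_tm (Var (Suc (Suc 0)) \<cdot> ?s) l') (sub_ty
      (Cls (Var (Suc (Suc 0))) \<cdot> ?s) L)"
    using subst_tm_eq[OF e wsub_scons[OF w x]] by simp
  show ?thesis by (rule tm_trans[OF tm_trans[OF tm_sym[OF lx] c] ly])
qed

lemmas imp_n0_elim = n0_elim[of emTT_imp, simplified]
lemmas imp_n1_elim = n1_elim[of emTT_imp, simplified]
lemmas imp_list_elim = list_elim[of emTT_imp, simplified]
lemmas imp_plus_elim = plus_elim[of emTT_imp, simplified]
lemmas imp_sigma_elim = sigma_elim[of emTT_imp, simplified]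
lemmas imp_quot_elim = quot_elim[of emTT_imp, simplified]

text \<open>All the presuppositions must be treated together: the one of \<open>TyEq\<close>, which is wanted
  below, needs that of \<open>TmEq\<close> for equality propositions; that of \<open>TmEq\<close> needs the one of \<open>Tm\<close> for
  substitution of equal terms; and that of \<open>Tm\<close> needs well-formed contexts for variables.\<close>

theorem presuppositions: "\<Gamma> \<tturnstile> J \<Longrightarrow> presup \<Gamma> J"
proof (induction rule: derives.induct)
  case (ctx_ext \<Gamma> A)
  then show ?case by (intro presup_ctx_ext)
next
  case (weakening \<Gamma> J A)
  note A = \<open>\<Gamma> \<tturnstile> Ty Col A\<close>
  show ?case
  proof (cases "J = Ctx")
    case True
    with weakening show ?thesis using presup_ctx_ext[OF _ A] by simp
  next
    case False
    with weakening show ?thesis using presup_sub[OF _ _ wsub_shift[OF A]] by simp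
  qed
next
  case (substitution \<Gamma> J \<Delta> \<sigma>)
  then have "wsub \<Delta> \<sigma> \<Gamma>" by (simp add: wsub_def)
  then show ?case using substitution presup_sub[of \<Gamma> J \<Delta> \<sigma>] by (cases "J = Ctx") simp_all
next
  case (substitution_ty_eq \<Gamma> k A \<Delta> \<sigma> \<tau>)
  then have "wsub \<Delta> \<sigma> \<Gamma>" "wsub \<Delta> \<tau> \<Gamma>" by (simp_all add: wsub_def)
  then show ?case using substitution_ty_eq by (simp add: subst_ty)
next
  case (substitution_tm_eq \<Gamma> a A \<Delta> \<sigma> \<tau>)
  then have s: "wsub \<Delta> \<sigma> \<Gamma>" and t: "wsub \<Delta> \<tau> \<Gamma>" and A: "\<Gamma> \<tturnstile> Ty Col A" and a: "\<Gamma> \<tturnstile> Tm a A"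
    by (simp_all add: wsub_def)
  have "\<Delta> \<tturnstile> TyEq Col (sub_ty \<sigma> A) (sub_ty \<tau> A)"
    using substitution_tm_eq by (intro derives.substitution_ty_eq[OF A]) simp_all
  from tm_conv[OF subst_tm[OF a t] ty_sym[OF this]] subst_tm[OF a s] subst_ty[OF A s]
  show ?case by simp
next
  case (tm_conv \<Gamma> a A B)
  then show ?case by simp
next
  case (tm_eq_conv \<Gamma> a b A B)
  then show ?case by (auto intro: derives.tm_conv)
next
  case (ty_eq_incl \<Gamma> k A B k')
  then show ?case by (auto elim!: kind_incl.cases intro: prop_col)
next
  case (conj_form_cong k \<Gamma> \<phi> \<phi>' \<psi> \<psi>')
  then show ?case by (auto intro!: conj_prop)
next
  case (disj_form_cong k \<Gamma> \<phi> \<phi>' \<psi> \<psi>')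
  then show ?case by (auto intro!: disj_prop)
next
  case (impl_form_cong k \<Gamma> \<phi> \<phi>' \<psi> \<psi>')
  then show ?case by (auto intro!: impl_prop)
next
  case (exi_form_cong k \<Gamma> A A' \<phi> \<phi>')
  then show ?case by (auto intro!: exi_prop intro: ctx_conv)
next
  case (forall_form_cong k \<Gamma> A A' \<phi> \<phi>')
  then show ?case by (auto intro!: forall_prop intro: ctx_conv)
next
  case (eq_form_cong k \<Gamma> A A' a a' b b')
  then show ?case by (auto intro!: eq_prop intro: derives.tm_conv)
next
  case (list_form_cong \<Gamma> A A')
  then show ?case by (simp add: list_col)
next
  case (plus_form_cong \<Gamma> A A' B B')
  then show ?case by (simp add: plus_col)
next
  case (sigma_form_cong k \<Gamma> A A' B B')
  then show ?case by (auto intro!: sigma_col intro: ctx_conv)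
next
  case (pi_form_cong \<Gamma> A A' B B')
  then show ?case by (auto intro!: pi_col intro: ctx_conv)
next
  case (top1_form_cong \<Gamma> A A')
  then show ?case by (simp add: top1_form)
next
  case (conj_intro \<Gamma> \<phi> \<psi>)
  then show ?case by (simp add: prop_col conj_prop)
next
  case (disj_intro1 \<Gamma> \<phi> \<psi>)
  then show ?case by (simp add: prop_col disj_prop)
next
  case (disj_intro2 \<Gamma> \<phi> \<psi>)
  then show ?case by (simp add: prop_col disj_prop)
next
  case (impl_intro \<Gamma> \<phi> \<psi>)
  then show ?case by (simp add: prop_col impl_prop)
next
  case (exi_intro \<Gamma> A \<phi> a)
  then show ?case by (simp add: prop_col exi_prop)
next
  case (forall_intro \<Gamma> A \<phi>)
  then show ?case by (simp add: prop_col forall_prop)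
next
  case (forall_elim \<Gamma> A \<phi> a)
  then show ?case using inst_col[OF prop_col] by simp
next
  case (eq_intro \<Gamma> A a)
  then show ?case by (simp add: prop_col eq_prop)
next
  case (n0_elim \<Gamma> L p)
  then show ?case by (simp add: inst_col)
next
  case (n0_elim_cong \<Gamma> L p p')
  then have L: "N0 # \<Gamma> \<tturnstile> Ty Col L" and e: "\<Gamma> \<tturnstile> TmEq p p' N0" and p: "\<Gamma> \<tturnstile> Tm p N0" "\<Gamma> \<tturnstile> Tm p' N0"
    by simp_all
  from motive_conv[OF imp_n0_elim[OF L p(2)] L e p] imp_n0_elim[OF L p(1)] inst_col[OF L p(1)]
  show ?case by simp
next
  case (n1_intro \<Gamma>)
  then show ?case using n1_form[of emTT_imp \<Gamma>] by simp
next
  case (n1_elim \<Gamma> L p c)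
  then show ?case by (simp add: inst_col)
next
  case (n1_elim_cong \<Gamma> L p p' c c')
  then have L: "N1 # \<Gamma> \<tturnstile> Ty Col L" and e: "\<Gamma> \<tturnstile> TmEq p p' N1" and p: "\<Gamma> \<tturnstile> Tm p N1" "\<Gamma> \<tturnstile> Tm p' N1"
    and c: "\<Gamma> \<tturnstile> Tm c (sub_ty (Star \<cdot> Var) L)" "\<Gamma> \<tturnstile> Tm c' (sub_ty (Star \<cdot> Var) L)"
    by simp_all
  from motive_conv[OF imp_n1_elim[OF L p(2) c(2)] L e p] imp_n1_elim[OF L p(1) c(1)] inst_col[OF L p(1)]
  show ?case by simp
next
  case (n1_beta \<Gamma> L c)
  then show ?case using imp_n1_elim[of \<Gamma> L Star c] n1_intro[OF derives_ctx[OF n1_beta(2)]] by simp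
next
  case (nil_intro \<Gamma> A)
  then show ?case by (simp add: list_col)
next
  case (cons_intro \<Gamma> A s a)
  then show ?case by simp
next
  case (cons_cong \<Gamma> A s s' a a')
  then show ?case by (simp add: cons_tm)
next
  case (list_elim \<Gamma> A L s a l)
  then show ?case by (simp add: inst_col)
next
  case (list_elim_cong \<Gamma> A L s s' a a' l l')
  then have L: "LIST A # \<Gamma> \<tturnstile> Ty Col L" and e: "\<Gamma> \<tturnstile> TmEq s s' (LIST A)"
    and s: "\<Gamma> \<tturnstile> Tm s (LIST A)" "\<Gamma> \<tturnstile> Tm s' (LIST A)" by simp_all
  have "\<Gamma> \<tturnstile> Tm (ElList s a l) (sub_ty (s \<cdot> Var) L)" "\<Gamma> \<tturnstile> Tm (ElList s' a' l') (sub_ty (s' \<cdot> Var) L)"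
    by (rule imp_list_elim[where A = A]; use list_elim_cong in simp)+
  from motive_conv[OF this(2) L e s] this(1) inst_col[OF L s(1)] show ?case by simp
next
  case (nil_beta \<Gamma> A L a l)
  then show ?case using imp_list_elim[of \<Gamma> A L LNil a l] by (simp add: nil_tm inst_col)
next
  case (cons_beta \<Gamma> A L s b a l)
  then have L: "LIST A # \<Gamma> \<tturnstile> Ty Col L" and s: "\<Gamma> \<tturnstile> Tm s (LIST A)" and b: "\<Gamma> \<tturnstile> Tm b A"
    and sb: "\<Gamma> \<tturnstile> Tm (LCons s b) (LIST A)" by (simp_all add: cons_tm)
  have r: "\<Gamma> \<tturnstile> Tm (ElList s a l) (sub_ty (s \<cdot> Var) L)"
    "\<Gamma> \<tturnstile> Tm (ElList (LCons s b) a l) (sub_ty (LCons s b \<cdot> Var) L)"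
    by (rule imp_list_elim[where A = A]; use cons_beta sb in simp)+
  have "wsub \<Gamma> (ElList s a l \<cdot> b \<cdot> s \<cdot> Var) (inst_ty 2 (Var 1) L # wk_ty 1 A # LIST A # \<Gamma>)"
    using r s b by (intro wsub_scons wsub_id derives_ctx[OF s]) simp_all
  from subst_tm[OF cons_beta(6) this] cons_beta r inst_col[OF L sb] show ?case by simp
next
  case (inl_intro \<Gamma> A B a)
  then show ?case by (simp add: plus_col)
next
  case (inl_cong \<Gamma> A B a a')
  then show ?case by (simp add: plus_col inl_tm)
next
  case (inr_intro \<Gamma> A B b)
  then show ?case by (simp add: plus_col)
next
  case (inr_cong \<Gamma> A B b b')
  then show ?case by (simp add: plus_col inr_tm)
next
  case (plus_elim \<Gamma> A B L p l r)
  then show ?case by (simp add: inst_col)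
next
  case (plus_elim_cong \<Gamma> A B L p p' l l' r r')
  then have L: "Plus A B # \<Gamma> \<tturnstile> Ty Col L" and e: "\<Gamma> \<tturnstile> TmEq p p' (Plus A B)"
    and p: "\<Gamma> \<tturnstile> Tm p (Plus A B)" "\<Gamma> \<tturnstile> Tm p' (Plus A B)" by simp_all
  have "\<Gamma> \<tturnstile> Tm (ElPlus p l r) (sub_ty (p \<cdot> Var) L)" "\<Gamma> \<tturnstile> Tm (ElPlus p' l' r') (sub_ty (p' \<cdot> Var) L)"
    by (rule imp_plus_elim[where A = A and B = B]; use plus_elim_cong in simp)+
  from motive_conv[OF this(2) L e p] this(1) inst_col[OF L p(1)] show ?case by simp
next
  case (inl_beta \<Gamma> A B L a l r)
  then have i: "\<Gamma> \<tturnstile> Tm (InL a) (Plus A B)" by (simp add: inl_tm)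
  then show ?case
    using inl_beta imp_plus_elim[of \<Gamma> A B L "InL a" l r] inst_tm[of A \<Gamma> l
      "sub_ty (InL (Var 0) \<cdot> shift (Suc 0)) L" a]
    by (simp add: inst_col)
next
  case (inr_beta \<Gamma> A B L b l r)
  then have i: "\<Gamma> \<tturnstile> Tm (InR b) (Plus A B)" by (simp add: inr_tm)
  then show ?case
    using inr_beta imp_plus_elim[of \<Gamma> A B L "InR b" l r] inst_tm[of B \<Gamma> r
      "sub_ty (InR (Var 0) \<cdot> shift (Suc 0)) L" b]
    by (simp add: inst_col)
next
  case (pair_intro \<Gamma> A B a b)
  then show ?case by (simp add: sigma_col)
next
  case (pair_cong \<Gamma> A B a a' b b')
  then have A: "\<Gamma> \<tturnstile> Ty Col A" and B: "A # \<Gamma> \<tturnstile> Ty Col B" and e: "\<Gamma> \<tturnstile> TmEq a a' A"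
    and a: "\<Gamma> \<tturnstile> Tm a A" "\<Gamma> \<tturnstile> Tm a' A" and b: "\<Gamma> \<tturnstile> Tm b (sub_ty (a \<cdot> Var) B)"
        "\<Gamma> \<tturnstile> Tm b' (sub_ty (a \<cdot> Var) B)"
    by simp_all
  from pair_tm[OF A B a(1) b(1)] pair_tm[OF A B a(2) motive_conv[OF b(2) B tm_sym[OF e] a(2,1)]]
    sigma_col[OF A B]
  show ?case by simp
next
  case (sigma_elim \<Gamma> A B L p m)
  then show ?case by (simp add: inst_col)
next
  case (sigma_elim_cong \<Gamma> A B L p p' m m')
  then have L: "Sigma A B # \<Gamma> \<tturnstile> Ty Col L" and e: "\<Gamma> \<tturnstile> TmEq p p' (Sigma A B)"
    and p: "\<Gamma> \<tturnstile> Tm p (Sigma A B)" "\<Gamma> \<tturnstile> Tm p' (Sigma A B)" by simp_all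
  have "\<Gamma> \<tturnstile> Tm (ElSigma p m) (sub_ty (p \<cdot> Var) L)" "\<Gamma> \<tturnstile> Tm (ElSigma p' m') (sub_ty (p' \<cdot> Var) L)"
    by (rule imp_sigma_elim[where A = A and B = B]; use sigma_elim_cong in simp)+
  from motive_conv[OF this(2) L e p] this(1) inst_col[OF L p(1)] show ?case by simp
next
  case (sigma_beta \<Gamma> A B L a b m)
  then have L: "Sigma A B # \<Gamma> \<tturnstile> Ty Col L" and ab: "\<Gamma> \<tturnstile> Tm (Pr a b) (Sigma A B)"
    and a: "\<Gamma> \<tturnstile> Tm a A" and b: "\<Gamma> \<tturnstile> Tm b (sub_ty (a \<cdot> Var) B)" by (simp_all add: pair_tm)
  have "wsub \<Gamma> (b \<cdot> a \<cdot> Var) (B # A # \<Gamma>)"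
    using a b by (intro wsub_scons wsub_id derives_ctx[OF a]) simp_all
  from subst_tm[OF sigma_beta(6) this] sigma_beta ab imp_sigma_elim[of \<Gamma> A B L "Pr a b" m] inst_col[OF
    L ab]
  show ?case by simp
next
  case (pi_intro \<Gamma> A B b)
  then show ?case by (simp add: pi_col)
next
  case (pi_intro_cong \<Gamma> A B b b')
  then show ?case using derives.pi_intro[of emTT_imp \<Gamma> A B] by (simp add: pi_col)
next
  case (pi_elim \<Gamma> A B f a)
  then show ?case by (simp add: inst_col)
next
  case (pi_elim_cong \<Gamma> A B f f' a a')
  then have A: "\<Gamma> \<tturnstile> Ty Col A" and B: "A # \<Gamma> \<tturnstile> Ty Col B" and e: "\<Gamma> \<tturnstile> TmEq a a' A"
    and f: "\<Gamma> \<tturnstile> Tm f (Pi A B)" "\<Gamma> \<tturnstile> Tm f' (Pi A B)" and a: "\<Gamma> \<tturnstile> Tm a A" "\<Gamma> \<tturnstile> Tm a' A" by simp_all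
  from ap_tm[OF A B f(1) a(1)] motive_conv[OF ap_tm[OF A B f(2) a(2)] B e a] inst_col[OF B a(1)]
  show ?case by simp
next
  case (pi_beta \<Gamma> A B b a)
  then show ?case
    using ap_tm[of \<Gamma> A B "Lam b" a] derives.pi_intro[of emTT_imp \<Gamma> A B b] inst_tm[of A \<Gamma> b B a]
    by (simp add: inst_col)
next
  case (pi_eta \<Gamma> A B f)
  then have A: "\<Gamma> \<tturnstile> Ty Col A" and B: "A # \<Gamma> \<tturnstile> Ty Col B" and f: "\<Gamma> \<tturnstile> Tm f (Pi A B)" by simp_all
  note w = wsub_shift[OF A]
  have "A # \<Gamma> \<tturnstile> Tm (Ap (sub_tm (shift (Suc 0)) f) (Var 0)) B"
    using ap_tm[OF subst_ty[OF A w] subst_ty[OF B wsub_lift[OF w A]], of "sub_tm (shift (Suc 0)) f"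
      "Var 0"]
      subst_tm[OF f w] var0[OF A] by simp
  with A B f derives.pi_intro[of emTT_imp \<Gamma> A B] show ?case by (simp add: pi_col)
next
  case (top1_intro \<Gamma> A b)
  then show ?case by (simp add: top1_form)
next
  case (top1_intro_cong \<Gamma> A b b')
  then show ?case by (simp add: top1_form derives.top1_intro)
next
  case (top1_elim \<Gamma> A f a)
  then show ?case by (auto intro: p1_col derives_ctx)
next
  case (top1_elim_cong \<Gamma> A f f' a a')
  then have "\<Gamma> \<tturnstile> Ty Col P1" by (auto intro: p1_col derives_ctx)
  with top1_elim_cong show ?case using derives.top1_elim[of emTT_imp \<Gamma> A] by simp
next
  case (top1_beta \<Gamma> A b a)
  then have "\<Gamma> \<tturnstile> Ty Col P1" by (auto intro: p1_col derives_ctx)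
  with top1_beta show ?case
    using derives.top1_elim[of emTT_imp \<Gamma> A "Lam b" a] derives.top1_intro[of emTT_imp \<Gamma> A b]
      inst_tm[of A \<Gamma> b P1 a] by simp
next
  case (top1_eta \<Gamma> A f)
  then have A: "\<Gamma> \<tturnstile> Ty Col A" and f: "\<Gamma> \<tturnstile> Tm f (ToP1 A)" by simp_all
  note w = wsub_shift[OF A]
  have "A # \<Gamma> \<tturnstile> Tm (Ap (sub_tm (shift (Suc 0)) f) (Var 0)) P1"
    using derives.top1_elim[of emTT_imp "A # \<Gamma>" "sub_ty (shift (Suc 0)) A"] subst_ty[OF A w]
      subst_tm[OF f w] var0[OF A] by simp
  with A f show ?case by (simp add: top1_form derives.top1_intro)
next
  case (cls_intro \<Gamma> A R a)
  then show ?case by simp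
next
  case (cls_cong \<Gamma> A R a a')
  then show ?case by (simp add: cls_tm)
next
  case (quot_eq \<Gamma> A R a b)
  then show ?case by (simp add: cls_tm)
next
  case (quot_eff \<Gamma> A R a b)
  then have A: "\<Gamma> \<tturnstile> Ty Col A" and R: "sub_ty (shift (Suc 0)) A # A # \<Gamma> \<tturnstile> Ty Prop R"
    and a: "\<Gamma> \<tturnstile> Tm a A" and b: "\<Gamma> \<tturnstile> Tm b A" by simp_all
  have "wsub \<Gamma> (b \<cdot> a \<cdot> Var) (sub_ty (shift (Suc 0)) A # A # \<Gamma>)"
    using a b by (intro wsub_scons wsub_id derives_ctx[OF a]) simp_all
  from prop_col[OF subst_ty[OF R this]] show ?case by simp
next
  case (quot_elim \<Gamma> A R L p l)
  then show ?case by (simp add: inst_col)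
next
  case (quot_elim_cong \<Gamma> A R L p p' l l')
  then have L: "Quot A R # \<Gamma> \<tturnstile> Ty Col L" and e: "\<Gamma> \<tturnstile> TmEq p p' (Quot A R)"
    and p: "\<Gamma> \<tturnstile> Tm p (Quot A R)" "\<Gamma> \<tturnstile> Tm p' (Quot A R)" by simp_all
  have "\<Gamma> \<tturnstile> Tm (ElQ p l) (sub_ty (p \<cdot> Var) L)"
    by (rule imp_quot_elim[where A = A and R = R]) (use quot_elim_cong in simp_all)
  moreover have "\<Gamma> \<tturnstile> Tm (ElQ p' l') (sub_ty (p' \<cdot> Var) L)"
    by (rule imp_quot_elim[where A = A and R = R])
      (use quot_elim_cong presup_quot_elim_cong[of \<Gamma> A R L l l'] in simp_all)
  ultimately show ?case using motive_conv[OF _ L e p] inst_col[OF L p(1)] by simp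
next
  case (quot_beta \<Gamma> A R L a l)
  then have i: "\<Gamma> \<tturnstile> Tm (Cls a) (Quot A R)" by (simp add: cls_tm)
  then show ?case
    using quot_beta imp_quot_elim[of \<Gamma> A R L "Cls a" l] inst_tm[of A \<Gamma> l
      "sub_ty (Cls (Var 0) \<cdot> shift (Suc 0)) L" a]
    by (simp add: inst_col)
next
  case (code_intro \<Gamma> \<phi>)
  then show ?case by (auto intro: p1_col derives_ctx)
next
  case (code_cong \<Gamma> \<phi> \<psi>)
  then have "\<Gamma> \<tturnstile> Ty Col P1" by (auto intro: p1_col derives_ctx)
  with code_cong show ?case by (simp add: code_tm)
next
  case (code_eq \<Gamma> \<phi> \<psi>)
  then have "\<Gamma> \<tturnstile> Ty Col P1" by (auto intro: p1_col derives_ctx)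
  with code_eq show ?case by (simp add: code_tm)
next
  case (code_eff \<Gamma> \<phi> \<psi>)
  then show ?case by (simp add: prop_col iff_prop)
next
  case (code_eta \<Gamma> U)
  then have "\<Gamma> \<tturnstile> Ty Col P1" "\<Gamma> \<tturnstile> Tm (Code Top) P1" by (auto intro: p1_col derives_ctx code_top_bot_tm)
  with code_eta show ?case by (simp add: code_tm eq_prop)
qed (simp_all add: prop_col)

section \<open>The double-negation translation\<close>

text \<open>Terms change only at codes of propositions, which are sent to their classes in \<open>P1nn\<close>.
  Since \<open>Lam\<close> and \<open>Ap\<close> are shared by products and power collections, replacing \<open>A \<rightarrow> P(1)\<close> by a
  product leaves these terms alone.\<close>

primrec tr_ty :: "ty \<Rightarrow> ty" and tr_tm :: "tm \<Rightarrow> tm" where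
  "tr_ty Bot = Bot"
| "tr_ty (Conj A B) = Conj (tr_ty A) (tr_ty B)"
| "tr_ty (Disj A B) = nn (Disj (tr_ty A) (tr_ty B))"
| "tr_ty (Impl A B) = Impl (tr_ty A) (tr_ty B)"
| "tr_ty (Exi A B) = nn (Exi (tr_ty A) (tr_ty B))"
| "tr_ty (Forall A B) = Forall (tr_ty A) (tr_ty B)"
| "tr_ty (EqP A a b) = EqP (tr_ty A) (tr_tm a) (tr_tm b)"
| "tr_ty N0 = N0"
| "tr_ty N1 = N1"
| "tr_ty (LIST A) = LIST (tr_ty A)"
| "tr_ty (Plus A B) = Plus (tr_ty A) (tr_ty B)"
| "tr_ty (Sigma A B) = Sigma (tr_ty A) (tr_ty B)"
| "tr_ty (Pi A B) = Pi (tr_ty A) (tr_ty B)"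
| "tr_ty (Quot A R) = Quot (tr_ty A) (tr_ty R)"
| "tr_ty P1 = P1nn"
| "tr_ty (ToP1 A) = Pi (tr_ty A) P1nn"
| "tr_tm (Var n) = Var n"
| "tr_tm TT = TT"
| "tr_tm (ElN0 p) = ElN0 (tr_tm p)"
| "tr_tm Star = Star"
| "tr_tm (ElN1 p c) = ElN1 (tr_tm p) (tr_tm c)"
| "tr_tm LNil = LNil"
| "tr_tm (LCons s a) = LCons (tr_tm s) (tr_tm a)"
| "tr_tm (ElList s a l) = ElList (tr_tm s) (tr_tm a) (tr_tm l)"
| "tr_tm (InL a) = InL (tr_tm a)"
| "tr_tm (InR a) = InR (tr_tm a)"
| "tr_tm (ElPlus p l r) = ElPlus (tr_tm p) (tr_tm l) (tr_tm r)"
| "tr_tm (Pr a b) = Pr (tr_tm a) (tr_tm b)"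
| "tr_tm (ElSigma p m) = ElSigma (tr_tm p) (tr_tm m)"
| "tr_tm (Lam b) = Lam (tr_tm b)"
| "tr_tm (Ap f a) = Ap (tr_tm f) (tr_tm a)"
| "tr_tm (Cls a) = Cls (tr_tm a)"
| "tr_tm (ElQ p l) = ElQ (tr_tm p) (tr_tm l)"
| "tr_tm (Code \<phi>) = Cls (Code (tr_ty \<phi>))"

text \<open>Kept as a constant, because the simplifier would unfold the function at a variable and no
  longer recognise a shift.\<close>

definition tr_sub :: "(nat \<Rightarrow> tm) \<Rightarrow> nat \<Rightarrow> tm" where
  "tr_sub \<sigma> = (\<lambda>n. tr_tm (\<sigma> n))"

lemma tr_sub_apply [simp]: "tr_sub \<sigma> n = tr_tm (\<sigma> n)"
  by (simp add: tr_sub_def)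

lemma tr_ren: "tr_ty (ren_ty \<rho> A) = ren_ty \<rho> (tr_ty A)" "tr_tm (ren_tm \<rho> a) = ren_tm \<rho> (tr_tm a)"
proof -
  have [simp]: "ren_ty \<rho> P1nn = P1nn" for \<rho> by (simp add: ren_as_sub)
  show "tr_ty (ren_ty \<rho> A) = ren_ty \<rho> (tr_ty A)" "tr_tm (ren_tm \<rho> a) = ren_tm \<rho> (tr_tm a)"
    by (induction A and a arbitrary: \<rho> and \<rho>) simp_all
qed

lemma tr_sub_lift: "tr_sub (lift_sub \<sigma>) = lift_sub (tr_sub \<sigma>)"
proof
  fix n show "tr_sub (lift_sub \<sigma>) n = lift_sub (tr_sub \<sigma>) n"
    by (cases n) (simp_all add: lift_sub_def tr_ren del: lift_sub_eq)
qed

lemma tr_subst: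
  "tr_ty (sub_ty \<sigma> A) = sub_ty (tr_sub \<sigma>) (tr_ty A)"
  "tr_tm (sub_tm \<sigma> a) = sub_tm (tr_sub \<sigma>) (tr_tm a)"
  by (induction A and a arbitrary: \<sigma> and \<sigma>) (simp_all add: tr_sub_lift del: lift_sub_eq)

lemma tr_sub_scons: "tr_sub (a \<cdot> \<sigma>) = tr_tm a \<cdot> tr_sub \<sigma>"
proof
  fix n show "tr_sub (a \<cdot> \<sigma>) n = (tr_tm a \<cdot> tr_sub \<sigma>) n" by (cases n) simp_all
qed

lemma tr_sub_shift: "tr_sub (shift k) = shift k"
  by (rule ext) simp

lemma tr_sub_Var: "tr_sub Var = Var"
  using tr_sub_shift[of 0] by simp

primrec tr_judgement :: "judgement \<Rightarrow> judgement" where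
  "tr_judgement Ctx = Ctx"
| "tr_judgement (Ty k A) = Ty k (tr_ty A)"
| "tr_judgement (TyEq k A B) = TyEq k (tr_ty A) (tr_ty B)"
| "tr_judgement (Tm a A) = Tm (tr_tm a) (tr_ty A)"
| "tr_judgement (TmEq a b A) = TmEq (tr_tm a) (tr_tm b) (tr_ty A)"

lemma tr_judgement_sub: "tr_judgement (sub_judgement \<sigma> J) = sub_judgement (tr_sub \<sigma>) (tr_judgement J)"
  by (cases J) (simp_all add: tr_subst)

lemma var_ty_tr: "i < length \<Gamma> \<Longrightarrow> var_ty (map tr_ty \<Gamma>) i = tr_ty (var_ty \<Gamma> i)"
  by (simp add: var_ty_def tr_subst tr_sub_shift)

text \<open>The invariant carried along by the soundness proof. A type is translated to one with
  stable equality, and a proposition moreover to a stable proposition; resizing never turns a set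
  into a proposition, so the second clause survives all changes of kind.\<close>

primrec stable_judgement :: "ctx \<Rightarrow> judgement \<Rightarrow> bool" where
  "stable_judgement \<Gamma> Ctx = True"
| "stable_judgement \<Gamma> (Ty k A) = (stable \<Gamma> A \<and> (k \<in> {PropS, Prop} \<longrightarrow> pstable \<Gamma> A))"
| "stable_judgement \<Gamma> (TyEq k A B) = True"
| "stable_judgement \<Gamma> (Tm a A) = True"
| "stable_judgement \<Gamma> (TmEq a b A) = True"

lemma stable_judgement_sub:
  "stable_judgement \<Gamma> J \<Longrightarrow> wsub \<Delta> \<sigma> \<Gamma> \<Longrightarrow> stable_judgement \<Delta> (sub_judgement \<sigma> J)"
  by (cases J) (auto intro: stable_sub pstable_sub)

section \<open>Soundness of the translation\<close>

lemma nn_form_cong: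
  assumes "\<Gamma> \<tturnstile> TyEq Prop \<phi> \<psi>" shows "\<Gamma> \<tturnstile> TyEq Prop (nn \<phi>) (nn \<psi>)"
  using assms by (intro impl_form_cong ty_refl[OF bot_prop[OF derives_ctx[OF assms]]]) simp_all

text \<open>A doubly negated hypothesis may be used as if it were plain when the goal is stable. This
  is why the elimination rules for disjunctions and existential quantifiers survive the
  translation.\<close>

lemma nn_true_elim:
  assumes p: "\<Gamma> \<tturnstile> Ty Prop \<phi>" and x: "\<Gamma> \<tturnstile> Ty Prop \<chi>" and st: "pstable \<Gamma> \<chi>"
    and n: "\<Gamma> \<tturnstile> Tm TT (nn \<phi>)"
    and h: "\<And>\<Delta> \<sigma>. wsub \<Delta> \<sigma> \<Gamma> \<Longrightarrow> \<Delta> \<tturnstile> Tm TT (sub_ty \<sigma> \<phi>) \<Longrightarrow> \<Delta> \<tturnstile> Tm TT (sub_ty \<sigma> \<chi>)"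
  shows "\<Gamma> \<tturnstile> Tm TT \<chi>"
  by (rule pstableD[OF st nn_map[OF p x n h]])

lemma disj_elim_nn:
  assumes p: "\<Gamma> \<tturnstile> Ty Prop \<phi>" and q: "\<Gamma> \<tturnstile> Ty Prop \<psi>" and x: "\<Gamma> \<tturnstile> Ty Prop \<chi>" and st: "pstable \<Gamma> \<chi>"
    and n: "\<Gamma> \<tturnstile> Tm TT (nn (Disj \<phi> \<psi>))"
    and l: "\<phi> # \<Gamma> \<tturnstile> Tm TT (sub_ty (shift (Suc 0)) \<chi>)" and r: "\<psi> # \<Gamma> \<tturnstile> Tm TT (sub_ty (shift (Suc 0)) \<chi>)"
  shows "\<Gamma> \<tturnstile> Tm TT \<chi>"
proof (rule nn_true_elim[OF disj_prop[OF p q] x st n])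
  fix \<Delta> \<sigma> assume s: "wsub \<Delta> \<sigma> \<Gamma>" and h: "\<Delta> \<tturnstile> Tm TT (sub_ty \<sigma> (Disj \<phi> \<psi>))"
  then show "\<Delta> \<tturnstile> Tm TT (sub_ty \<sigma> \<chi>)"
    using disj_elim[OF subst_ty[OF p s] subst_ty[OF q s] subst_ty[OF x s]]
      subst_prf[OF l wsub_lift[OF s prop_col[OF p]]] subst_prf[OF r wsub_lift[OF s prop_col[OF q]]] by
          simp
qed

lemma exi_elim_nn:
  assumes A: "\<Gamma> \<tturnstile> Ty Col A" and q: "A # \<Gamma> \<tturnstile> Ty Prop \<phi>" and x: "\<Gamma> \<tturnstile> Ty Prop \<chi>" and st: "pstable \<Gamma> \<chi>"
    and n: "\<Gamma> \<tturnstile> Tm TT (nn (Exi A \<phi>))"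
    and h: "\<phi> # A # \<Gamma> \<tturnstile> Tm TT (sub_ty (shift (Suc (Suc 0))) \<chi>)"
  shows "\<Gamma> \<tturnstile> Tm TT \<chi>"
proof (rule nn_true_elim[OF exi_prop[OF A q] x st n])
  fix \<Delta> \<sigma> assume s: "wsub \<Delta> \<sigma> \<Gamma>" and t: "\<Delta> \<tturnstile> Tm TT (sub_ty \<sigma> (Exi A \<phi>))"
  note w = wsub_lift[OF s A]
  show "\<Delta> \<tturnstile> Tm TT (sub_ty \<sigma> \<chi>)"
    using exi_elim[OF subst_ty[OF A s] subst_ty[OF q w] subst_ty[OF x s]] t
      subst_prf[OF h wsub_lift[OF w prop_col[OF q]]] by simp
qed

lemmas tr_rules = tr_ty.simps tr_tm.simps tr_judgement.simps stable_judgement.simps tr_subst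
    tr_judgement_sub
  tr_sub_scons tr_sub_shift tr_sub_Var list.map length_map simp_thms

text \<open>For the rules whose type formers are translated homomorphically, the translated rule is
  another instance of the same rule; these cases are left to the last line. The others are the
  structural rules that involve substitutions, the formation rules and changes of kind, where
  stability has to be maintained, and the rules for the formers that the translation changes.\<close>

theorem tr_sound:
  "emTT_imp_c \<rhd> \<Gamma> \<turnstile> J
    \<Longrightarrow> map tr_ty \<Gamma> \<tturnstile> tr_judgement J \<and> stable_judgement (map tr_ty \<Gamma>) (tr_judgement J)"
proof (induction rule: derives.induct)
  case (var \<Gamma> i)
  then show ?case using derives.var[of emTT_imp "map tr_ty \<Gamma>" i] by (simp add: var_ty_tr)
next
  case (weakening \<Gamma> J A)
  then have w: "wsub (tr_ty A # map tr_ty \<Gamma>) (shift (Suc 0)) (map tr_ty \<Gamma>)" by (intro wsub_shift) simp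
  from weakening subst[OF _ w] stable_judgement_sub[OF _ w] show ?case
    by (simp add: tr_judgement_sub tr_sub_shift tr_sub_Var)
next
  case (substitution \<Gamma> J \<Delta> \<sigma>)
  then have w: "wsub (map tr_ty \<Delta>) (tr_sub \<sigma>) (map tr_ty \<Gamma>)"
    by (simp add: wsub_def var_ty_tr tr_subst)
  from substitution subst[OF _ w] stable_judgement_sub[OF _ w] show ?case
    by (simp add: tr_judgement_sub)
next
  case (substitution_ty_eq \<Gamma> k A \<Delta> \<sigma> \<tau>)
  then show ?case
    using derives.substitution_ty_eq[of emTT_imp "map tr_ty \<Gamma>" k "tr_ty A" "map tr_ty \<Delta>" "tr_sub \<sigma>"
      "tr_sub \<tau>"]
    by (simp add: var_ty_tr tr_subst)
next
  case (substitution_tm_eq \<Gamma> a A \<Delta> \<sigma> \<tau>)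
  then show ?case
    using derives.substitution_tm_eq[of emTT_imp "map tr_ty \<Gamma>" "tr_tm a" "tr_ty A" "map tr_ty \<Delta>"
      "tr_sub \<sigma>" "tr_sub \<tau>"]
    by (simp add: var_ty_tr tr_subst)
next
  case (ty_incl \<Gamma> k A k')
  then show ?case by (auto elim!: kind_incl.cases intro: prop_col)
next
  case (resize_col \<Gamma> A)
  then show ?case by simp
next
  case (resize_prop \<Gamma> \<phi>)
  then show ?case by simp
next
  case (lem \<Gamma> \<phi>)
  then show ?case by (simp add: nn_lem)
next
  case (bot_form \<Gamma>)
  then show ?case by (simp add: bot_prop stable_prop pstable_bot)
next
  case (conj_form k \<Gamma> \<phi> \<psi>)
  then show ?case by (auto intro!: conj_prop stable_prop pstable_conj)
next
  case (disj_form k \<Gamma> \<phi> \<psi>)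
  then show ?case by (auto intro!: neg_prop disj_prop stable_prop pstable_neg)
next
  case (disj_form_cong k \<Gamma> \<phi> \<phi>' \<psi> \<psi>')
  then show ?case by (auto intro!: nn_form_cong derives.disj_form_cong)
next
  case (impl_form k \<Gamma> \<phi> \<psi>)
  then show ?case by (auto intro!: impl_prop stable_prop pstable_impl)
next
  case (exi_form k \<Gamma> A \<phi>)
  then show ?case by (auto intro!: neg_prop exi_prop stable_prop pstable_neg)
next
  case (exi_form_cong k \<Gamma> A A' \<phi> \<phi>')
  then show ?case by (auto intro!: nn_form_cong derives.exi_form_cong)
next
  case (forall_form k \<Gamma> A \<phi>)
  then show ?case by (auto intro!: forall_prop stable_prop pstable_forall)
next
  case (eq_form k \<Gamma> A a b)
  then show ?case by (auto intro!: eq_prop stable_prop pstable_eq)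
next
  case (n0_form \<Gamma>)
  then show ?case using derives.n0_form[of emTT_imp "map tr_ty \<Gamma>"] by (simp add: stable_n0)
next
  case (n1_form \<Gamma>)
  then show ?case using derives.n1_form[of emTT_imp "map tr_ty \<Gamma>"] by (simp add: stable_n1)
next
  case (list_form \<Gamma> A)
  then show ?case by (simp add: list_col stable_list)
next
  case (plus_form \<Gamma> A B)
  then show ?case by (simp add: plus_col stable_plus)
next
  case (sigma_form k \<Gamma> A B)
  then show ?case by (auto simp: sigma_col stable_sigma)
next
  case (pi_form \<Gamma> A B)
  then show ?case by (simp add: pi_col stable_pi)
next
  case (quot_form \<Gamma> A R)
  have *: "map tr_ty \<Gamma> \<tturnstile> Ty Set (Quot (tr_ty A) (tr_ty R))"
    by (rule derives.quot_form) (use quot_form in \<open>simp_all add: tr_subst tr_sub_scons tr_sub_shift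
      tr_sub_Var\<close>)
  then show ?case using quot_form by (simp add: stable_quot tr_subst tr_sub_shift tr_sub_Var)
next
  case (p1_form \<Gamma>)
  then show ?case by (simp add: P1nn_col stable_P1nn)
next
  case (top1_form \<Gamma> A)
  then have A: "map tr_ty \<Gamma> \<tturnstile> Ty Col (tr_ty A)" by simp
  from pi_col[OF A] stable_pi[OF A] P1nn_col[OF ctx_cons[OF A]] stable_P1nn[OF ctx_cons[OF A]]
  show ?case by simp
next
  case (top1_form_cong \<Gamma> A A')
  then have e: "map tr_ty \<Gamma> \<tturnstile> TyEq Col (tr_ty A) (tr_ty A')" by simp
  \<comment> \<open>reflexivity of \<open>P1nn\<close> is needed in the context extended by \<open>A\<close>\<close>
  have "tr_ty A # map tr_ty \<Gamma> \<tturnstile> TyEq Col P1nn P1nn"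
    by (rule ty_refl[OF P1nn_col[OF ctx_cons[OF presuppositions[OF e, simplified, THEN conjunct1]]]])
  then show ?case using derives.pi_form_cong[of emTT_imp "map tr_ty \<Gamma>" "tr_ty A" "tr_ty A'" P1nn P1nn]
      e by simp
next
  case (disj_intro1 \<Gamma> \<phi> \<psi>)
  then show ?case by (simp add: nn_I disj_prop derives.disj_intro1)
next
  case (disj_intro2 \<Gamma> \<phi> \<psi>)
  then show ?case by (simp add: nn_I disj_prop derives.disj_intro2)
next
  case (disj_elim \<Gamma> \<phi> \<psi> \<chi>)
  then show ?case using disj_elim_nn[of "map tr_ty \<Gamma>" "tr_ty \<phi>" "tr_ty \<psi>" "tr_ty \<chi>"]
    by (simp add: tr_subst tr_sub_shift tr_sub_Var)
next
  case (exi_intro \<Gamma> A \<phi> a)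
  then show ?case
    using nn_I[OF exi_prop derives.exi_intro, of "map tr_ty \<Gamma>" "tr_ty A" "tr_ty \<phi>" "tr_tm a"]
    by (simp add: tr_subst tr_sub_scons tr_sub_shift tr_sub_Var)
next
  case (exi_elim \<Gamma> A \<phi> \<chi>)
  then show ?case using exi_elim_nn[of "map tr_ty \<Gamma>" "tr_ty A" "tr_ty \<phi>" "tr_ty \<chi>"]
    by (simp add: tr_subst tr_sub_shift tr_sub_Var)
next
  case (top1_intro \<Gamma> A b)
  then have A: "map tr_ty \<Gamma> \<tturnstile> Ty Col (tr_ty A)" by simp
  show ?case using top1_intro derives.pi_intro[of emTT_imp "map tr_ty \<Gamma>" "tr_ty A" P1nn "tr_tm b"]
      P1nn_col[OF ctx_cons[OF A]] by simp
next
  case (top1_intro_cong \<Gamma> A b b')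
  then have A: "map tr_ty \<Gamma> \<tturnstile> Ty Col (tr_ty A)" by simp
  show ?case using top1_intro_cong derives.pi_intro_cong[of emTT_imp "map tr_ty \<Gamma>" "tr_ty A" P1nn
      "tr_tm b" "tr_tm b'"]
      P1nn_col[OF ctx_cons[OF A]] by simp
next
  case (top1_elim \<Gamma> A f a)
  then have A: "map tr_ty \<Gamma> \<tturnstile> Ty Col (tr_ty A)" by simp
  show ?case using top1_elim derives.pi_elim[of emTT_imp "map tr_ty \<Gamma>" "tr_ty A" P1nn "tr_tm f"
      "tr_tm a"]
      P1nn_col[OF ctx_cons[OF A]] by simp
next
  case (top1_elim_cong \<Gamma> A f f' a a')
  then have A: "map tr_ty \<Gamma> \<tturnstile> Ty Col (tr_ty A)" by simp
  show ?case using top1_elim_cong derives.pi_elim_cong[of emTT_imp "map tr_ty \<Gamma>" "tr_ty A" P1nn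
      "tr_tm f" "tr_tm f'" "tr_tm a" "tr_tm a'"]
      P1nn_col[OF ctx_cons[OF A]] by simp
next
  case (top1_beta \<Gamma> A b a)
  then have A: "map tr_ty \<Gamma> \<tturnstile> Ty Col (tr_ty A)" by simp
  show ?case using top1_beta derives.pi_beta[of emTT_imp "map tr_ty \<Gamma>" "tr_ty A" P1nn "tr_tm b"
      "tr_tm a"]
      P1nn_col[OF ctx_cons[OF A]] by (simp add: tr_subst tr_sub_scons tr_sub_shift tr_sub_Var)
next
  case (top1_eta \<Gamma> A f)
  then have A: "map tr_ty \<Gamma> \<tturnstile> Ty Col (tr_ty A)" by simp
  show ?case using top1_eta derives.pi_eta[of emTT_imp "map tr_ty \<Gamma>" "tr_ty A" P1nn "tr_tm f"]
      P1nn_col[OF ctx_cons[OF A]] by (simp add: tr_subst tr_sub_shift tr_sub_Var)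
next
  case (code_intro \<Gamma> \<phi>)
  then show ?case by (simp add: P1nn_cls code_tm)
next
  case (code_cong \<Gamma> \<phi> \<psi>)
  then have "map tr_ty \<Gamma> \<tturnstile> TmEq (Code (tr_ty \<phi>)) (Code (tr_ty \<psi>)) P1"
    using derives.code_cong[of emTT_imp] by simp
  from P1nn_cls_cong[OF this] show ?case by simp
next
  case (code_eq \<Gamma> \<phi> \<psi>)
  then show ?case by (simp add: P1nn_cls_cong code_eqI)
next
  case (code_eff \<Gamma> \<phi> \<psi>)
  then show ?case by (simp add: P1nn_code_eff)
next
  case (code_eta \<Gamma> U)
  then show ?case by (simp add: P1nn_code_eta)
qed (simp only: tr_rules; (elim conjE)?; rule derives.intros; (assumption | simp))+

section \<open>Equiconsistency\<close>

text \<open>Every side condition that admits a rule in \<open>emTT_imp\<close> admits it in \<open>emTT_imp_c\<close>.\<close>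

lemma imp_into_imp_c: "emTT_imp \<rhd> \<Gamma> \<turnstile> J \<Longrightarrow> emTT_imp_c \<rhd> \<Gamma> \<turnstile> J"
  by (induction rule: derives.induct)
    (rule derives.intros; (assumption | blast))+

theorem proposition10:
  shows "consistent emTT_imp_c \<longleftrightarrow> consistent emTT_imp"
proof
  show "consistent emTT_imp_c \<Longrightarrow> consistent emTT_imp"
    unfolding consistent_def by (blast dest: imp_into_imp_c)
  show "consistent emTT_imp \<Longrightarrow> consistent emTT_imp_c"
    unfolding consistent_def using tr_sound[of "[]" "Tm TT Bot"] by auto
qed

end
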